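(* Let $\mathcal{G}_h$ be a cubical mesh of a bounded domain $\Omega\subset\mathbb{R}^n$ and let $0\le k\le n$. Then $$W^{\rm def}_h\Lambda^k\supset\{\mathbb{I}^{d^k}_h\omega_h:\omega_h\in V^{\mathcal{Q}}_h\Lambda^k\}\qquad\text{and}\qquad W^{\rm def}_{h0}\Lambda^k\supset\{\mathbb{I}^{d^k}_h\omega_h:\omega_h\in V^{\mathcal{Q}}_{h0}\Lambda^k\}.$$
   Context: Forms. For a domain $\Xi\subset\mathbb{R}^n$, $L^2\Lambda^k(\Xi)$ is the Hilbert space of differential $k$-forms with $L^2(\Xi)$ coefficients, with the componentwise inner product $\langle\cdot,\cdot\rangle_{L^2\Lambda^k(\Xi)}$; $d^k$ is the exterior derivative on $k$-forms (weak sense; $d^n=0$); $\star$ is the Euclidean Hodge star; the codifferential is $\delta_k=(-1)^{n(k+1)+1}\star d^{n-k}\star$ on $k$-forms, i.e. the formal $L^2$-adjoint of $d^{k-1}$. $H\Lambda^k(\Xi)=\{\omega\in L^2\Lambda^k(\Xi): d^k\omega\in L^2\Lambda^{k+1}(\Xi)\}$ (with $H\Lambda^n=L^2\Lambda^n$), $H^*\Lambda^k(\Xi)=\{\mu\in L^2\Lambda^k(\Xi):\delta_k\mu\in L^2\Lambda^{k-1}(\Xi)\}$, and $H_0\Lambda^k(\Xi)$, $H^*_0\Lambda^k(\Xi)$ are the closures of $\mathcal{C}^\infty_0\Lambda^k(\Xi)$ in $H\Lambda^k(\Xi)$, $H^*\Lambda^k(\Xi)$ in the graph norms. Mesh. A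 cubical mesh $\mathcal{G}_h$ of $\Omega$ is a finite (face-to-face) subdivision of $\Omega$ into $n$-dimensional boxes $K$ (products of intervals, edges parallel to the coordinate axes). Local spaces. $\mathcal{P}_0\Lambda^k$ is the space of constant-coefficient $k$-forms. The Koszul operator is $\kappa(dx^{\alpha_1}\wedge\dots\wedge dx^{\alpha_k})=\sum_{j=1}^k(-1)^{j+1}x_{\alpha_j}dx^{\alpha_1}\wedge\dots\widehat{dx^{\alpha_j}}\dots\wedge dx^{\alpha_k}$ (linear over functions). Whitney forms: $\mathcal{P}^-_1\Lambda^k=\mathcal{P}_0\Lambda^k+\kappa(\mathcal{P}_0\Lambda^{k+1})$ (so $\mathcal{P}^-_1\Lambda^n=\mathcal{P}_0\Lambda^n$), and $\mathcal{P}^{*,-}_1\Lambda^k=\star(\mathcal{P}^-_1\Lambda^{n-k})$. For a box $K=I_1\times\dots\times I_n$, $\mathcal{Q}^-_1\Lambda^k(K)=\bigoplus_{\alpha}\big[\bigotimes_{i=1}^n\mathcal{P}_{1-\delta_{i,\alpha}}(I_i)\big]dx^{\alpha_1}\wedge\dots\wedge dx^{\alpha_k}$, the sum over $1\le\alpha_1<\dots<\alpha_k\le n$, where $\delta_{i,\alpha}=1$ if $i\in\{\alpha_1,\dots,\alpha_k\}$ and $0$ otherwise, and $\mathcal{P}_r(I)$ denotes univariate polynomials of degree at most $r$. $\mathcal{Q}^{*,-}_1\Lambda^k(K)=\star(\mathcal{Q}^-_1\Lambda^{n-k}(K))$. Interpolator. For $0\le k\le n-1$ and a box $K$, $\mathbb{I}^{d^k}_K:H\Lambda^k(K)\to\mathcal{P}^-_1\Lambda^k(K)$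 is the (well-defined) operator determined by $$\langle d^k\mathbb{I}^{d^k}_K\omega,\mu\rangle_{L^2\Lambda^{k+1}(K)}-\langle\mathbb{I}^{d^k}_K\omega,\delta_{k+1}\mu\rangle_{L^2\Lambda^k(K)}=\langle d^k\omega,\mu\rangle_{L^2\Lambda^{k+1}(K)}-\langle\omega,\delta_{k+1}\mu\rangle_{L^2\Lambda^k(K)}\quad\forall\mu\in\mathcal{P}^{*,-}_1\Lambda^{k+1}(K).$$ For $k=n$, $\mathbb{I}^{d^n}_K$ is the $L^2$ projection onto $\mathcal{P}_0\Lambda^n$ on $K$. Globally $(\mathbb{I}^{d^k}_h\omega)|_K=\mathbb{I}^{d^k}_K(\omega|_K)$ for all $K\in\mathcal{G}_h$. Global spaces. $\mathcal{P}^-_1\Lambda^k(\mathcal{G}_h)=\prod_{K\in\mathcal{G}_h}\mathcal{P}^-_1\Lambda^k(K)$. $V^{\mathcal{Q}}_h\Lambda^k$ (resp. $V^{\mathcal{Q}}_{h0}\Lambda^k$) is the set of $\omega\in H\Lambda^k(\Omega)$ (resp. $H_0\Lambda^k(\Omega)$) with $\omega|_K\in\mathcal{Q}^-_1\Lambda^k(K)$ for all $K\in\mathcal{G}_h$. $V^{\mathcal{Q},*}_{h}\Lambda^{k}$ (resp. $V^{\mathcal{Q},*}_{h0}\Lambda^{k}$) is the set of $\mu\in H^*\Lambda^{k}(\Omega)$ (resp. $H^*_0\Lambda^{k}(\Omega)$) with $\mu|_K\in\mathcal{Q}^{*,-}_1\Lambda^{k}(K)$ for all $K\in\mathcal{G}_h$.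 Define $$W^{\rm def}_h\Lambda^k=\Big\{\omega_h\in\mathcal{P}^-_1\Lambda^k(\mathcal{G}_h):\sum_{K\in\mathcal{G}_h}\langle d^k\omega_h,\mu_h\rangle_{L^2\Lambda^{k+1}(K)}-\langle\omega_h,\delta_{k+1}\mu_h\rangle_{L^2\Lambda^k(K)}=0\ \ \forall\mu_h\in V^{\mathcal{Q},*}_{h0}\Lambda^{k+1}\Big\},$$ and $W^{\rm def}_{h0}\Lambda^k$ by the same formula with $V^{\mathcal{Q},*}_{h0}\Lambda^{k+1}$ replaced by $V^{\mathcal{Q},*}_{h}\Lambda^{k+1}$. For $k=n$ the condition is void (there are no nonzero $(n+1)$-forms), so $W^{\rm def}_h\Lambda^n=W^{\rm def}_{h0}\Lambda^n=\mathcal{P}_0\Lambda^n(\mathcal{G}_h)$, the piecewise constant $n$-forms. *)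

theory Defs
  imports "HOL-Analysis.Analysis"
begin

text \<open>A strictly increasing multi-index is identified with the set of its entries, so an element
  of the exterior algebra of the coordinate space is its vector of coefficients indexed by sets of
  coordinates. Its inner product is then the componentwise one, and the basis forms are
  orthonormal. The linear order on the index type is the order of the coordinates.\<close>

type_synonym 'n point = "real ^ 'n"
type_synonym 'n ext = "real ^ ('n set)"
type_synonym 'n dform = "'n point \<Rightarrow> 'n ext"

definition dx :: "'n::finite set \<Rightarrow> 'n ext" where
  "dx \<alpha> = axis \<alpha> 1"

definition alt :: "nat \<Rightarrow> 'n::finite ext set" where
  "alt k = {v. \<forall>\<alpha>. card \<alpha> \<noteq> k \<longrightarrow> v $ \<alpha> = 0}"

text \<open>If \<open>i\<close> is the \<open>j\<close>-th smallest element of \<open>\<alpha>\<close>, this is \<open>(-1) ^ (j + 1)\<close>. It is also the sign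
  for which \<open>dx {i} \<and> dx (\<alpha> - {i})\<close> equals this sign times \<open>dx \<alpha>\<close>.\<close>

definition pos_sign :: "'n::{finite,linorder} \<Rightarrow> 'n set \<Rightarrow> real" where
  "pos_sign i \<alpha> = (-1) ^ card {j \<in> \<alpha>. j < i}"

definition shuffle_sign :: "'n::{finite,linorder} set \<Rightarrow> 'n set \<Rightarrow> real" where
  "shuffle_sign \<alpha> \<beta> = (-1) ^ card {(i, j). i \<in> \<alpha> \<and> j \<in> \<beta> \<and> j < i}"

text \<open>Normalised by \<open>dx \<alpha> \<and> \<star>(dx \<alpha>) = dx UNIV\<close>.\<close>

definition hodge :: "'n::{finite,linorder} ext \<Rightarrow> 'n ext" where
  "hodge v = (\<Sum>\<alpha>\<in>UNIV. (v $ \<alpha> * shuffle_sign \<alpha> (- \<alpha>)) *\<^sub>R dx (- \<alpha>))"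

definition koszul :: "'n::{finite,linorder} point \<Rightarrow> 'n ext \<Rightarrow> 'n ext" where
  "koszul x v = (\<Sum>\<alpha>\<in>UNIV. v $ \<alpha> *\<^sub>R (\<Sum>i\<in>\<alpha>. (pos_sign i \<alpha> * x $ i) *\<^sub>R dx (\<alpha> - {i})))"

definition partial_deriv :: "'n::finite \<Rightarrow> ('n point \<Rightarrow> real) \<Rightarrow> 'n point \<Rightarrow> real" where
  "partial_deriv i f x = frechet_derivative f (at x) (axis i 1)"

fun cont_diff :: "nat \<Rightarrow> ('n::finite point \<Rightarrow> real) \<Rightarrow> bool" where
  "cont_diff 0 f \<longleftrightarrow> continuous_on UNIV f"
| "cont_diff (Suc m) f \<longleftrightarrow>
     (\<forall>x. f differentiable (at x)) \<and> (\<forall>i. cont_diff m (partial_deriv i f))"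

text \<open>An element of \<open>C\<^sub>0\<^sup>\<infinity>(\<Xi>)\<close> is represented by its extension by zero.\<close>

definition test_function :: "'n::finite point set \<Rightarrow> ('n point \<Rightarrow> real) \<Rightarrow> bool" where
  "test_function \<Xi> \<phi> \<longleftrightarrow>
     (\<forall>m. cont_diff m \<phi>) \<and> (\<exists>C. compact C \<and> C \<subseteq> \<Xi> \<and> (\<forall>x. x \<notin> C \<longrightarrow> \<phi> x = 0))"

definition test_form :: "nat \<Rightarrow> 'n::finite point set \<Rightarrow> 'n dform set" where
  "test_form k \<Xi> = {\<phi>. (\<forall>x. \<phi> x \<in> alt k) \<and> (\<forall>\<alpha>. test_function \<Xi> (\<lambda>x. \<phi> x $ \<alpha>))}"

text \<open>Elements of \<open>L\<^sup>2\<close> are handled through representatives. All notions below depend only on the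
  values of a form on \<open>\<Xi>\<close>, so that restricting a form to a subdomain only means
  replacing \<open>\<Xi>\<close>.\<close>

definition L2form :: "nat \<Rightarrow> 'n::finite point set \<Rightarrow> 'n dform set" where
  "L2form k \<Xi> = {\<omega>. (\<forall>x\<in>\<Xi>. \<omega> x \<in> alt k) \<and> \<omega> \<in> borel_measurable (lebesgue_on \<Xi>)
      \<and> integrable (lebesgue_on \<Xi>) (\<lambda>x. (norm (\<omega> x))\<^sup>2)}"

definition L2inner :: "'n::finite point set \<Rightarrow> 'n dform \<Rightarrow> 'n dform \<Rightarrow> real" where
  "L2inner \<Xi> \<omega> \<mu> = (LINT x|lebesgue_on \<Xi>. \<omega> x \<bullet> \<mu> x)"

text \<open>For a smooth \<open>k\<close>-form, the coefficient of \<open>d\<omega>\<close> at \<open>\<beta>\<close> is the sum over \<open>i \<in> \<beta>\<close> of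
  \<open>pos_sign i \<beta>\<close> times the \<open>i\<close>-th partial derivative of the coefficient at
  \<open>\<beta> - {i}\<close>; the weak version reads this in the sense of distributions. If \<open>k\<close> is the
  dimension there is no \<open>\<beta>\<close>, and \<open>d\<omega> = 0\<close> on \<open>\<Xi>\<close> because \<open>alt (Suc k) = {0}\<close>.\<close>

definition has_extd :: "nat \<Rightarrow> 'n::{finite,linorder} point set \<Rightarrow> 'n dform \<Rightarrow> 'n dform \<Rightarrow> bool" where
  "has_extd k \<Xi> \<omega> \<eta> \<longleftrightarrow> \<eta> \<in> L2form (Suc k) \<Xi> \<and>
     (\<forall>\<beta> \<phi>. card \<beta> = Suc k \<and> test_function \<Xi> \<phi> \<longrightarrow>
        (LINT x|lebesgue_on \<Xi>. \<eta> x $ \<beta> * \<phi> x) =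
        - (LINT x|lebesgue_on \<Xi>. (\<Sum>i\<in>\<beta>. pos_sign i \<beta> * \<omega> x $ (\<beta> - {i}) * partial_deriv i \<phi> x)))"

text \<open>The derivative is determined up to a null set; \<open>extd\<close> chooses a representative.\<close>

definition extd :: "nat \<Rightarrow> 'n::{finite,linorder} point set \<Rightarrow> 'n dform \<Rightarrow> 'n dform" where
  "extd k \<Xi> \<omega> = (SOME \<eta>. has_extd k \<Xi> \<omega> \<eta>)"

definition has_codiff :: "nat \<Rightarrow> 'n::{finite,linorder} point set \<Rightarrow> 'n dform \<Rightarrow> 'n dform \<Rightarrow> bool" where
  "has_codiff k \<Xi> \<mu> \<nu> \<longleftrightarrow>
     (\<exists>\<eta>. has_extd (CARD('n) - k) \<Xi> (\<lambda>x. hodge (\<mu> x)) \<eta> \<and>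
          \<nu> = (\<lambda>x. (-1) ^ (CARD('n) * (k + 1) + 1) *\<^sub>R hodge (\<eta> x)))"

definition codiff :: "nat \<Rightarrow> 'n::{finite,linorder} point set \<Rightarrow> 'n dform \<Rightarrow> 'n dform" where
  "codiff k \<Xi> \<mu> = (SOME \<nu>. has_codiff k \<Xi> \<mu> \<nu>)"

definition HL :: "nat \<Rightarrow> 'n::{finite,linorder} point set \<Rightarrow> 'n dform set" where
  "HL k \<Xi> = {\<omega> \<in> L2form k \<Xi>. \<exists>\<eta>. has_extd k \<Xi> \<omega> \<eta>}"

definition HLstar :: "nat \<Rightarrow> 'n::{finite,linorder} point set \<Rightarrow> 'n dform set" where
  "HLstar k \<Xi> = {\<mu> \<in> L2form k \<Xi>. \<exists>\<nu>. has_codiff k \<Xi> \<mu> \<nu>}"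

definition graph_norm ::
    "('n dform \<Rightarrow> 'n dform) \<Rightarrow> 'n::finite point set \<Rightarrow> 'n dform \<Rightarrow> real" where
  "graph_norm D \<Xi> \<omega> = sqrt (L2inner \<Xi> \<omega> \<omega> + L2inner \<Xi> (D \<omega>) (D \<omega>))"

definition HL0 :: "nat \<Rightarrow> 'n::{finite,linorder} point set \<Rightarrow> 'n dform set" where
  "HL0 k \<Xi> = {\<omega> \<in> HL k \<Xi>.
     \<forall>\<epsilon>>0. \<exists>\<phi>\<in>test_form k \<Xi>. graph_norm (extd k \<Xi>) \<Xi> (\<lambda>x. \<omega> x - \<phi> x) < \<epsilon>}"

definition HLstar0 :: "nat \<Rightarrow> 'n::{finite,linorder} point set \<Rightarrow> 'n dform set" where
  "HLstar0 k \<Xi> = {\<mu> \<in> HLstar k \<Xi>.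
     \<forall>\<epsilon>>0. \<exists>\<phi>\<in>test_form k \<Xi>. graph_norm (codiff k \<Xi>) \<Xi> (\<lambda>x. \<mu> x - \<phi> x) < \<epsilon>}"

text \<open>Cells are closed boxes; function spaces on a cell are taken on its interior. The domain is
  not required to be the interior of the union of the cells, so it may for instance have slits
  along cell faces.\<close>

definition cubical_mesh :: "'n::finite point set \<Rightarrow> 'n point set set \<Rightarrow> bool" where
  "cubical_mesh \<Omega> \<G> \<longleftrightarrow> \<G> division_of (closure \<Omega>)
     \<and> (\<forall>K\<in>\<G>. interior K \<noteq> {} \<and> interior K \<subseteq> \<Omega>)
     \<and> (\<forall>K\<in>\<G>. \<forall>K'\<in>\<G>. (K \<inter> K') face_of K)"

text \<open>Polynomial forms are functions on the whole space. They are determined by their restriction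
  to any box with nonempty interior, so the cell is not a parameter.\<close>

definition P0 :: "nat \<Rightarrow> 'n::finite dform set" where
  "P0 k = {\<lambda>x. v |v. v \<in> alt k}"

definition P1minus :: "nat \<Rightarrow> 'n::{finite,linorder} dform set" where
  "P1minus k = {\<lambda>x. p x + koszul x (q x) |p q. p \<in> P0 k \<and> q \<in> P0 (Suc k)}"

definition P1minus_star :: "nat \<Rightarrow> 'n::{finite,linorder} dform set" where
  "P1minus_star k = (\<lambda>\<omega> x. hodge (\<omega> x)) ` P1minus (CARD('n) - k)"

text \<open>The tensor product over \<open>i\<close> of the univariate polynomials of degree at most \<open>r i\<close>: finite sums
  of products of univariate polynomials.\<close>

definition tensor_poly :: "('n::finite \<Rightarrow> nat) \<Rightarrow> ('n point \<Rightarrow> real) set" where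
  "tensor_poly r = {\<lambda>x. \<Sum>j<m. \<Prod>i\<in>UNIV. poly (p j i) (x $ i)
      |(m::nat) (p :: nat \<Rightarrow> 'n \<Rightarrow> real poly). \<forall>j<m. \<forall>i. degree (p j i) \<le> r i}"

definition Q1minus :: "nat \<Rightarrow> 'n::finite dform set" where
  "Q1minus k = {\<omega>. (\<forall>x. \<omega> x \<in> alt k) \<and>
     (\<forall>\<alpha>. card \<alpha> = k \<longrightarrow> (\<lambda>x. \<omega> x $ \<alpha>) \<in> tensor_poly (\<lambda>i. 1 - (if i \<in> \<alpha> then 1 else 0)))}"

definition Q1minus_star :: "nat \<Rightarrow> 'n::{finite,linorder} dform set" where
  "Q1minus_star k = (\<lambda>\<omega> x. hodge (\<omega> x)) ` Q1minus (CARD('n) - k)"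

definition dpair ::
    "nat \<Rightarrow> 'n::{finite,linorder} point set \<Rightarrow> 'n dform \<Rightarrow> 'n dform \<Rightarrow> real" where
  "dpair k \<Xi> \<omega> \<mu> = L2inner \<Xi> (extd k \<Xi> \<omega>) \<mu> - L2inner \<Xi> \<omega> (codiff (Suc k) \<Xi> \<mu>)"

definition interp :: "nat \<Rightarrow> 'n::{finite,linorder} point set \<Rightarrow> 'n dform \<Rightarrow> 'n dform" where
  "interp k \<Xi> \<omega> =
     (if k < CARD('n)
      then THE \<sigma>. \<sigma> \<in> P1minus k \<and> (\<forall>\<mu>\<in>P1minus_star (Suc k). dpair k \<Xi> \<sigma> \<mu> = dpair k \<Xi> \<omega> \<mu>)
      else THE \<sigma>. \<sigma> \<in> P0 k \<and> (\<forall>\<mu>\<in>P0 k. L2inner \<Xi> \<sigma> \<mu> = L2inner \<Xi> \<omega> \<mu>))"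

text \<open>Piecewise polynomial forms are families indexed by the cells, i.e. elements of the product of
  the local spaces.\<close>

definition interp_mesh ::
    "nat \<Rightarrow> 'n::{finite,linorder} point set set \<Rightarrow> 'n dform \<Rightarrow> ('n point set \<Rightarrow> 'n dform)" where
  "interp_mesh k \<G> \<omega> = (\<lambda>K\<in>\<G>. interp k (interior K) \<omega>)"

definition P1minus_mesh ::
    "nat \<Rightarrow> 'n::{finite,linorder} point set set \<Rightarrow> ('n point set \<Rightarrow> 'n dform) set" where
  "P1minus_mesh k \<G> = (\<Pi>\<^sub>E K\<in>\<G>. P1minus k)"

definition piecewise_in ::
    "'n::finite point set set \<Rightarrow> 'n dform set \<Rightarrow> 'n dform \<Rightarrow> bool" where
  "piecewise_in \<G> S \<omega> \<longleftrightarrow> (\<forall>K\<in>\<G>. \<exists>q\<in>S. AE x in lebesgue_on (interior K). \<omega> x = q x)"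

definition VQ :: "nat \<Rightarrow> 'n::{finite,linorder} point set \<Rightarrow> 'n point set set \<Rightarrow> 'n dform set" where
  "VQ k \<Omega> \<G> = {\<omega> \<in> HL k \<Omega>. piecewise_in \<G> (Q1minus k) \<omega>}"

definition VQ0 :: "nat \<Rightarrow> 'n::{finite,linorder} point set \<Rightarrow> 'n point set set \<Rightarrow> 'n dform set" where
  "VQ0 k \<Omega> \<G> = {\<omega> \<in> HL0 k \<Omega>. piecewise_in \<G> (Q1minus k) \<omega>}"

definition VQstar :: "nat \<Rightarrow> 'n::{finite,linorder} point set \<Rightarrow> 'n point set set \<Rightarrow> 'n dform set" where
  "VQstar k \<Omega> \<G> = {\<mu> \<in> HLstar k \<Omega>. piecewise_in \<G> (Q1minus_star k) \<mu>}"

definition VQstar0 :: "nat \<Rightarrow> 'n::{finite,linorder} point set \<Rightarrow> 'n point set set \<Rightarrow> 'n dform set" where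
  "VQstar0 k \<Omega> \<G> = {\<mu> \<in> HLstar0 k \<Omega>. piecewise_in \<G> (Q1minus_star k) \<mu>}"

text \<open>The guard \<open>k < CARD('n)\<close> makes the condition void in top degree, where \<open>P1minus k = P0 k\<close>.\<close>

definition Wdef ::
    "nat \<Rightarrow> 'n::{finite,linorder} point set \<Rightarrow> 'n point set set \<Rightarrow>
     ('n point set \<Rightarrow> 'n dform) set" where
  "Wdef k \<Omega> \<G> = {\<sigma> \<in> P1minus_mesh k \<G>. k < CARD('n) \<longrightarrow>
     (\<forall>\<mu>\<in>VQstar0 (Suc k) \<Omega> \<G>. (\<Sum>K\<in>\<G>. dpair k (interior K) (\<sigma> K) \<mu>) = 0)}"

definition Wdef0 ::
    "nat \<Rightarrow> 'n::{finite,linorder} point set \<Rightarrow> 'n point set set \<Rightarrow>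
     ('n point set \<Rightarrow> 'n dform) set" where
  "Wdef0 k \<Omega> \<G> = {\<sigma> \<in> P1minus_mesh k \<G>. k < CARD('n) \<longrightarrow>
     (\<forall>\<mu>\<in>VQstar (Suc k) \<Omega> \<G>. (\<Sum>K\<in>\<G>. dpair k (interior K) (\<sigma> K) \<mu>) = 0)}"

end

theory Submission
  imports Defs
begin

text \<open>
  On a box with midpoint \<open>c\<close> write \<open>B(\<omega>, \<mu>) = \<langle>d\<omega>, \<mu>\<rangle> - \<langle>\<omega>, \<delta>\<mu>\<rangle>\<close> for the pairing in the definition of
  the interpolator. The heart of the argument is a one-point formula (\<open>dpair_midpoint\<close>): if \<open>\<omega>\<close>
  belongs to the tensor product family \<open>Q1minus k\<close> and \<open>\<mu>\<close> to \<open>Q1minus_star (k + 1)\<close>, then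
  \<open>B(\<omega>, \<mu>) = |K| (d\<omega>(c) \<bullet> \<mu>(c) - \<omega>(c) \<bullet> \<delta>\<mu>(c))\<close>. Indeed the coefficient of \<open>\<omega>\<close> at \<open>\<alpha>\<close> depends only on the
  coordinates outside \<open>\<alpha>\<close>, and so does that of \<open>d\<omega>\<close>; the coefficients of \<open>\<mu>\<close> and \<open>\<delta>\<mu>\<close> at \<open>\<alpha>\<close> depend
  only on the coordinates in \<open>\<alpha>\<close>. All of them have degree at most one in each variable,
  hence so have the products that occur in \<open>B(\<omega>, \<mu>)\<close>, and the mean over a box of such a
  polynomial is its value at the midpoint (\<open>integral_multi_affine\<close>).

  Since \<open>d (koszul x w) = (k + 1) w\<close> for constant \<open>w\<close>, some Whitney form \<open>\<sigma>\<close> has the same value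
  and the same exterior derivative at \<open>c\<close> as a given \<open>\<omega>\<close> in \<open>Q1minus k\<close> (\<open>P1minus_jet\<close>). By the
  one-point formula \<open>B(\<sigma>, \<mu>) = B(\<omega>, \<mu>)\<close> for all \<open>\<mu>\<close> in \<open>Q1minus_star (k + 1)\<close>, which contains the Whitney
  forms used to define the interpolator. So \<open>\<sigma>\<close> is the interpolant of \<open>\<omega>\<close>, and interpolation
  preserves the pairing with the whole tensor product family (\<open>interp_Q1minus\<close>).

  Summing over the cells, the interpolant of \<open>\<omega>\<close> may be replaced by \<open>\<omega>\<close> itself, and the sum
  becomes \<open>\<langle>d\<omega>, \<mu>\<rangle> - \<langle>\<omega>, \<delta>\<mu>\<rangle>\<close> over \<open>\<Omega>\<close>. This vanishes as soon as one of the two forms is a limit of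
  test forms in the graph norm (\<open>HLstar0_green\<close>, \<open>HL0_green\<close>).

  Because \<open>extd\<close> and \<open>codiff\<close> are chosen representatives, weak derivatives must be shown to be
  unique up to null sets. This is the fundamental lemma of the calculus of variations, proved
  with explicit smooth bump functions. The operators \<open>d\<close> and \<open>\<delta>\<close> are treated simultaneously as
  constant-coefficient operators \<open>\<Sum>\<^sub>i A i \<partial>\<^sub>i\<close>, whose symbols \<open>A i\<close> are the exterior product with \<open>dx {i}\<close> and
  its negative adjoint.
\<close>

section \<open>Smooth functions and bump functions\<close>

lemma partial_deriv_eq:
  assumes "(f has_derivative f') (at x)"
  shows "partial_deriv i f x = f' (axis i 1)"
  using frechet_derivative_at[OF assms] unfolding partial_deriv_def by simp

lemma partial_deriv_has_derivative:
  assumes "f differentiable (at x)"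
  shows "(f has_derivative frechet_derivative f (at x)) (at x)"
  using assms frechet_derivative_works by blast

lemma cont_diff_const: "cont_diff m (\<lambda>x::'n::finite point. c)"
proof (induction m arbitrary: c)
  case (Suc m)
  have "partial_deriv i (\<lambda>x::'n point. c) = (\<lambda>x. 0)" for i
    by (rule ext, subst partial_deriv_eq[OF has_derivative_const]) simp
  then show ?case using Suc by simp
qed simp

lemma cont_diff_continuous:
  assumes "cont_diff m f" shows "continuous_on UNIV f"
proof (cases m)
  case (Suc l)
  then show ?thesis using assms
    by (simp add: differentiable_imp_continuous_within continuous_on_eq_continuous_within)
qed (use assms in simp)

lemma cont_diff_Suc_imp: "cont_diff (Suc m) f \<Longrightarrow> cont_diff m f"
proof (induction m arbitrary: f)
  case 0
  then show ?case using cont_diff_continuous by (metis cont_diff.simps(1))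
next
  case (Suc m)
  then show ?case by (metis cont_diff.simps(2))
qed

lemma partial_deriv_add:
  assumes "f differentiable (at x)" "g differentiable (at x)"
  shows "partial_deriv i (\<lambda>x. f x + g x) x = partial_deriv i f x + partial_deriv i g x"
  by (subst partial_deriv_eq[OF has_derivative_add[OF assms[THEN partial_deriv_has_derivative]]])
    (simp add: partial_deriv_def)

lemma partial_deriv_mult:
  fixes f g :: "'n::finite point \<Rightarrow> real"
  assumes "f differentiable (at x)" "g differentiable (at x)"
  shows "partial_deriv i (\<lambda>x. f x * g x) x = partial_deriv i f x * g x + f x * partial_deriv i g x"
  by (subst partial_deriv_eq[OF has_derivative_mult[OF assms[THEN partial_deriv_has_derivative]]])
    (simp add: partial_deriv_def)

lemma cont_diff_add:
  "cont_diff m f \<Longrightarrow> cont_diff m g \<Longrightarrow> cont_diff m (\<lambda>x. f x + g x)"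
proof (induction m arbitrary: f g)
  case 0
  then show ?case by (auto intro: continuous_on_add)
next
  case (Suc m)
  have "partial_deriv i (\<lambda>x. f x + g x) = (\<lambda>x. partial_deriv i f x + partial_deriv i g x)" for i
    using Suc.prems by (intro ext partial_deriv_add) auto
  then show ?case using Suc by (auto intro: differentiable_add)
qed

lemma cont_diff_mult:
  "cont_diff m f \<Longrightarrow> cont_diff m g \<Longrightarrow> cont_diff m (\<lambda>x. f x * g x)"
proof (induction m arbitrary: f g)
  case 0
  then show ?case by (auto intro: continuous_on_mult)
next
  case (Suc m)
  have "partial_deriv i (\<lambda>x. f x * g x)
      = (\<lambda>x. partial_deriv i f x * g x + f x * partial_deriv i g x)" for i
    using Suc.prems by (intro ext partial_deriv_mult) auto
  moreover have "cont_diff m f" "cont_diff m g"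
    using Suc.prems cont_diff_Suc_imp by blast+
  ultimately show ?case using Suc by (auto intro: differentiable_mult cont_diff_add)
qed

lemma cont_diff_sum:
  "(\<And>j. j \<in> J \<Longrightarrow> cont_diff m (f j)) \<Longrightarrow> cont_diff m (\<lambda>x. \<Sum>j\<in>J. f j x)"
  by (induction J rule: infinite_finite_induct) (auto intro: cont_diff_const cont_diff_add)

lemma cont_diff_prod:
  "(\<And>j. j \<in> J \<Longrightarrow> cont_diff m (f j)) \<Longrightarrow> cont_diff m (\<lambda>x. \<Prod>j\<in>J. f j x)"
  by (induction J rule: infinite_finite_induct) (auto intro: cont_diff_const cont_diff_mult)

text \<open>\<open>G\<close> lists the successive derivatives of \<open>G 0\<close>.\<close>

lemma cont_diff_comp_affine:
  assumes "\<And>l t. (G l has_real_derivative G (Suc l) t) (at t)"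
  shows "cont_diff m (\<lambda>x::'n::finite point. G l (c * x $ i + d))"
proof (induction m arbitrary: l)
  case 0
  have "continuous_on UNIV (G l)"
    using assms by (meson DERIV_continuous continuous_at_imp_continuous_on)
  moreover have "continuous_on UNIV (\<lambda>x::'n point. c * x $ i + d)"
    by (intro continuous_intros)
  ultimately show ?case
    using continuous_on_compose2[of UNIV "G l" UNIV "\<lambda>x::'n point. c * x $ i + d"] by simp
next
  case (Suc m)
  have d: "((\<lambda>x::'n point. G l (c * x $ i + d)) has_derivative
      (\<lambda>h. G (Suc l) (c * x $ i + d) * (c * h $ i))) (at x)" for x
  proof -
    have "((\<lambda>x::'n point. c * x $ i + d) has_derivative (\<lambda>h. c * h $ i)) (at x)"
      by (auto intro!: derivative_eq_intros bounded_linear_imp_has_derivative bounded_linear_vec_nth)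
    moreover have "(G l has_derivative (*) (G (Suc l) (c * x $ i + d))) (at (c * x $ i + d))"
      using assms by (simp add: has_field_derivative_def)
    ultimately show ?thesis
      by (rule has_derivative_compose)
  qed
  have "partial_deriv j (\<lambda>x::'n point. G l (c * x $ i + d))
      = (\<lambda>x. (c * axis j 1 $ i) * G (Suc l) (c * x $ i + d))" for j
    by (rule ext, subst partial_deriv_eq[OF d]) simp
  moreover have "(\<lambda>x::'n point. G l (c * x $ i + d)) differentiable (at x)" for x
    using d differentiable_def by blast
  ultimately show ?case
    by (simp, intro allI cont_diff_mult cont_diff_const Suc.IH)
qed

lemma cont_diff_coord: "cont_diff m (\<lambda>x::'n::finite point. x $ i)"
proof -
  let ?G = "\<lambda>l t::real. if l = (0::nat) then t else if l = 1 then 1 else 0"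
  have "(?G l has_real_derivative ?G (Suc l) t) (at t)" for l t
    by (cases "l = 0"; cases "l = 1") (auto intro!: derivative_eq_intros)
  from cont_diff_comp_affine[of ?G m 0 1 i 0, OF this] show ?thesis by simp
qed

text \<open>\<open>flat l\<close> is the \<open>l\<close>-th derivative of \<open>exp (-1/t)\<close>, extended by zero to \<open>t \<le> 0\<close>. It has the form
  \<open>p (1/t) exp (-1/t)\<close> with a polynomial \<open>p\<close>, here called \<open>flat_poly l\<close>; differentiation replaces
  \<open>p\<close> by \<open>u\<^sup>2 (p - p')\<close>.\<close>

definition flat_poly :: "nat \<Rightarrow> real poly" where
  "flat_poly l = ((\<lambda>p. [:0, 0, 1:] * (p - pderiv p)) ^^ l) 1"

definition flat :: "nat \<Rightarrow> real \<Rightarrow> real" where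
  "flat l t = (if t \<le> 0 then 0 else poly (flat_poly l) (inverse t) * exp (- inverse t))"

lemma poly_exp_tendsto_0: "((\<lambda>u::real. poly p u * exp (- u)) \<longlongrightarrow> 0) at_top"
proof -
  have "((\<lambda>u::real. \<Sum>i\<le>degree p. coeff p i * (u ^ i / exp u)) \<longlongrightarrow> (\<Sum>i\<le>degree p. coeff p i * 0)) at_top"
    by (intro tendsto_intros tendsto_power_div_exp_0)
  then show ?thesis
    by (simp add: poly_altdef sum_distrib_right exp_minus divide_inverse mult.assoc)
qed

lemma flat_has_derivative: "(flat l has_real_derivative flat (Suc l) t) (at t)"
proof -
  consider "t < 0" | "t = 0" | "t > 0" by linarith
  then show ?thesis
  proof cases
    case 1
    have "((\<lambda>t. 0) has_real_derivative flat (Suc l) t) (at t)" using 1 by (simp add: flat_def)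
    then show ?thesis
      by (rule DERIV_cong_ev[THEN iffD1, rotated 3])
        (use 1 in \<open>auto simp: flat_def intro!: eventually_mono[OF eventually_nhds_in_open[of "{..<0}"]]\<close>)
  next
    case 3
    have "((\<lambda>t. poly (flat_poly l) (inverse t) * exp (- inverse t)) has_real_derivative flat (Suc l) t) (at t)"
      using 3 by (auto intro!: derivative_eq_intros simp: flat_def flat_poly_def algebra_simps power2_eq_square)
    then show ?thesis
      by (rule DERIV_cong_ev[THEN iffD1, rotated 3])
        (use 3 in \<open>auto simp: flat_def intro!: eventually_mono[OF eventually_nhds_in_open[of "{0<..}"]]\<close>)
  next
    case 2
    have "((\<lambda>u. poly ([:0,1:] * flat_poly l) u * exp (- u)) \<longlongrightarrow> 0) at_top"
      by (rule poly_exp_tendsto_0)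
    then have "((\<lambda>h. poly ([:0,1:] * flat_poly l) (inverse h) * exp (- inverse h)) \<longlongrightarrow> 0) (at_right 0)"
      by (rule filterlim_compose) (rule filterlim_inverse_at_top_right)
    then have r: "((\<lambda>h. (flat l (0 + h) - flat l 0) / h) \<longlongrightarrow> 0) (at_right 0)"
      by (rule Lim_transform_eventually)
        (auto simp: flat_def eventually_at_filter field_simps)
    have "((\<lambda>h. (flat l (0 + h) - flat l 0) / h) \<longlongrightarrow> 0) (at_left 0)"
      by (rule tendsto_eventually) (auto simp: flat_def eventually_at_filter)
    with r have "((\<lambda>h. (flat l (0 + h) - flat l 0) / h) \<longlongrightarrow> 0) (at 0)"
      by (simp add: filterlim_split_at)
    then show ?thesis using 2 by (simp add: DERIV_def flat_def)
  qed
qed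

text \<open>Smooth functions supported in a closed box that increase to the indicator function
  of its interior, since \<open>exp (-1/(m t))\<close> increases to 1 for \<open>t > 0\<close>.\<close>

definition box_bump :: "'n::finite point \<Rightarrow> 'n point \<Rightarrow> nat \<Rightarrow> 'n point \<Rightarrow> real" where
  "box_bump a b m x = (\<Prod>i\<in>UNIV. flat 0 (real m * x $ i + - real m * a $ i)
      * flat 0 (- real m * x $ i + real m * b $ i))"

lemma test_function_box_bump:
  assumes "cbox a b \<subseteq> \<Xi>"
  shows "test_function \<Xi> (box_bump a b m)"
  unfolding test_function_def
proof (intro conjI allI exI[of _ "cbox a b"] impI)
  show "cont_diff l (box_bump a b m)" for l
    unfolding box_bump_def
    by (intro cont_diff_prod cont_diff_mult cont_diff_comp_affine flat_has_derivative)
  fix x assume "x \<notin> cbox a b"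
  then obtain i where "x $ i < a $ i \<or> b $ i < x $ i"
    by (auto simp: mem_box_cart not_le)
  then have "flat 0 (real m * x $ i + - real m * a $ i)
      * flat 0 (- real m * x $ i + real m * b $ i) = 0"
    using mult_left_mono[of "x $ i" "a $ i" "real m"] mult_left_mono[of "b $ i" "x $ i" "real m"]
    by (auto simp: flat_def)
  then show "box_bump a b m x = 0"
    unfolding box_bump_def by (meson UNIV_I finite prod_zero_iff)
qed (use assms in auto)

lemma flat_0_bounds: "0 \<le> flat 0 t" "flat 0 t \<le> 1"
  by (auto simp: flat_def flat_poly_def)

lemma box_bump_bounds: "0 \<le> box_bump a b m x" "box_bump a b m x \<le> 1"
  by (auto simp: box_bump_def flat_0_bounds intro!: prod_nonneg prod_le_1 mult_le_one)

lemma flat_scale_tendsto: "(\<lambda>m. flat 0 (real m * t)) \<longlonglongrightarrow> (if t > 0 then 1 else 0)"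
proof (cases "t > 0")
  case True
  have "(\<lambda>m. exp (- (inverse (real m) * inverse t))) \<longlonglongrightarrow> exp (- (0 * inverse t))"
    by (intro tendsto_intros lim_inverse_n)
  moreover have "\<forall>\<^sub>F m in sequentially. exp (- (inverse (real m) * inverse t)) = flat 0 (real m * t)"
    using eventually_gt_at_top[of 0] by eventually_elim (use True in \<open>auto simp: flat_def flat_poly_def mult_le_0_iff\<close>)
  ultimately show ?thesis using True by (simp add: tendsto_cong)
next
  case False
  then have "flat 0 (real m * t) = 0" for m by (simp add: flat_def mult_nonneg_nonpos)
  then show ?thesis using False by simp
qed

lemma box_bump_tendsto: "(\<lambda>m. box_bump a b m x) \<longlonglongrightarrow> indicator (box a b) x"
proof -
  have "(\<lambda>m. box_bump a b m x) \<longlonglongrightarrow>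
     (\<Prod>i\<in>UNIV. (if x $ i - a $ i > 0 then 1 else 0) * (if b $ i - x $ i > 0 then 1 else 0))"
    unfolding box_bump_def
    using flat_scale_tendsto[of "x $ _ - a $ _"] flat_scale_tendsto[of "b $ _ - x $ _"]
    by (intro tendsto_prod tendsto_mult) (simp_all add: algebra_simps)
  also have "(\<Prod>i\<in>UNIV. (if x $ i - a $ i > 0 then 1 else 0) * (if b $ i - x $ i > 0 then 1 else 0))
     = (indicator (box a b) x :: real)"
  proof (cases "x \<in> box a b")
    case False
    then obtain i where "\<not> (x $ i - a $ i > 0 \<and> b $ i - x $ i > 0)" by (auto simp: mem_box_cart)
    then have "(if x $ i - a $ i > 0 then 1 else 0) * (if b $ i - x $ i > 0 then 1 else 0) = (0::real)" by auto
    then have "(\<Prod>i\<in>UNIV. (if x $ i - a $ i > 0 then 1 else 0) * (if b $ i - x $ i > 0 then 1 else 0)) = (0::real)"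
      by (meson UNIV_I finite prod_zero_iff)
    then show ?thesis using False by simp
  qed (auto simp: mem_box_cart)
  finally show ?thesis .
qed

section \<open>The fundamental lemma of the calculus of variations\<close>

lemma partial_deriv_outside:
  assumes "closed C" "\<And>x. x \<notin> C \<Longrightarrow> f x = 0" "x \<notin> C"
  shows "partial_deriv i f x = 0"
proof -
  have "(f has_derivative (\<lambda>_. 0)) (at x)"
    by (rule has_derivative_transform_within_open[of "\<lambda>_. 0" _ _ _ "- C"])
      (use assms in \<open>auto simp: open_Compl\<close>)
  then show ?thesis by (subst partial_deriv_eq) auto
qed

lemma partial_deriv_along_line:
  assumes "g differentiable (at (x + s *\<^sub>R axis i 1))"
  shows "((\<lambda>s. g (x + s *\<^sub>R axis i 1)) has_real_derivative
    partial_deriv i g (x + s *\<^sub>R axis i 1)) (at s)"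
proof -
  let ?D = "frechet_derivative g (at (x + s *\<^sub>R axis i 1))"
  have D: "(g has_derivative ?D) (at (x + s *\<^sub>R axis i 1))"
    by (rule partial_deriv_has_derivative[OF assms])
  have "((\<lambda>s. x + s *\<^sub>R axis i 1) has_derivative (\<lambda>h. h *\<^sub>R axis i 1)) (at s)"
    by (auto intro!: derivative_eq_intros)
  from has_derivative_compose[OF this D]
  have "((\<lambda>s. g (x + s *\<^sub>R axis i 1)) has_derivative (\<lambda>h. ?D (h *\<^sub>R axis i 1))) (at s)" .
  moreover have "?D (h *\<^sub>R axis i 1) = partial_deriv i g (x + s *\<^sub>R axis i 1) * h" for h
    using linear_cmul[OF has_derivative_linear[OF D]] by (simp add: partial_deriv_def)
  ultimately show ?thesis by (simp add: has_field_derivative_def)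
qed

lemma integrable_compact_support:
  fixes g :: "'a::euclidean_space \<Rightarrow> real"
  assumes "continuous_on UNIV g" "compact C" "\<And>x. x \<notin> C \<Longrightarrow> g x = 0"
  shows "integrable lborel g"
proof -
  have "integrable lborel (\<lambda>x. indicator C x *\<^sub>R g x)"
    using assms by (intro borel_integrable_compact) (auto intro: continuous_on_subset)
  moreover have "(\<lambda>x. indicator C x *\<^sub>R g x) = g" using assms(3) by (auto simp: fun_eq_iff indicator_def)
  ultimately show ?thesis by simp
qed

text \<open>By translation invariance the difference quotients integrate to zero; they converge
  boundedly to the partial derivative.\<close>

lemma integral_partial_deriv_compact_support:
  fixes g :: "'n::finite point \<Rightarrow> real"
  assumes g: "cont_diff 1 g" and C: "compact C" "\<And>x. x \<notin> C \<Longrightarrow> g x = 0"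
  shows "(LINT x|lebesgue. partial_deriv i g x) = 0"
proof -
  let ?e = "axis i 1 :: 'n point"
  define h where "h m = inverse (real (Suc m))" for m
  have h: "0 < h m" "h m \<le> 1" for m by (auto simp: h_def divide_simps)
  have diff: "g differentiable (at x)" for x using g by simp
  have cont: "continuous_on UNIV g" "continuous_on UNIV (partial_deriv i g)"
    using g cont_diff_continuous[OF g] by auto
  have out: "partial_deriv i g x = 0" if "x \<notin> C" for x
    using partial_deriv_outside[OF compact_imp_closed C(2) that] C(1) by auto
  obtain B where B: "B \<ge> 0" "\<And>x. \<bar>partial_deriv i g x\<bar> \<le> B"
  proof -
    have "bounded (partial_deriv i g ` C)"
      using C(1) cont(2) by (intro compact_imp_bounded compact_continuous_image) (auto intro: continuous_on_subset)
    then obtain B where "\<forall>x\<in>C. \<bar>partial_deriv i g x\<bar> \<le> B" unfolding bounded_iff by auto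
    then have "\<bar>partial_deriv i g x\<bar> \<le> max 0 B" for x
      by (cases "x \<in> C") (auto simp: out le_max_iff_disj)
    then show ?thesis using that[of "max 0 B"] by auto
  qed
  obtain R where R: "\<And>x. x \<in> C \<Longrightarrow> norm x \<le> R"
    using compact_imp_bounded[OF C(1)] unfolding bounded_iff by auto
  define D where "D m x = (g (h m *\<^sub>R ?e + x) - g x) / h m" for m x
  have bound: "norm (D m x) \<le> B * indicator (cball 0 (R + 1)) x" for m x
  proof (cases "norm x \<le> R + 1")
    case True
    have "\<exists>z. z > 0 \<and> z < h m \<and> g (x + h m *\<^sub>R ?e) - g (x + 0 *\<^sub>R ?e)
         = (h m - 0) * partial_deriv i g (x + z *\<^sub>R ?e)"
      by (rule MVT2[OF h(1), of m "\<lambda>s. g (x + s *\<^sub>R ?e)"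
            "\<lambda>s. partial_deriv i g (x + s *\<^sub>R ?e)"]) (rule partial_deriv_along_line[OF diff])
    then obtain z where "g (x + h m *\<^sub>R ?e) - g x = h m * partial_deriv i g (x + z *\<^sub>R ?e)" by auto
    then have "D m x = partial_deriv i g (x + z *\<^sub>R ?e)" using h[of m] by (simp add: D_def add.commute)
    then show ?thesis using True B by auto
  next
    case False
    have "norm (h m *\<^sub>R ?e + x) \<ge> norm x - norm (h m *\<^sub>R ?e)"
      using norm_triangle_ineq4[of "h m *\<^sub>R ?e + x" "h m *\<^sub>R ?e"] by (simp add: algebra_simps)
    moreover have "norm (h m *\<^sub>R ?e) \<le> 1" using h[of m] by simp
    ultimately have "h m *\<^sub>R ?e + x \<notin> C" "x \<notin> C" using R False by force+
    then show ?thesis using C(2) False by (simp add: D_def)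
  qed
  have [measurable]: "g \<in> borel_measurable borel" "partial_deriv i g \<in> borel_measurable borel"
    using cont by (auto intro: borel_measurable_continuous_onI)
  have lim: "(\<lambda>m. D m x) \<longlonglongrightarrow> partial_deriv i g x" for x
  proof -
    have "((\<lambda>t. (g (x + (0 + t) *\<^sub>R ?e) - g (x + 0 *\<^sub>R ?e)) / t) \<longlongrightarrow> partial_deriv i g (x + 0 *\<^sub>R ?e)) (at 0)"
      using partial_deriv_along_line[where x = x and s = 0 and i = i, OF diff] by (simp add: DERIV_def)
    moreover have "filterlim h (at 0) sequentially"
    proof -
      have "h \<longlonglongrightarrow> 0" unfolding h_def by (rule LIMSEQ_inverse_real_of_nat)
      moreover have "h m \<noteq> 0" for m using h(1)[of m] by simp
      ultimately show ?thesis by (simp add: filterlim_at)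
    qed
    ultimately show ?thesis
      using filterlim_compose[of "\<lambda>t. (g (x + (0 + t) *\<^sub>R ?e) - g (x + 0 *\<^sub>R ?e)) / t" _ "at 0" h]
      by (simp add: D_def add.commute)
  qed
  have "(\<lambda>m. LINT x|lborel. D m x) \<longlonglongrightarrow> (LINT x|lborel. partial_deriv i g x)"
  proof (rule integral_dominated_convergence)
    show "integrable lborel (\<lambda>x::'n point. B * indicator (cball 0 (R + 1)) x)"
      by (intro integrable_mult_right integrable_real_indicator)
        (use emeasure_lborel_cball_finite in auto)
    show "D m \<in> borel_measurable lborel" for m unfolding D_def by measurable
  qed (use lim bound in auto)
  moreover have "(LINT x|lborel. D m x) = 0" for m
  proof -
    have int: "integrable lborel g" by (rule integrable_compact_support[OF cont(1) C])
    have tr: "integrable lborel (\<lambda>x. g (h m *\<^sub>R ?e + x))"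
        "(LINT x|lborel. g (h m *\<^sub>R ?e + x)) = (LINT x|lborel. g x)"
      using int integrable_distr_eq[of "(+) (h m *\<^sub>R ?e)" lborel borel g]
        integral_distr[of "(+) (h m *\<^sub>R ?e)" lborel borel g] lborel_distr_plus[of "h m *\<^sub>R ?e"] by auto
    show ?thesis using tr int by (simp add: D_def)
  qed
  ultimately have "(LINT x|lborel. partial_deriv i g x) = 0" by (simp add: LIMSEQ_const_iff)
  then show ?thesis by (simp add: integral_completion)
qed

text \<open>The sets over which \<open>g\<close> integrates to zero form a Dynkin system, and the boxes are a generator of
  the Borel sets that is stable under intersection.\<close>

lemma AE_eq_0_if_box_integrals_0:
  fixes g :: "'a::euclidean_space \<Rightarrow> real"
  assumes int: "integrable lborel g"
    and box: "\<And>a b. (LINT x:box a b|lborel. g x) = 0"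
  shows "AE x in lborel. g x = 0"
proof -
  have si: "set_integrable lborel A g" if "A \<in> sets borel" for A
    using int that integrable_mult_indicator[of A lborel g] by (simp add: set_integrable_def)
  have UN: "(LINT x:UNIV|lborel. g x) = 0"
  proof -
    have "(\<lambda>m. LINT x:box (- real m *\<^sub>R One) (real m *\<^sub>R One)|lborel. g x) \<longlonglongrightarrow>
        (LINT x:(\<Union>m. box (- real m *\<^sub>R One) (real m *\<^sub>R One)) |lborel. g x)"
    proof (rule set_integral_cont_up)
      show "incseq (\<lambda>m. box (- real m *\<^sub>R One) (real m *\<^sub>R One :: 'a))"
        by (rule incseq_SucI, rule subset_box_imp)
          (auto simp: inner_sum_left inner_Basis algebra_simps)
    qed (auto intro: si)
    then show ?thesis
      by (simp add: box UN_box_eq_UNIV LIMSEQ_const_iff)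
  qed
  have "(LINT x:A|lborel. g x) = 0" if "A \<in> sets borel" for A
  proof -
    have A: "A \<in> sigma_sets UNIV (range (\<lambda>(a, b). box a b :: 'a set))"
      using that by (simp add: borel_eq_box)
    have stable: "Int_stable (range (\<lambda>(a, b). box a b :: 'a set))"
      by (auto simp: Int_stable_def Int_interval box_Int_box)
    have subs: "range (\<lambda>(a, b). box a b :: 'a set) \<subseteq> Pow UNIV" by simp
    show ?thesis using stable subs A
    proof (induction rule: sigma_sets_induct_disjoint)
      case (basic A)
      then show ?case using box by auto
    next
      case empty
      then show ?case by (simp add: set_lebesgue_integral_def)
    next
      case (compl A)
      then have A: "A \<in> sets borel" by (simp add: borel_eq_box)
      have "(LINT x:(UNIV - A) \<union> A|lborel. g x)
          = (LINT x:UNIV - A|lborel. g x) + (LINT x:A|lborel. g x)"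
        using A by (intro set_integral_Un si) auto
      then show ?case using compl UN by simp
    next
      case (union A)
      then have A: "A i \<in> sets borel" for i by (auto simp: borel_eq_box)
      have "(LINT x:(\<Union>i. A i)|lborel. g x) = (\<Sum>i. LINT x:A i|lborel. g x)"
        using A union(1) by (intro lebesgue_integral_countable_add si) (auto simp: disjoint_family_on_def)
      then show ?case using union by simp
    qed
  qed
  then have "AE x in lborel. g x = (\<lambda>_. 0) x"
    using int by (intro density_unique_real) auto
  then show ?thesis by simp
qed

text \<open>The fundamental lemma of the calculus of variations. The bump functions of a closed box in \<open>\<Xi>\<close> are
  test functions on \<open>\<Xi>\<close>, so by dominated convergence \<open>f\<close> integrates to zero over the open box; then
  the preceding lemma applies on each box of a countable cover of \<open>\<Xi>\<close>.\<close>

lemma AE_eq_0_if_orthogonal_test_functions: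
  fixes f :: "'n::finite point \<Rightarrow> real"
  assumes \<Xi>: "open \<Xi>"
    and loc: "\<And>a b. cbox a b \<subseteq> \<Xi> \<Longrightarrow> integrable (lebesgue_on (cbox a b)) f"
    and orth: "\<And>\<phi>. test_function \<Xi> \<phi> \<Longrightarrow> (LINT x|lebesgue_on \<Xi>. f x * \<phi> x) = 0"
  shows "AE x in lebesgue_on \<Xi>. f x = 0"
proof -
  have \<Xi>s: "\<Xi> \<in> sets lebesgue" using \<Xi> by simp
  have box0: "(LINT x|lebesgue. indicator (box p q) x * f x) = 0" if sub: "cbox p q \<subseteq> \<Xi>" for p q
  proof -
    define u where "u x = (if x \<in> cbox p q then f x else 0)" for x
    have u: "integrable lebesgue u"
      unfolding u_def by (subst Lebesgue_Measure.integrable_restrict_UNIV) (auto intro: loc[OF sub])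
    then have [measurable]: "u \<in> borel_measurable lebesgue" by auto
    have bm[measurable]: "box_bump p q m \<in> borel_measurable lebesgue" for m
      using test_function_box_bump[OF sub, of m] cont_diff_continuous[of 0 "box_bump p q m"]
      by (intro measurable_completion) (auto simp: test_function_def intro!: borel_measurable_continuous_onI)
    have "(\<lambda>m. LINT x|lebesgue. u x * box_bump p q m x) \<longlonglongrightarrow> (LINT x|lebesgue. u x * indicator (box p q) x)"
    proof (rule integral_dominated_convergence)
      show "integrable lebesgue (\<lambda>x. \<bar>u x\<bar>)" using u by auto
      show "(\<lambda>x. u x * indicator (box p q) x) \<in> borel_measurable lebesgue"
        by (intro borel_measurable_times borel_measurable_indicator) auto
      show "AE x in lebesgue. (\<lambda>m. u x * box_bump p q m x) \<longlonglongrightarrow> u x * indicator (box p q) x"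
        by (intro always_eventually allI tendsto_mult box_bump_tendsto tendsto_const)
      show "AE x in lebesgue. norm (u x * box_bump p q m x) \<le> \<bar>u x\<bar>" for m
        using box_bump_bounds[of p q m] by (auto simp: abs_mult intro!: mult_left_le)
    qed measurable
    moreover have "(LINT x|lebesgue. u x * box_bump p q m x) = 0" for m
    proof -
      have "box_bump p q m x = 0" if "x \<notin> cbox p q" for x
      proof -
        obtain i where "x $ i < p $ i \<or> q $ i < x $ i"
          using \<open>x \<notin> cbox p q\<close> by (auto simp: mem_box_cart not_le)
        then show ?thesis
          using mult_left_mono[of "x $ i" "p $ i" "real m"] mult_left_mono[of "q $ i" "x $ i" "real m"]
          by (auto simp: box_bump_def flat_def intro!: prod_zero bexI[of _ i])
      qed
      then have "u x * box_bump p q m x = (if x \<in> \<Xi> then f x * box_bump p q m x else 0)" for x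
        using sub by (auto simp: u_def)
      then show ?thesis
        using orth[OF test_function_box_bump[OF sub, of m]]
          Lebesgue_Measure.integral_restrict_UNIV[OF \<Xi>s, of "\<lambda>x. f x * box_bump p q m x"] by simp
    qed
    ultimately have "(LINT x|lebesgue. u x * indicator (box p q) x) = 0" by (simp add: LIMSEQ_const_iff)
    moreover have "u x * indicator (box p q) x = indicator (box p q) x * f x" for x
      using box_subset_cbox[of p q] by (auto simp: u_def indicator_def)
    ultimately show ?thesis by simp
  qed
  have cb: "AE x in lebesgue. x \<in> cbox a b \<longrightarrow> f x = 0" if sub: "cbox a b \<subseteq> \<Xi>" for a b
  proof -
    define g where "g x = indicator (box a b) x * f x" for x
    have "integrable lebesgue (\<lambda>x. if x \<in> cbox a b then f x else 0)"
      by (subst Lebesgue_Measure.integrable_restrict_UNIV) (auto intro: loc[OF sub])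
    from integrable_mult_indicator[OF _ this, of "box a b"]
    have "integrable lebesgue (\<lambda>x. indicator (box a b) x *\<^sub>R (if x \<in> cbox a b then f x else 0))" by simp
    moreover have "(\<lambda>x. indicator (box a b) x *\<^sub>R (if x \<in> cbox a b then f x else 0)) = g"
      using box_subset_cbox[of a b] by (auto simp: g_def fun_eq_iff indicator_def)
    ultimately have g: "integrable lebesgue g" by simp
    obtain g' where g': "g' \<in> borel_measurable lborel" "AE x in lborel. g x = g' x"
      using completion_ex_borel_measurable_real[of g lborel] g by auto
    have AE: "AE x in lebesgue. g x = g' x" using g'(2) by (rule AE_completion)
    have "integrable lebesgue g'"
      using g AE g' by (subst integrable_cong_AE[of g' _ g]) (auto intro: measurable_completion)
    then have int: "integrable lborel g'" using g' integrable_completion[of g' lborel] by simp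
    have "AE x in lborel. g' x = 0"
    proof (rule AE_eq_0_if_box_integrals_0[OF int])
      fix c d :: "'n point"
      obtain p q where pq: "box c d \<inter> box a b = box p q" "cbox p q \<subseteq> cbox a b"
      proof
        show "box c d \<inter> box a b = box (\<chi> i. max (c $ i) (a $ i)) (\<chi> i. min (d $ i) (b $ i))"
          by (auto simp: mem_box_cart)
        show "cbox (\<chi> i. max (c $ i) (a $ i)) (\<chi> i. min (d $ i) (b $ i)) \<subseteq> cbox a b"
          by (auto simp: mem_box_cart)
      qed
      have "(LINT x:box c d|lborel. g' x) = (LINT x|lebesgue. indicator (box c d) x *\<^sub>R g' x)"
        unfolding set_lebesgue_integral_def using g'(1) by (intro integral_completion[symmetric]) simp
      also have "\<dots> = (LINT x|lebesgue. indicator (box c d) x *\<^sub>R g x)"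
      proof (rule integral_cong_AE)
        have [measurable]: "g \<in> borel_measurable lebesgue" "g' \<in> borel_measurable lebesgue"
          using g g'(1) by (auto intro: measurable_completion)
        show "(\<lambda>x. indicator (box c d) x *\<^sub>R g' x) \<in> borel_measurable lebesgue"
          "(\<lambda>x. indicator (box c d) x *\<^sub>R g x) \<in> borel_measurable lebesgue"
          by (intro borel_measurable_scaleR borel_measurable_indicator; simp)+
      qed (use AE in auto)
      also have "\<dots> = (LINT x|lebesgue. indicator (box p q) x * f x)"
        by (intro Bochner_Integration.integral_cong) (auto simp: g_def pq(1)[symmetric] indicator_def)
      also have "\<dots> = 0" using box0 pq(2) sub by blast
      finally show "(LINT x:box c d|lborel. g' x) = 0" .
    qed
    then have "AE x in lebesgue. g' x = 0" by (rule AE_completion)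
    moreover have "AE x in lebesgue. x \<notin> cbox a b - box a b"
      using negligible_frontier_interval[of a b] by (intro AE_not_in) (auto simp: negligible_iff_null_sets)
    ultimately show ?thesis using AE by eventually_elim (auto simp: g_def indicator_def)
  qed
  obtain \<D> where \<D>: "countable \<D>" "\<D> \<subseteq> Pow \<Xi>" "\<And>X. X \<in> \<D> \<Longrightarrow> \<exists>a b. X = cbox a b" "\<Union>\<D> = \<Xi>"
    using open_countable_Union_open_cbox[OF \<Xi>] by metis
  have "AE x in lebesgue. \<forall>X\<in>\<D>. x \<in> X \<longrightarrow> f x = 0"
    using \<D> by (subst AE_ball_countable) (auto, metis PowD cb subset_iff)
  then have "AE x in lebesgue. x \<in> \<Xi> \<longrightarrow> f x = 0"
    by eventually_elim (use \<D>(4) in auto)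
  then show ?thesis using \<Xi>s by (simp add: AE_restrict_space_iff)
qed

section \<open>Exterior algebra\<close>

text \<open>\<open>dx_wedge i\<close> is \<open>v \<mapsto> dx {i} \<and> v\<close> and \<open>contract i\<close> is its adjoint, the interior product with the
  \<open>i\<close>-th coordinate vector.\<close>

definition dx_wedge :: "'n::{finite,linorder} \<Rightarrow> 'n ext \<Rightarrow> 'n ext" where
  "dx_wedge i v = (\<chi> \<beta>. if i \<in> \<beta> then pos_sign i \<beta> * v $ (\<beta> - {i}) else 0)"

definition contract :: "'n::{finite,linorder} \<Rightarrow> 'n ext \<Rightarrow> 'n ext" where
  "contract i v = (\<chi> \<alpha>. if i \<notin> \<alpha> then pos_sign i \<alpha> * v $ insert i \<alpha> else 0)"

lemma dx_wedge_nth: "dx_wedge i v $ \<beta> = (if i \<in> \<beta> then pos_sign i \<beta> * v $ (\<beta> - {i}) else 0)"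
  by (simp add: dx_wedge_def)

lemma contract_nth: "contract i v $ \<alpha> = (if i \<notin> \<alpha> then pos_sign i \<alpha> * v $ insert i \<alpha> else 0)"
  by (simp add: contract_def)

lemma linear_dx_wedge: "linear (dx_wedge i)"
  by (rule linearI) (simp_all add: vec_eq_iff dx_wedge_nth algebra_simps)

lemma linear_contract: "linear (contract i)"
  by (rule linearI) (simp_all add: vec_eq_iff contract_nth algebra_simps)

lemma pos_sign_insert [simp]: "pos_sign i (insert i \<alpha>) = pos_sign i \<alpha>"
  unfolding pos_sign_def by (rule arg_cong[of _ _ "\<lambda>A. (-1) ^ card A"]) auto

lemma pos_sign_remove [simp]: "pos_sign i (\<alpha> - {i}) = pos_sign i \<alpha>"
  unfolding pos_sign_def by (rule arg_cong[of _ _ "\<lambda>A. (-1) ^ card A"]) auto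

lemma pos_sign_square [simp]: "pos_sign i \<alpha> * pos_sign i \<alpha> = 1" "pos_sign i \<alpha> * (pos_sign i \<alpha> * x) = x"
  by (simp_all add: pos_sign_def mult.assoc[symmetric] power_mult_distrib[symmetric])

lemma dx_wedge_inner: "dx_wedge i v \<bullet> w = v \<bullet> contract i w"
proof -
  have "dx_wedge i v \<bullet> w = (\<Sum>\<beta>\<in>{\<beta>. i \<in> \<beta>}. pos_sign i \<beta> * v $ (\<beta> - {i}) * w $ \<beta>)"
    unfolding inner_vec_def by (rule sum.mono_neutral_cong_right) (auto simp: dx_wedge_nth)
  also have "\<dots> = (\<Sum>\<alpha>\<in>{\<alpha>. i \<notin> \<alpha>}. v $ \<alpha> * (pos_sign i \<alpha> * w $ insert i \<alpha>))"
    by (rule sum.reindex_bij_witness[of _ "insert i" "\<lambda>\<beta>. \<beta> - {i}"]) (auto simp: insert_absorb)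
  also have "\<dots> = v \<bullet> contract i w"
    unfolding inner_vec_def by (rule sum.mono_neutral_cong_left) (auto simp: contract_nth)
  finally show ?thesis .
qed

lemma koszul_eq_contract: "koszul x v = (\<Sum>i\<in>UNIV. x $ i *\<^sub>R contract i v)"
proof (rule vec_eq_iff[THEN iffD2], rule allI)
  fix \<gamma>
  have "koszul x v $ \<gamma> = (\<Sum>\<alpha>\<in>UNIV. \<Sum>i\<in>\<alpha>.
      if \<gamma> = \<alpha> - {i} then v $ \<alpha> * (pos_sign i \<alpha> * x $ i) else 0)"
    unfolding koszul_def
    by (simp add: dx_def axis_def sum_distrib_left if_distrib[of "(*) _"] cong: if_cong)
  also have "\<dots> = (\<Sum>\<alpha>\<in>UNIV. \<Sum>i\<in>UNIV.
      if i \<in> \<alpha> \<and> \<alpha> - {i} = \<gamma> then v $ \<alpha> * (pos_sign i \<alpha> * x $ i) else 0)"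
    by (intro sum.cong[OF refl] sum.mono_neutral_cong_left) auto
  also have "\<dots> = (\<Sum>i\<in>UNIV. \<Sum>\<alpha>\<in>UNIV.
      if i \<in> \<alpha> \<and> \<alpha> - {i} = \<gamma> then v $ \<alpha> * (pos_sign i \<alpha> * x $ i) else 0)"
    by (rule sum.swap)
  also have "\<dots> = (\<Sum>i\<in>UNIV. x $ i * contract i v $ \<gamma>)"
  proof (rule sum.cong[OF refl])
    fix i
    have "(\<Sum>\<alpha>\<in>UNIV. if i \<in> \<alpha> \<and> \<alpha> - {i} = \<gamma> then v $ \<alpha> * (pos_sign i \<alpha> * x $ i) else 0)
      = (\<Sum>\<alpha>\<in>UNIV. if insert i \<gamma> = \<alpha> then (if i \<notin> \<gamma> then v $ \<alpha> * (pos_sign i \<alpha> * x $ i) else 0) else 0)"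
      by (intro sum.cong refl) auto
    then show "(\<Sum>\<alpha>\<in>UNIV. if i \<in> \<alpha> \<and> \<alpha> - {i} = \<gamma> then v $ \<alpha> * (pos_sign i \<alpha> * x $ i) else 0)
        = x $ i * contract i v $ \<gamma>"
      by (simp add: contract_nth)
  qed
  finally show "koszul x v $ \<gamma> = (\<Sum>i\<in>UNIV. x $ i *\<^sub>R contract i v) $ \<gamma>" by simp
qed

lemma card_Compl': "card (- \<gamma> :: 'n::finite set) = CARD('n) - card \<gamma>"
  by (simp add: Compl_eq_Diff_UNIV card_Diff_subset)

lemma altD: "v \<in> alt k \<Longrightarrow> card \<alpha> \<noteq> k \<Longrightarrow> v $ \<alpha> = 0" by (simp add: alt_def)

lemma subspace_alt: "subspace (alt k)" by (auto simp: alt_def subspace_def)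

lemma alt_diff: "v \<in> alt k \<Longrightarrow> w \<in> alt k \<Longrightarrow> v - w \<in> alt k"
  and alt_scaleR: "v \<in> alt k \<Longrightarrow> c *\<^sub>R v \<in> alt k"
  and alt_add: "v \<in> alt k \<Longrightarrow> w \<in> alt k \<Longrightarrow> v + w \<in> alt k"
  and alt_0: "0 \<in> alt k"
  and alt_sum: "(\<And>i. i \<in> I \<Longrightarrow> f i \<in> alt k) \<Longrightarrow> sum f I \<in> alt k"
  using subspace_alt[of k]
  by (auto intro: subspace_diff subspace_scale subspace_add subspace_0 subspace_sum)

lemma dx_wedge_alt: "v \<in> alt k \<Longrightarrow> dx_wedge i v \<in> alt (Suc k)"
  by (auto simp: alt_def dx_wedge_nth)
    (metis card.remove finite)

lemma contract_alt: "v \<in> alt (Suc k) \<Longrightarrow> contract i v \<in> alt k"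
  by (auto simp: alt_def contract_nth)

lemma koszul_alt: "v \<in> alt (Suc k) \<Longrightarrow> koszul x v \<in> alt k"
  unfolding koszul_eq_contract by (intro alt_sum alt_scaleR contract_alt)

lemma dx_wedge_contract_nth: "dx_wedge i (contract i v) $ \<beta> = (if i \<in> \<beta> then v $ \<beta> else 0)"
  by (simp add: dx_wedge_nth contract_nth insert_absorb)

lemma contract_dx_wedge_nth: "contract i (dx_wedge i v) $ \<beta> = (if i \<in> \<beta> then 0 else v $ \<beta>)"
  by (simp add: dx_wedge_nth contract_nth)

lemma sum_dx_wedge_contract:
  assumes "v \<in> alt k"
  shows "(\<Sum>i\<in>UNIV. dx_wedge i (contract i v)) = real k *\<^sub>R v"
proof (rule vec_eq_iff[THEN iffD2], rule allI)
  fix \<beta>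
  have "(\<Sum>i\<in>UNIV. dx_wedge i (contract i v)) $ \<beta> = real (card \<beta>) * v $ \<beta>"
    by (simp add: dx_wedge_contract_nth sum.If_cases)
  then show "(\<Sum>i\<in>UNIV. dx_wedge i (contract i v)) $ \<beta> = (real k *\<^sub>R v) $ \<beta>"
    using altD[OF assms, of \<beta>] by (cases "card \<beta> = k") auto
qed

lemma sum_contract_dx_wedge:
  fixes v :: "'n::{finite,linorder} ext"
  assumes "v \<in> alt k"
  shows "(\<Sum>i\<in>UNIV. contract i (dx_wedge i v)) = real (CARD('n) - k) *\<^sub>R v"
proof (rule vec_eq_iff[THEN iffD2], rule allI)
  fix \<beta> :: "'n set"
  have "(\<Sum>i\<in>UNIV. contract i (dx_wedge i v)) $ \<beta> = real (card (- \<beta>)) * v $ \<beta>"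
    by (simp add: contract_dx_wedge_nth sum.If_cases)
  then show "(\<Sum>i\<in>UNIV. contract i (dx_wedge i v)) $ \<beta> = (real (CARD('n) - k) *\<^sub>R v) $ \<beta>"
    using altD[OF assms, of \<beta>] by (cases "card \<beta> = k") (auto simp: card_Compl')
qed

lemma hodge_nth: "hodge v $ \<gamma> = v $ (- \<gamma>) * shuffle_sign (- \<gamma>) \<gamma>"
proof -
  have "hodge v $ \<gamma> = (\<Sum>\<alpha>\<in>UNIV. if \<alpha> = - \<gamma> then v $ \<alpha> * shuffle_sign \<alpha> (- \<alpha>) else 0)"
    unfolding hodge_def sum_component by (intro sum.cong) (auto simp: dx_def axis_def)
  then show ?thesis by simp
qed

lemma linear_hodge: "linear hodge"
  by (rule linearI) (simp_all add: vec_eq_iff hodge_nth algebra_simps)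

lemma card_le_UNIV: "card (\<gamma> :: 'n::finite set) \<le> CARD('n)"
  by (simp add: card_mono)

lemma hodge_alt:
  fixes v :: "'n::{finite,linorder} ext"
  assumes "v \<in> alt k"
  shows "hodge v \<in> alt (CARD('n) - k)"
  unfolding alt_def
proof (intro CollectI allI impI)
  fix \<gamma> :: "'n set"
  assume "card \<gamma> \<noteq> CARD('n) - k"
  then have "card (- \<gamma>) \<noteq> k" using card_le_UNIV[of \<gamma>] by (auto simp: card_Compl')
  then show "hodge v $ \<gamma> = 0" using altD[OF assms] by (simp add: hodge_nth)
qed

lemma pos_sign_prod: "pos_sign i \<beta> = (\<Prod>j\<in>\<beta>. if j < i then -1 else 1)"
  by (simp add: pos_sign_def prod.inter_filter[symmetric])

lemma shuffle_sign_prod: "shuffle_sign \<alpha> \<beta> = (\<Prod>i\<in>\<alpha>. pos_sign i \<beta>)"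
proof -
  have "{(i, j). i \<in> \<alpha> \<and> j \<in> \<beta> \<and> j < i} = Sigma \<alpha> (\<lambda>i. {j \<in> \<beta>. j < i})" by auto
  then show ?thesis by (simp add: shuffle_sign_def pos_sign_def power_sum)
qed

lemma shuffle_sign_square: "shuffle_sign \<alpha> \<beta> * shuffle_sign \<alpha> \<beta> = 1"
  by (simp add: shuffle_sign_def power_mult_distrib[symmetric])

lemma shuffle_sign_commute:
  assumes "\<alpha> \<inter> \<beta> = {}"
  shows "shuffle_sign \<alpha> \<beta> * shuffle_sign \<beta> \<alpha> = (-1) ^ (card \<alpha> * card \<beta>)"
proof -
  have "shuffle_sign \<beta> \<alpha> = (\<Prod>i\<in>\<alpha>. \<Prod>j\<in>\<beta>. if i < j then -1 else 1)"
    unfolding shuffle_sign_prod pos_sign_prod by (rule prod.swap)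
  then have "shuffle_sign \<alpha> \<beta> * shuffle_sign \<beta> \<alpha>
      = (\<Prod>i\<in>\<alpha>. \<Prod>j\<in>\<beta>. (if j < i then -1 else 1) * (if i < j then -1 else 1))"
    by (simp add: shuffle_sign_prod pos_sign_prod prod.distrib)
  also have "\<dots> = (\<Prod>i\<in>\<alpha>. \<Prod>j\<in>\<beta>. -1)"
    using assms by (intro prod.cong refl) auto
  finally show ?thesis by (simp add: power_mult[symmetric] mult.commute)
qed

lemma shuffle_sign_insert:
  assumes "i \<notin> \<alpha>" "i \<notin> \<gamma>"
  shows "shuffle_sign (insert i \<alpha>) \<gamma>
    = (-1) ^ card \<alpha> * pos_sign i \<alpha> * pos_sign i \<gamma> * shuffle_sign \<alpha> (insert i \<gamma>)"
proof -
  have "(\<Prod>a\<in>\<alpha>. if i < a then -1 else 1) = (\<Prod>a\<in>\<alpha>. -1 * (if a < i then -1 else (1::real)))"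
    using assms by (intro prod.cong refl) auto
  also have "\<dots> = (-1) ^ card \<alpha> * pos_sign i \<alpha>"
    unfolding prod.distrib by (simp add: pos_sign_prod)
  finally have "(\<Prod>a\<in>\<alpha>. if i < a then -1 else (1::real)) = (-1) ^ card \<alpha> * pos_sign i \<alpha>" .
  moreover have "pos_sign a (insert i \<gamma>) = (if i < a then -1 else 1) * pos_sign a \<gamma>" for a
    using assms by (simp add: pos_sign_prod)
  ultimately have "shuffle_sign \<alpha> (insert i \<gamma>)
      = (-1) ^ card \<alpha> * pos_sign i \<alpha> * shuffle_sign \<alpha> \<gamma>"
    by (simp add: shuffle_sign_prod prod.distrib)
  then have "(-1) ^ card \<alpha> * pos_sign i \<alpha> * shuffle_sign \<alpha> (insert i \<gamma>) = shuffle_sign \<alpha> \<gamma>"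
    by (cases "even (card \<alpha>)") simp_all
  moreover have "shuffle_sign (insert i \<alpha>) \<gamma> = pos_sign i \<gamma> * shuffle_sign \<alpha> \<gamma>"
    using assms by (simp add: shuffle_sign_prod)
  ultimately show ?thesis by (simp add: mult_ac)
qed

lemma hodge_hodge:
  fixes v :: "'n::{finite,linorder} ext"
  assumes "v \<in> alt k"
  shows "hodge (hodge v) = (-1) ^ (k * (CARD('n) - k)) *\<^sub>R v"
proof (rule vec_eq_iff[THEN iffD2], rule allI)
  fix \<gamma> :: "'n set"
  have "hodge (hodge v) $ \<gamma> = (-1) ^ (card \<gamma> * card (- \<gamma>)) * v $ \<gamma>"
    using shuffle_sign_commute[of \<gamma> "- \<gamma>"] by (simp add: hodge_nth)
  then show "hodge (hodge v) $ \<gamma> = ((-1) ^ (k * (CARD('n) - k)) *\<^sub>R v) $ \<gamma>"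
    using altD[OF assms, of \<gamma>] by (cases "card \<gamma> = k") (auto simp: card_Compl')
qed

lemma dx_wedge_hodge:
  assumes "v \<in> alt (Suc k)"
  shows "dx_wedge i (hodge v) = (-1) ^ k *\<^sub>R hodge (contract i v)"
proof (rule vec_eq_iff[THEN iffD2], rule allI)
  fix \<beta>
  show "dx_wedge i (hodge v) $ \<beta> = ((-1) ^ k *\<^sub>R hodge (contract i v)) $ \<beta>"
  proof (cases "i \<in> \<beta> \<and> card (insert i (- \<beta>)) = Suc k")
    case False
    then show ?thesis
      using altD[OF assms, of "insert i (- \<beta>)"]
      by (auto simp: dx_wedge_nth hodge_nth contract_nth Compl_Diff_eq)
  next
    case True
    then have "i \<notin> - \<beta>" "card (insert i (- \<beta>)) = Suc k" by auto
    then have "card (- \<beta>) = k" using card_insert_disjoint[of "- \<beta>" i] by simp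
    moreover have "- (\<beta> - {i}) = insert i (- \<beta>)" "insert i (\<beta> - {i}) = \<beta>" using True by auto
    ultimately show ?thesis
      using True shuffle_sign_insert[of i "- \<beta>" "\<beta> - {i}"]
      by (simp add: dx_wedge_nth hodge_nth contract_nth mult_ac)
  qed
qed

text \<open>The algebraic identity behind the sign convention of the codifferential.\<close>

lemma hodge_dx_wedge_hodge:
  fixes v :: "'n::{finite,linorder} ext"
  assumes v: "v \<in> alt (Suc k)" and k: "k < CARD('n)"
  shows "(-1) ^ (CARD('n) * (Suc k + 1) + 1) *\<^sub>R hodge (dx_wedge i (hodge v)) = - contract i v"
proof -
  have "hodge (dx_wedge i (hodge v)) = (-1) ^ k *\<^sub>R ((-1) ^ (k * (CARD('n) - k)) *\<^sub>R contract i v)"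
    by (simp add: dx_wedge_hodge[OF v] linear_cmul[OF linear_hodge] hodge_hodge[OF contract_alt[OF v]])
  moreover have "(-1) ^ (CARD('n) * (Suc k + 1) + 1) * ((-1) ^ k * (-1) ^ (k * (CARD('n) - k))) = (-1 :: real)"
  proof -
    have parity: "odd (n * (Suc k + 1) + 1 + (k + k * (n - k)))" if "k < n" for n :: nat
      using that by (auto simp: even_diff_nat)
    have "odd (CARD('n) * (Suc k + 1) + 1 + (k + k * (CARD('n) - k)))"
      by (rule parity[OF k])
    then have "(-1) ^ (CARD('n) * (Suc k + 1) + 1 + (k + k * (CARD('n) - k))) = (-1 :: real)"
      by (rule neg_one_odd_power)
    then show ?thesis by (simp only: power_add)
  qed
  ultimately show ?thesis
    by (metis (no_types, lifting) mult.assoc scaleR_scaleR scaleR_minus1_left)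
qed

lemma hodge_surj:
  fixes v :: "'n::{finite,linorder} ext"
  assumes "v \<in> alt k" "k \<le> CARD('n)"
  obtains w where "w \<in> alt (CARD('n) - k)" "hodge w = v"
proof
  show "(-1) ^ (k * (CARD('n) - k)) *\<^sub>R hodge v \<in> alt (CARD('n) - k)"
    by (intro alt_scaleR hodge_alt assms)
  show "hodge ((-1) ^ (k * (CARD('n) - k)) *\<^sub>R hodge v) = v"
    by (simp add: linear_cmul[OF linear_hodge] hodge_hodge[OF assms(1)] power_mult_distrib[symmetric])
qed

section \<open>Square-integrable functions\<close>

text \<open>Square-integrability, for functions with values in a Euclidean space.\<close>

definition sqint :: "'a measure \<Rightarrow> ('a \<Rightarrow> 'b::euclidean_space) \<Rightarrow> bool" where
  "sqint M f \<longleftrightarrow> f \<in> borel_measurable M \<and> integrable M (\<lambda>x. (norm (f x))\<^sup>2)"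

lemma sqint_measurable: "sqint M f \<Longrightarrow> f \<in> borel_measurable M"
  by (simp add: sqint_def)

lemma sqint_dominated:
  assumes "sqint M f" "g \<in> borel_measurable M" "\<And>x. norm (g x) \<le> c * norm (f x)"
  shows "sqint M g"
  unfolding sqint_def
proof
  have [measurable]: "g \<in> borel_measurable M" by fact
  show "integrable M (\<lambda>x. (norm (g x))\<^sup>2)"
  proof (rule Bochner_Integration.integrable_bound)
    show "integrable M (\<lambda>x. c\<^sup>2 * (norm (f x))\<^sup>2)" using assms(1) by (simp add: sqint_def)
    show "AE x in M. norm ((norm (g x))\<^sup>2) \<le> norm (c\<^sup>2 * (norm (f x))\<^sup>2)"
      using power_mono[OF assms(3) norm_ge_zero, of _ 2] by (simp add: power_mult_distrib)
  qed measurable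
qed fact

lemma sqint_linear:
  fixes H :: "'b::euclidean_space \<Rightarrow> 'c::euclidean_space"
  assumes "linear H" "sqint M f"
  shows "sqint M (\<lambda>x. H (f x))"
proof -
  obtain B where "\<And>x. norm (H x) \<le> B * norm x" using linear_bounded[OF assms(1)] by blast
  moreover have "(\<lambda>x. H (f x)) \<in> borel_measurable M"
    using linear_continuous_on[OF linear_linear[THEN iffD2, OF assms(1)], of UNIV] sqint_measurable[OF assms(2)]
    by (metis borel_measurable_continuous_onI measurable_compose)
  ultimately show ?thesis by (intro sqint_dominated[OF assms(2)])
qed

lemma sqint_nth: "sqint M f \<Longrightarrow> sqint M (\<lambda>x. f x $ i)"
  by (rule sqint_linear) (simp_all add: bounded_linear.linear bounded_linear_vec_nth)

lemma integrable_sqint_inner: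
  assumes "sqint M f" "sqint M g"
  shows "integrable M (\<lambda>x. f x \<bullet> g x)"
proof (rule Bochner_Integration.integrable_bound)
  have [measurable]: "f \<in> borel_measurable M" "g \<in> borel_measurable M" using assms by (auto simp: sqint_def)
  show "integrable M (\<lambda>x. (norm (f x))\<^sup>2 + (norm (g x))\<^sup>2)" using assms by (simp add: sqint_def)
  have "\<bar>a \<bullet> b\<bar> \<le> (norm a)\<^sup>2 + (norm b)\<^sup>2" for a b :: 'b
    using Cauchy_Schwarz_ineq2[of a b] sum_squares_bound[of "norm a" "norm b"]
      mult_nonneg_nonneg[of "norm a" "norm b"] by simp
  then show "AE x in M. norm (f x \<bullet> g x) \<le> norm ((norm (f x))\<^sup>2 + (norm (g x))\<^sup>2)" by auto
  show "(\<lambda>x. f x \<bullet> g x) \<in> borel_measurable M" by measurable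
qed

lemma sqint_add:
  assumes "sqint M f" "sqint M g"
  shows "sqint M (\<lambda>x. f x + g x)"
proof -
  have [measurable]: "f \<in> borel_measurable M" "g \<in> borel_measurable M" using assms by (auto simp: sqint_def)
  have "integrable M (\<lambda>x. (norm (f x))\<^sup>2 + (norm (g x))\<^sup>2 + 2 * (f x \<bullet> g x))"
    using assms by (intro Bochner_Integration.integrable_add integrable_mult_right integrable_sqint_inner) (auto simp: sqint_def)
  then show ?thesis
    by (simp add: sqint_def power2_norm_eq_inner inner_add inner_commute algebra_simps) 
qed

lemma sqint_scaleR: "sqint M f \<Longrightarrow> sqint M (\<lambda>x. c *\<^sub>R f x)"
  by (rule sqint_linear[OF linear_scaleR])

lemma sqint_diff: "sqint M f \<Longrightarrow> sqint M g \<Longrightarrow> sqint M (\<lambda>x. f x - g x)"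
  using sqint_add[of M f "\<lambda>x. (-1) *\<^sub>R g x"] sqint_scaleR[of M g "-1"] by simp

lemma sqint_sum:
  "finite I \<Longrightarrow> (\<And>i. i \<in> I \<Longrightarrow> sqint M (f i)) \<Longrightarrow> sqint M (\<lambda>x. \<Sum>i\<in>I. f i x)"
proof (induction I rule: finite_induct)
  case empty
  then show ?case by (simp add: sqint_def)
next
  case (insert i I)
  then show ?case by (simp add: sqint_add)
qed

lemma integrable_sqint_mult:
  fixes f g :: "'a \<Rightarrow> real"
  shows "sqint M f \<Longrightarrow> sqint M g \<Longrightarrow> integrable M (\<lambda>x. f x * g x)"
  using integrable_sqint_inner[of M f g] by (simp add: mult.commute)

lemma integrable_sqint:
  fixes f :: "'a \<Rightarrow> 'b::euclidean_space"
  assumes "finite_measure M" "sqint M f"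
  shows "integrable M f"
proof (rule Bochner_Integration.integrable_bound)
  show "integrable M (\<lambda>x. 1 + (norm (f x))\<^sup>2)"
    using assms by (intro Bochner_Integration.integrable_add finite_measure.integrable_const) (auto simp: sqint_def)
  have "r \<le> 1 + r\<^sup>2" for r :: real 
  proof -
    have "2 * r \<le> r\<^sup>2 + 1" using sum_squares_bound[of r 1] by simp
    then show ?thesis using zero_le_power2[of r] by linarith
  qed
  then show "AE x in M. norm (f x) \<le> norm (1 + (norm (f x))\<^sup>2)" by auto
qed (use assms in \<open>auto simp: sqint_def\<close>)

lemma integrable_lebesgue_on_subset:
  fixes f :: "'a::euclidean_space \<Rightarrow> 'b::{banach, second_countable_topology}"
  assumes "integrable (lebesgue_on S) f" "T \<subseteq> S" "S \<in> sets lebesgue" "T \<in> sets lebesgue"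
  shows "integrable (lebesgue_on T) f"
proof -
  have "integrable lebesgue (\<lambda>x. indicator T x *\<^sub>R (if x \<in> S then f x else 0))"
    using assms by (intro integrable_mult_indicator) (simp_all add: Lebesgue_Measure.integrable_restrict_UNIV)
  moreover have "(\<lambda>x. indicator T x *\<^sub>R (if x \<in> S then f x else 0)) = (\<lambda>x. if x \<in> T then f x else 0)"
    using assms(2) by (auto simp: indicator_def fun_eq_iff)
  ultimately show ?thesis
    using Lebesgue_Measure.integrable_restrict_UNIV[OF assms(4), of f] by simp
qed

lemma sqint_restrict:
  assumes "sqint (lebesgue_on S) f" "T \<subseteq> S" "S \<in> sets lebesgue" "T \<in> sets lebesgue"
  shows "sqint (lebesgue_on T) f"
  using assms unfolding sqint_def
  by (metis measurable_restrict_mono integrable_lebesgue_on_subset)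

lemma sqint_bounded_domain:
  assumes "continuous_on UNIV f" "bounded \<Xi>" "\<Xi> \<in> sets lebesgue"
  shows "sqint (lebesgue_on \<Xi>) (f :: 'a::euclidean_space \<Rightarrow> 'b::euclidean_space)"
proof -
  obtain a where a: "\<Xi> \<subseteq> cbox (- a) a" using bounded_subset_cbox_symmetric[OF assms(2)] by blast
  have "sqint (lebesgue_on (cbox (- a) a)) f"
    unfolding sqint_def
    using assms(1) by (auto intro!: continuous_imp_measurable_on_sets_lebesgue continuous_imp_integrable
        continuous_intros intro: continuous_on_subset)
  from sqint_restrict[OF this a _ assms(3)] show ?thesis by simp
qed

lemma sqint_compact_support:
  assumes "continuous_on UNIV f" "compact C" "\<And>x. x \<notin> C \<Longrightarrow> f x = 0" "\<Xi> \<in> sets lebesgue"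
  shows "sqint (lebesgue_on \<Xi>) (f :: 'a::euclidean_space \<Rightarrow> 'b::euclidean_space)"
proof -
  have "integrable lebesgue (\<lambda>x. (norm (f x))\<^sup>2)"
    using assms by (intro integrable_completion[THEN iffD2] integrable_compact_support[of _ C])
      (auto intro!: continuous_intros borel_measurable_continuous_onI)
  then have "sqint (lebesgue_on UNIV) f"
    using assms(1) by (auto simp: sqint_def lebesgue_on_UNIV_eq
      intro!: borel_measurable_continuous_onI measurable_completion)
  from sqint_restrict[OF this subset_UNIV _ assms(4)] show ?thesis by simp
qed

text \<open>The Cauchy--Schwarz inequality.\<close>

lemma integral_inner_le:
  assumes f: "sqint M f" and g: "sqint M g"
  shows "\<bar>LINT x|M. f x \<bullet> g x\<bar> \<le> sqrt (LINT x|M. f x \<bullet> f x) * sqrt (LINT x|M. g x \<bullet> g x)"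
proof -
  let ?a = "LINT x|M. f x \<bullet> f x" and ?b = "LINT x|M. f x \<bullet> g x" and ?c = "LINT x|M. g x \<bullet> g x"
  note int = integrable_sqint_inner[OF f f] integrable_sqint_inner[OF f g] integrable_sqint_inner[OF g g]
  have pos: "?a \<ge> 0" "?c \<ge> 0" by auto
  have "0 \<le> (LINT x|M. (s *\<^sub>R f x + t *\<^sub>R g x) \<bullet> (s *\<^sub>R f x + t *\<^sub>R g x))" for s t by auto
  also have "(LINT x|M. (s *\<^sub>R f x + t *\<^sub>R g x) \<bullet> (s *\<^sub>R f x + t *\<^sub>R g x))
      = (LINT x|M. s * s * (f x \<bullet> f x) + 2 * s * t * (f x \<bullet> g x) + t * t * (g x \<bullet> g x))" for s t
    by (intro Bochner_Integration.integral_cong refl) (simp add: inner_add inner_commute algebra_simps)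
  also have "\<dots> s t = s * s * ?a + 2 * s * t * ?b + t * t * ?c" for s t
    using int by simp
  finally have q: "0 \<le> s * s * ?a + 2 * s * t * ?b + t * t * ?c" for s t .
  have "?b\<^sup>2 \<le> ?a * ?c"
  proof (cases "?c = 0")
    case True
    have "?b = 0"
    proof (rule ccontr)
      assume "?b \<noteq> 0"
      then show False
        using q[of 1 "- (?a + 1) / (2 * ?b)"] True by (simp add: field_simps)
    qed
    then show ?thesis using True by simp
  next
    case False
    then have "?c > 0" using pos(2) by linarith
    have "0 \<le> ?c * (?a * ?c - ?b\<^sup>2)"
      using q[of ?c "- ?b"] by (simp add: power2_eq_square algebra_simps)
    then show ?thesis using \<open>?c > 0\<close> by (simp add: zero_le_mult_iff)
  qed
  then have "sqrt (?b\<^sup>2) \<le> sqrt (?a * ?c)" by (rule real_sqrt_le_mono)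
  then show ?thesis by (simp add: real_sqrt_mult)
qed

section \<open>Weak derivatives for first order operators\<close>

lemma integral_lebesgue_on_supp:
  fixes f :: "'a::euclidean_space \<Rightarrow> 'b::euclidean_space"
  assumes "S \<in> sets lebesgue" "\<And>x. x \<notin> S \<Longrightarrow> f x = 0"
  shows "(LINT x|lebesgue_on S. f x) = (LINT x|lebesgue. f x)"
proof -
  have "(\<lambda>x. if x \<in> S then f x else 0) = f" using assms(2) by auto
  then show ?thesis using Lebesgue_Measure.integral_restrict_UNIV[OF assms(1), of f] by simp
qed

lemma integral_lebesgue_on_subset_supp:
  fixes f :: "'a::euclidean_space \<Rightarrow> 'b::euclidean_space"
  assumes "S \<in> sets lebesgue" "T \<in> sets lebesgue" "T \<subseteq> S" "\<And>x. x \<notin> T \<Longrightarrow> f x = 0"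
  shows "(LINT x|lebesgue_on S. f x) = (LINT x|lebesgue_on T. f x)"
  using integral_lebesgue_on_supp[of S f] integral_lebesgue_on_supp[of T f] assms by auto

lemma test_function_mono: "test_function K \<phi> \<Longrightarrow> K \<subseteq> \<Xi> \<Longrightarrow> test_function \<Xi> \<phi>"
  unfolding test_function_def by blast

lemma test_function_outside:
  assumes "test_function \<Xi> \<phi>" "x \<notin> \<Xi>"
  shows "\<phi> x = 0" "partial_deriv i \<phi> x = 0"
proof -
  obtain C where C: "compact C" "C \<subseteq> \<Xi>" "\<And>x. x \<notin> C \<Longrightarrow> \<phi> x = 0"
    using assms(1) unfolding test_function_def by auto
  show "\<phi> x = 0" using C assms(2) by blast
  show "partial_deriv i \<phi> x = 0"
    using C assms(2) compact_imp_closed by (intro partial_deriv_outside[of C]) auto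
qed

lemma test_function_cont_diff: "test_function \<Xi> \<phi> \<Longrightarrow> cont_diff m \<phi>"
  by (simp add: test_function_def)

lemma sqint_test_function:
  assumes "test_function \<Xi> \<phi>" "S \<in> sets lebesgue"
  shows "sqint (lebesgue_on S) \<phi>" "sqint (lebesgue_on S) (partial_deriv i \<phi>)"
proof -
  obtain C where C: "compact C" "C \<subseteq> \<Xi>" "\<And>x. x \<notin> C \<Longrightarrow> \<phi> x = 0"
    using assms(1) unfolding test_function_def by auto
  show "sqint (lebesgue_on S) \<phi>"
    using test_function_cont_diff[OF assms(1), of 0] C assms(2)
    by (intro sqint_compact_support[of _ C]) auto
  show "sqint (lebesgue_on S) (partial_deriv i \<phi>)"
    using test_function_cont_diff[OF assms(1), of 1] C assms(2) compact_imp_closed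
    by (intro sqint_compact_support[of _ C] partial_deriv_outside) auto
qed

text \<open>Both \<open>d\<close> and \<open>\<delta>\<close> have the form \<open>\<Sum>\<^sub>i A i \<partial>\<^sub>i\<close> with linear maps \<open>A i\<close>. \<open>weak_deriv A \<Xi> \<omega> \<eta>\<close> says
  that this operator maps \<open>\<omega>\<close> to \<open>\<eta>\<close> on \<open>\<Xi>\<close> in the sense of distributions.\<close>

definition weak_deriv ::
    "('n::finite \<Rightarrow> 'n ext \<Rightarrow> 'n ext) \<Rightarrow> 'n point set \<Rightarrow> 'n dform \<Rightarrow> 'n dform \<Rightarrow> bool" where
  "weak_deriv A \<Xi> \<omega> \<eta> \<longleftrightarrow> (\<forall>\<phi> \<gamma>. test_function \<Xi> \<phi> \<longrightarrow>
     (LINT x|lebesgue_on \<Xi>. \<eta> x $ \<gamma> * \<phi> x)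
     = - (LINT x|lebesgue_on \<Xi>. (\<Sum>i\<in>UNIV. A i (\<omega> x) $ \<gamma> * partial_deriv i \<phi> x)))"

text \<open>The coefficientwise partial derivative of a form defined on the whole space, and the classical
  application of the operator with symbols \<open>A i\<close> to it.\<close>

definition form_deriv :: "'n::finite \<Rightarrow> 'n dform \<Rightarrow> 'n dform" where
  "form_deriv i \<omega> x = (\<chi> \<alpha>. partial_deriv i (\<lambda>y. \<omega> y $ \<alpha>) x)"

definition diff_op :: "('n::finite \<Rightarrow> 'n ext \<Rightarrow> 'n ext) \<Rightarrow> 'n dform \<Rightarrow> 'n dform" where
  "diff_op A \<omega> x = (\<Sum>i\<in>UNIV. A i (form_deriv i \<omega> x))"

text \<open>Continuous differentiability of all coefficients, on the whole space.\<close>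

definition C1_form :: "'n::finite dform \<Rightarrow> bool" where
  "C1_form \<omega> \<longleftrightarrow> (\<forall>\<alpha>. cont_diff 1 (\<lambda>x. \<omega> x $ \<alpha>))"

lemma continuous_on_componentwise_vec:
  "(\<And>i. continuous_on S (\<lambda>x. f x $ i)) \<Longrightarrow> continuous_on S f"
  using continuous_on_vec_lambda[of S "\<lambda>i x. f x $ i"] by (simp add: vec_nth_inverse)

lemma C1_form_continuous: "C1_form \<omega> \<Longrightarrow> continuous_on UNIV \<omega>"
  unfolding C1_form_def using cont_diff_continuous by (blast intro: continuous_on_componentwise_vec)

lemma C1_form_continuous_deriv: "C1_form \<omega> \<Longrightarrow> continuous_on UNIV (form_deriv i \<omega>)"
  unfolding C1_form_def form_deriv_def
  by (intro continuous_on_vec_lambda) (auto simp: One_nat_def)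

lemma linear_continuous_UNIV: "linear (H :: 'b::euclidean_space \<Rightarrow> 'c::euclidean_space) \<Longrightarrow> continuous_on UNIV H"
  by (simp add: linear_continuous_on linear_linear)

lemma C1_form_continuous_diff_op:
  assumes "C1_form \<omega>" "\<And>i. linear (A i)"
  shows "continuous_on UNIV (diff_op A \<omega>)"
  unfolding diff_op_def
  by (intro continuous_on_sum continuous_on_compose2[OF linear_continuous_UNIV[OF assms(2)]]
      C1_form_continuous_deriv assms) auto

lemma linear_vec_expand:
  assumes "linear (H :: real ^ 'm::finite \<Rightarrow> real ^ 'k::finite)"
  shows "H v $ \<gamma> = (\<Sum>\<alpha>\<in>UNIV. v $ \<alpha> * H (axis \<alpha> 1) $ \<gamma>)"
proof -
  have "v = (\<Sum>\<alpha>\<in>UNIV. v $ \<alpha> *\<^sub>R axis \<alpha> 1)" by (simp add: basis_expansion scalar_mult_eq_scaleR[symmetric])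
  then have "H v = (\<Sum>\<alpha>\<in>UNIV. v $ \<alpha> *\<^sub>R H (axis \<alpha> 1))"
    using linear_sum[OF assms, of "\<lambda>\<alpha>. v $ \<alpha> *\<^sub>R axis \<alpha> 1" UNIV] by (simp add: linear_cmul[OF assms])
  then show ?thesis by simp
qed

lemma C1_form_linear:
  assumes "C1_form \<omega>" "linear H"
  shows "C1_form (\<lambda>x. H (\<omega> x))" "form_deriv i (\<lambda>x. H (\<omega> x)) x = H (form_deriv i \<omega> x)"
proof -
  have diff: "(\<lambda>x. \<omega> x $ \<alpha>) differentiable (at x)" for \<alpha> x
    using assms(1) by (simp add: C1_form_def)
  show "C1_form (\<lambda>x. H (\<omega> x))"
    using assms(1) unfolding C1_form_def linear_vec_expand[OF assms(2), of "\<omega> _"]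
    by (intro allI cont_diff_sum cont_diff_mult cont_diff_const) auto
  have "partial_deriv i (\<lambda>x. \<Sum>\<alpha>\<in>UNIV. \<omega> x $ \<alpha> * H (axis \<alpha> 1) $ \<gamma>) x
      = (\<Sum>\<alpha>\<in>UNIV. partial_deriv i (\<lambda>x. \<omega> x $ \<alpha>) x * H (axis \<alpha> 1) $ \<gamma>)" for \<gamma>
    by (subst partial_deriv_eq[OF has_derivative_sum[OF
            has_derivative_mult_left[OF partial_deriv_has_derivative[OF diff]]]])
      (simp add: partial_deriv_def)
  then show "form_deriv i (\<lambda>x. H (\<omega> x)) x = H (form_deriv i \<omega> x)"
    by (simp add: vec_eq_iff form_deriv_def linear_vec_expand[OF assms(2), of "\<omega> _"]
        linear_vec_expand[OF assms(2), of "\<chi> \<alpha>. _ \<alpha>"])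
qed

lemma C1_form_test: "(\<And>\<alpha>. test_function \<Xi> (\<lambda>x. \<psi> x $ \<alpha>)) \<Longrightarrow> C1_form \<psi>"
  by (simp add: C1_form_def test_function_def del: cont_diff.simps)

text \<open>The classical derivative is a weak derivative: integrate by parts.\<close>

lemma weak_deriv_diff_op:
  assumes \<omega>: "C1_form \<omega>" and A: "\<And>i. linear (A i)" and \<Xi>: "\<Xi> \<in> sets lebesgue"
  shows "weak_deriv A \<Xi> \<omega> (diff_op A \<omega>)"
  unfolding weak_deriv_def
proof (intro allI impI)
  fix \<phi> \<gamma> assume \<phi>: "test_function \<Xi> \<phi>"
  obtain C where C: "compact C" "\<And>x. x \<notin> C \<Longrightarrow> \<phi> x = 0"
    using \<phi> unfolding test_function_def by auto
  define g where "g i x = A i (\<omega> x) $ \<gamma>" for i x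
  have g: "cont_diff 1 (g i)" for i
    using C1_form_linear(1)[OF \<omega> A] unfolding C1_form_def g_def by blast
  have gd: "partial_deriv i (g i) x = A i (form_deriv i \<omega> x) $ \<gamma>" for i x
    using C1_form_linear(2)[OF \<omega> A, of i i x] by (simp add: g_def[abs_def] form_deriv_def vec_eq_iff)
  have \<phi>1: "cont_diff 1 \<phi>" using \<phi> by (rule test_function_cont_diff)
  have cont: "continuous_on UNIV (g i)" "continuous_on UNIV (partial_deriv i (g i))"
    "continuous_on UNIV \<phi>" "continuous_on UNIV (partial_deriv i \<phi>)" for i
    using g \<phi>1 cont_diff_continuous[OF g] cont_diff_continuous[OF \<phi>1] by auto
  have out: "partial_deriv i \<phi> x = 0" if "x \<notin> C" for i x
    using partial_deriv_outside[OF compact_imp_closed[OF C(1)] C(2) that] by auto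
  have int: "integrable lebesgue (\<lambda>x. partial_deriv i (g i) x * \<phi> x)"
    "integrable lebesgue (\<lambda>x. g i x * partial_deriv i \<phi> x)" for i
    using cont C out
    by (auto intro!: integrable_completion[THEN iffD2] integrable_compact_support[of _ C] continuous_intros
        borel_measurable_continuous_onI)
  have "(LINT x|lebesgue. partial_deriv i (g i) x * \<phi> x) + (LINT x|lebesgue. g i x * partial_deriv i \<phi> x) = 0" for i
  proof -
    have "(LINT x|lebesgue. partial_deriv i (\<lambda>x. g i x * \<phi> x) x) = 0"
      using C by (intro integral_partial_deriv_compact_support[of _ C] cont_diff_mult g \<phi>1) auto
    moreover have "partial_deriv i (\<lambda>x. g i x * \<phi> x) x
        = partial_deriv i (g i) x * \<phi> x + g i x * partial_deriv i \<phi> x" for x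
      using g[of i] \<phi>1 by (intro partial_deriv_mult) auto
    ultimately show ?thesis using int[of i] by simp
  qed
  then have "(\<Sum>i\<in>UNIV. LINT x|lebesgue. partial_deriv i (g i) x * \<phi> x)
      = - (\<Sum>i\<in>UNIV. LINT x|lebesgue. g i x * partial_deriv i \<phi> x)"
    unfolding sum_negf[symmetric] eq_neg_iff_add_eq_0[symmetric] by (intro sum.cong refl)
  then have "(LINT x|lebesgue. diff_op A \<omega> x $ \<gamma> * \<phi> x)
      = - (LINT x|lebesgue. (\<Sum>i\<in>UNIV. A i (\<omega> x) $ \<gamma> * partial_deriv i \<phi> x))"
    using int by (simp add: diff_op_def sum_distrib_right gd g_def)
  then show "(LINT x|lebesgue_on \<Xi>. diff_op A \<omega> x $ \<gamma> * \<phi> x)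
      = - (LINT x|lebesgue_on \<Xi>. (\<Sum>i\<in>UNIV. A i (\<omega> x) $ \<gamma> * partial_deriv i \<phi> x))"
    using test_function_outside[OF \<phi>] by (subst (1 2) integral_lebesgue_on_supp[OF \<Xi>]) auto
qed

lemma sqint_symbol:
  assumes "sqint M \<omega>" "\<And>i. linear (A i)"
  shows "sqint M (\<lambda>x. A i (\<omega> x) $ \<gamma>)"
  by (rule sqint_nth[OF sqint_linear[OF assms(2,1)]])

lemma integrable_symbol_test:
  assumes "sqint (lebesgue_on \<Xi>) \<omega>" "\<And>i. linear (A i)" "test_function \<Xi>' \<phi>" "\<Xi> \<in> sets lebesgue"
  shows "integrable (lebesgue_on \<Xi>) (\<lambda>x. (\<Sum>i\<in>UNIV. A i (\<omega> x) $ \<gamma> * partial_deriv i \<phi> x))"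
  by (intro Bochner_Integration.integrable_sum integrable_sqint_mult sqint_symbol sqint_test_function[OF assms(3,4)] assms)

lemma weak_deriv_diff:
  assumes "\<Xi> \<in> sets lebesgue" "\<And>i. linear (A i)"
    and "weak_deriv A \<Xi> \<omega> \<eta>" "weak_deriv A \<Xi> \<omega>' \<eta>'"
    and "sqint (lebesgue_on \<Xi>) \<omega>" "sqint (lebesgue_on \<Xi>) \<omega>'" "sqint (lebesgue_on \<Xi>) \<eta>" "sqint (lebesgue_on \<Xi>) \<eta>'"
  shows "weak_deriv A \<Xi> (\<lambda>x. \<omega> x - \<omega>' x) (\<lambda>x. \<eta> x - \<eta>' x)"
  unfolding weak_deriv_def
proof (intro allI impI)
  fix \<phi> \<gamma> assume \<phi>: "test_function \<Xi> \<phi>"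
  have i: "integrable (lebesgue_on \<Xi>) (\<lambda>x. \<eta> x $ \<gamma> * \<phi> x)" "integrable (lebesgue_on \<Xi>) (\<lambda>x. \<eta>' x $ \<gamma> * \<phi> x)"
    by (intro integrable_sqint_mult sqint_nth sqint_test_function[OF \<phi>] assms)+
  note j = integrable_symbol_test[OF assms(5) assms(2) \<phi> assms(1), where \<gamma> = \<gamma>]
    integrable_symbol_test[OF assms(6) assms(2) \<phi> assms(1), where \<gamma> = \<gamma>]
  have "(LINT x|lebesgue_on \<Xi>. (\<eta> x - \<eta>' x) $ \<gamma> * \<phi> x)
      = (LINT x|lebesgue_on \<Xi>. \<eta> x $ \<gamma> * \<phi> x) - (LINT x|lebesgue_on \<Xi>. \<eta>' x $ \<gamma> * \<phi> x)"
    using i by (simp add: left_diff_distrib)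
  also have "\<dots> = - ((LINT x|lebesgue_on \<Xi>. (\<Sum>i\<in>UNIV. A i (\<omega> x) $ \<gamma> * partial_deriv i \<phi> x))
     - (LINT x|lebesgue_on \<Xi>. (\<Sum>i\<in>UNIV. A i (\<omega>' x) $ \<gamma> * partial_deriv i \<phi> x)))"
    using assms(3,4) \<phi> by (simp add: weak_deriv_def)
  also have "\<dots> = - (LINT x|lebesgue_on \<Xi>. (\<Sum>i\<in>UNIV. A i (\<omega> x) $ \<gamma> * partial_deriv i \<phi> x)
     - (\<Sum>i\<in>UNIV. A i (\<omega>' x) $ \<gamma> * partial_deriv i \<phi> x))"
    using j by (subst Bochner_Integration.integral_diff) auto
  finally show "(LINT x|lebesgue_on \<Xi>. (\<eta> x - \<eta>' x) $ \<gamma> * \<phi> x)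
     = - (LINT x|lebesgue_on \<Xi>. (\<Sum>i\<in>UNIV. A i (\<omega> x - \<omega>' x) $ \<gamma> * partial_deriv i \<phi> x))"
    by (simp add: linear_diff[OF assms(2)] left_diff_distrib sum_subtractf)
qed

lemma weak_deriv_unique:
  assumes \<Xi>: "open \<Xi>" and A: "\<And>i. linear (A i)"
    and "weak_deriv A \<Xi> \<omega> \<eta>" "weak_deriv A \<Xi> \<omega>' \<eta>'"
    and sq: "sqint (lebesgue_on \<Xi>) \<omega>" "sqint (lebesgue_on \<Xi>) \<omega>'" "sqint (lebesgue_on \<Xi>) \<eta>" "sqint (lebesgue_on \<Xi>) \<eta>'"
    and AE: "AE x in lebesgue_on \<Xi>. \<omega> x = \<omega>' x"
  shows "AE x in lebesgue_on \<Xi>. \<eta> x = \<eta>' x"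
proof -
  have \<Xi>s: "\<Xi> \<in> sets lebesgue" using \<Xi> by simp
  have d: "weak_deriv A \<Xi> (\<lambda>x. \<omega> x - \<omega>' x) (\<lambda>x. \<eta> x - \<eta>' x)"
    using weak_deriv_diff[OF \<Xi>s] assms by blast
  have sqd: "sqint (lebesgue_on \<Xi>) (\<lambda>x. \<omega> x - \<omega>' x)" "sqint (lebesgue_on \<Xi>) (\<lambda>x. \<eta> x - \<eta>' x)"
    using sq by (auto intro: sqint_diff)
  have "AE x in lebesgue_on \<Xi>. (\<eta> x - \<eta>' x) $ \<gamma> = 0" for \<gamma>
  proof (rule AE_eq_0_if_orthogonal_test_functions[OF \<Xi>])
    fix a b assume ab: "cbox a b \<subseteq> \<Xi>"
    show "integrable (lebesgue_on (cbox a b)) (\<lambda>x. (\<eta> x - \<eta>' x) $ \<gamma>)"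
      by (intro integrable_sqint sqint_nth sqint_restrict[OF sqd(2) ab \<Xi>s]
          finite_measure_lebesgue_on) auto
  next
    fix \<phi> assume \<phi>: "test_function \<Xi> \<phi>"
    have "(LINT x|lebesgue_on \<Xi>. (\<Sum>i\<in>UNIV. A i (\<omega> x - \<omega>' x) $ \<gamma> * partial_deriv i \<phi> x)) = (LINT x|lebesgue_on \<Xi>. 0)"
      using integrable_symbol_test[OF sqd(1) A \<phi> \<Xi>s] AE
      by (intro integral_cong_AE) (auto elim!: eventually_mono simp: linear_0[OF A])
    then show "(LINT x|lebesgue_on \<Xi>. (\<eta> x - \<eta>' x) $ \<gamma> * \<phi> x) = 0"
      using d \<phi> by (simp add: weak_deriv_def)
  qed
  then have "AE x in lebesgue_on \<Xi>. \<forall>\<gamma>. (\<eta> x - \<eta>' x) $ \<gamma> = 0"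
    by (simp add: AE_all_countable)
  then show ?thesis by eventually_elim (simp add: vec_eq_iff)
qed

lemma weak_deriv_restrict:
  assumes "weak_deriv A \<Xi> \<omega> \<eta>" "K \<subseteq> \<Xi>" "K \<in> sets lebesgue" "\<Xi> \<in> sets lebesgue"
  shows "weak_deriv A K \<omega> \<eta>"
  unfolding weak_deriv_def
proof (intro allI impI)
  fix \<phi> \<gamma> assume \<phi>: "test_function K \<phi>"
  show "(LINT x|lebesgue_on K. \<eta> x $ \<gamma> * \<phi> x)
      = - (LINT x|lebesgue_on K. (\<Sum>i\<in>UNIV. A i (\<omega> x) $ \<gamma> * partial_deriv i \<phi> x))"
    using assms(1) test_function_mono[OF \<phi> assms(2)] test_function_outside[OF \<phi>] assms(2-4)
    by (subst (1 2) integral_lebesgue_on_subset_supp[symmetric, of \<Xi> K]) (auto simp: weak_deriv_def)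
qed

lemma weak_deriv_test_form:
  assumes w: "weak_deriv A \<Xi> \<omega> \<eta>" and \<Xi>: "\<Xi> \<in> sets lebesgue"
    and A: "\<And>i. linear (A i)" and adj: "\<And>i v w. A i v \<bullet> w = - (v \<bullet> B i w)"
    and sq: "sqint (lebesgue_on \<Xi>) \<omega>" "sqint (lebesgue_on \<Xi>) \<eta>"
    and \<psi>: "\<And>\<alpha>. test_function \<Xi> (\<lambda>x. \<psi> x $ \<alpha>)"
  shows "(LINT x|lebesgue_on \<Xi>. \<eta> x \<bullet> \<psi> x) = (LINT x|lebesgue_on \<Xi>. \<omega> x \<bullet> diff_op B \<psi> x)"
proof -
  have i: "integrable (lebesgue_on \<Xi>) (\<lambda>x. \<eta> x $ \<gamma> * \<psi> x $ \<gamma>)" for \<gamma>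
    by (intro integrable_sqint_mult sqint_nth sqint_test_function[OF \<psi>] sq \<Xi>)
  have "(LINT x|lebesgue_on \<Xi>. \<eta> x \<bullet> \<psi> x) = (\<Sum>\<gamma>\<in>UNIV. LINT x|lebesgue_on \<Xi>. \<eta> x $ \<gamma> * \<psi> x $ \<gamma>)"
    using i by (simp add: inner_vec_def)
  also have "\<dots> = - (\<Sum>\<gamma>\<in>UNIV. LINT x|lebesgue_on \<Xi>. (\<Sum>i\<in>UNIV. A i (\<omega> x) $ \<gamma> * partial_deriv i (\<lambda>x. \<psi> x $ \<gamma>) x))"
    using w \<psi> by (simp add: weak_deriv_def sum_negf)
  also have "\<dots> = - (LINT x|lebesgue_on \<Xi>. (\<Sum>\<gamma>\<in>UNIV. \<Sum>i\<in>UNIV. A i (\<omega> x) $ \<gamma> * partial_deriv i (\<lambda>x. \<psi> x $ \<gamma>) x))"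
    using integrable_symbol_test[OF sq(1) A \<psi> \<Xi>] by (subst Bochner_Integration.integral_sum) auto
  also have "\<dots> = - (LINT x|lebesgue_on \<Xi>. - (\<omega> x \<bullet> diff_op B \<psi> x))"
  proof -
    have "(\<Sum>\<gamma>\<in>UNIV. (\<Sum>i\<in>UNIV. A i (\<omega> x) $ \<gamma> * partial_deriv i (\<lambda>x. \<psi> x $ \<gamma>) x))
        = (\<Sum>i\<in>UNIV. A i (\<omega> x) \<bullet> form_deriv i \<psi> x)" for x
      unfolding inner_vec_def form_deriv_def by (subst sum.swap) simp
    then show ?thesis by (simp add: adj diff_op_def inner_sum_right sum_negf)
  qed
  finally show ?thesis by simp
qed

text \<open>Green's formula without boundary term: it suffices that one of the two factors is a limit of
  test forms in the graph norm.\<close>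

lemma weak_deriv_green:
  assumes w: "weak_deriv A \<Xi> \<omega> \<eta>" and \<Xi>: "\<Xi> \<in> sets lebesgue"
    and A: "\<And>i. linear (A i)" and B: "\<And>i. linear (B i)" and adj: "\<And>i v w. A i v \<bullet> w = - (v \<bullet> B i w)"
    and sq: "sqint (lebesgue_on \<Xi>) \<omega>" "sqint (lebesgue_on \<Xi>) \<eta>"
      "sqint (lebesgue_on \<Xi>) \<mu>" "sqint (lebesgue_on \<Xi>) \<nu>"
    and approx: "\<And>\<epsilon>. \<epsilon> > 0 \<Longrightarrow> \<exists>\<psi>. (\<forall>\<alpha>. test_function \<Xi> (\<lambda>x. \<psi> x $ \<alpha>))
        \<and> sqrt (L2inner \<Xi> (\<lambda>x. \<mu> x - \<psi> x) (\<lambda>x. \<mu> x - \<psi> x)) < \<epsilon>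
        \<and> sqrt (L2inner \<Xi> (\<lambda>x. \<nu> x - diff_op B \<psi> x) (\<lambda>x. \<nu> x - diff_op B \<psi> x)) < \<epsilon>"
  shows "(LINT x|lebesgue_on \<Xi>. \<eta> x \<bullet> \<mu> x) = (LINT x|lebesgue_on \<Xi>. \<omega> x \<bullet> \<nu> x)" (is "?l = ?r")
proof -
  let ?N = "\<lambda>f. sqrt (L2inner \<Xi> f f)"
  have "\<bar>?l - ?r\<bar> \<le> 0 + \<epsilon>" if eps: "\<epsilon> > 0" for \<epsilon>
  proof -
    define c where "c = ?N \<eta> + ?N \<omega> + 1"
    have N0: "?N f \<ge> 0" for f unfolding L2inner_def by (intro real_sqrt_ge_zero Bochner_Integration.integral_nonneg) auto
    have c: "c > 0" using N0[of \<eta>] N0[of \<omega>] unfolding c_def by linarith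
    obtain \<psi> where \<psi>: "\<And>\<alpha>. test_function \<Xi> (\<lambda>x. \<psi> x $ \<alpha>)"
      "?N (\<lambda>x. \<mu> x - \<psi> x) < \<epsilon> / c" "?N (\<lambda>x. \<nu> x - diff_op B \<psi> x) < \<epsilon> / c"
      using approx[of "\<epsilon> / c"] divide_pos_pos[OF eps c] by blast
    have sq\<psi>: "sqint (lebesgue_on \<Xi>) \<psi>"
    proof -
      have "sqint (lebesgue_on \<Xi>) (\<lambda>x. \<Sum>\<alpha>\<in>UNIV. \<psi> x $ \<alpha> *\<^sub>R axis \<alpha> (1::real))"
        by (intro sqint_sum sqint_linear[of "\<lambda>r. r *\<^sub>R axis _ 1"] sqint_test_function[OF \<psi>(1)] \<Xi>)
          (auto intro!: linearI simp: scaleR_add_left)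
      then show ?thesis by (simp add: basis_expansion scalar_mult_eq_scaleR[symmetric])
    qed
    have sqD: "sqint (lebesgue_on \<Xi>) (diff_op B \<psi>)"
    proof -
      have "sqint (lebesgue_on \<Xi>) (\<lambda>x. \<Sum>i\<in>UNIV. B i (\<Sum>\<alpha>\<in>UNIV. partial_deriv i (\<lambda>x. \<psi> x $ \<alpha>) x *\<^sub>R axis \<alpha> (1::real)))"
        by (intro sqint_sum sqint_linear[OF B] sqint_linear[of "\<lambda>r. r *\<^sub>R axis _ 1"] sqint_test_function[OF \<psi>(1)] \<Xi>)
          (auto intro!: linearI simp: scaleR_add_left)
      moreover have "(\<Sum>\<alpha>\<in>UNIV. partial_deriv i (\<lambda>x. \<psi> x $ \<alpha>) x *\<^sub>R axis \<alpha> 1) = form_deriv i \<psi> x" for i x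
        using basis_expansion[of "form_deriv i \<psi> x"] by (simp add: form_deriv_def scalar_mult_eq_scaleR)
      ultimately show ?thesis by (simp add: diff_op_def[abs_def])
    qed
    note ints = integrable_sqint_inner[OF sq(2,3)] integrable_sqint_inner[OF sq(1,4)]
       integrable_sqint_inner[OF sq(2) sq\<psi>] integrable_sqint_inner[OF sq(1) sqD]
    have "?l - ?r = (LINT x|lebesgue_on \<Xi>. \<eta> x \<bullet> (\<mu> x - \<psi> x)) - (LINT x|lebesgue_on \<Xi>. \<omega> x \<bullet> (\<nu> x - diff_op B \<psi> x))"
      using ints weak_deriv_test_form[OF w \<Xi> A adj sq(1,2) \<psi>(1)] by (simp add: inner_diff_right)
    moreover have "\<bar>LINT x|lebesgue_on \<Xi>. \<eta> x \<bullet> (\<mu> x - \<psi> x)\<bar> \<le> ?N \<eta> * ?N (\<lambda>x. \<mu> x - \<psi> x)"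
      using integral_inner_le[OF sq(2) sqint_diff[OF sq(3) sq\<psi>]] by (simp add: L2inner_def)
    moreover have "\<bar>LINT x|lebesgue_on \<Xi>. \<omega> x \<bullet> (\<nu> x - diff_op B \<psi> x)\<bar> \<le> ?N \<omega> * ?N (\<lambda>x. \<nu> x - diff_op B \<psi> x)"
      using integral_inner_le[OF sq(1) sqint_diff[OF sq(4) sqD]] by (simp add: L2inner_def)
    moreover have "?N \<eta> * ?N (\<lambda>x. \<mu> x - \<psi> x) \<le> ?N \<eta> * (\<epsilon> / c)"
      using \<psi>(2) N0 by (intro mult_left_mono) auto
    moreover have "?N \<omega> * ?N (\<lambda>x. \<nu> x - diff_op B \<psi> x) \<le> ?N \<omega> * (\<epsilon> / c)"
      using \<psi>(3) N0 by (intro mult_left_mono) auto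
    moreover have "?N \<eta> * (\<epsilon> / c) + ?N \<omega> * (\<epsilon> / c) \<le> \<epsilon>"
    proof -
      have "(?N \<eta> + ?N \<omega>) * \<epsilon> \<le> c * \<epsilon>" using eps by (intro mult_right_mono) (auto simp: c_def)
      then show ?thesis using c by (simp add: field_simps)
    qed
    ultimately show ?thesis by linarith
  qed
  then have "\<bar>?l - ?r\<bar> \<le> 0" by (rule field_le_epsilon)
  then show ?thesis by simp
qed

section \<open>Weak exterior derivative, codifferential and Green's formula\<close>

text \<open>The symbol of the codifferential, the negative adjoint of that of \<open>d\<close>.\<close>

abbreviation cod_symbol :: "'n::{finite,linorder} \<Rightarrow> 'n ext \<Rightarrow> 'n ext" where
  "cod_symbol i v \<equiv> - contract i v"

lemma linear_cod_symbol: "linear (cod_symbol i)"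
  by (rule linearI) (simp_all add: linear_add[OF linear_contract] linear_cmul[OF linear_contract])

lemma cod_symbol_inner: "cod_symbol i v \<bullet> w = - (v \<bullet> dx_wedge i w)"
  by (simp add: dx_wedge_inner inner_commute[of "contract i v"] inner_commute[of v "dx_wedge i w"])

lemma L2form_iff: "\<omega> \<in> L2form k \<Xi> \<longleftrightarrow> (\<forall>x\<in>\<Xi>. \<omega> x \<in> alt k) \<and> sqint (lebesgue_on \<Xi>) \<omega>"
  by (auto simp: L2form_def sqint_def)

lemma L2form_sqint: "\<omega> \<in> L2form k \<Xi> \<Longrightarrow> sqint (lebesgue_on \<Xi>) \<omega>"
  by (simp add: L2form_iff)

lemma L2form_restrict:
  "\<omega> \<in> L2form k \<Xi> \<Longrightarrow> K \<subseteq> \<Xi> \<Longrightarrow> K \<in> sets lebesgue \<Longrightarrow> \<Xi> \<in> sets lebesgue \<Longrightarrow> \<omega> \<in> L2form k K"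
  unfolding L2form_iff using sqint_restrict by blast

lemma L2form_diff: "\<omega> \<in> L2form k \<Xi> \<Longrightarrow> \<tau> \<in> L2form k \<Xi> \<Longrightarrow> (\<lambda>x. \<omega> x - \<tau> x) \<in> L2form k \<Xi>"
  unfolding L2form_iff using sqint_diff alt_diff by blast

text \<open>For a multi-index whose size is not \<open>k + 1\<close> both sides of the weak identity vanish, so it may be required
  for all multi-indices.\<close>

lemma has_extd_iff:
  assumes "\<omega> \<in> L2form k \<Xi>"
  shows "has_extd k \<Xi> \<omega> \<eta> \<longleftrightarrow> \<eta> \<in> L2form (Suc k) \<Xi> \<and> weak_deriv dx_wedge \<Xi> \<omega> \<eta>"
proof (cases "\<eta> \<in> L2form (Suc k) \<Xi>")
  case True
  have e: "(\<Sum>i\<in>UNIV. dx_wedge i (\<omega> x) $ \<beta> * partial_deriv i \<phi> x)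
      = (\<Sum>i\<in>\<beta>. pos_sign i \<beta> * \<omega> x $ (\<beta> - {i}) * partial_deriv i \<phi> x)" for x \<beta> \<phi>
    by (rule sum.mono_neutral_cong_right) (auto simp: dx_wedge_nth)
  have z: "(LINT x|lebesgue_on \<Xi>. \<eta> x $ \<beta> * \<phi> x) = (LINT x|lebesgue_on \<Xi>. 0)"
      "(LINT x|lebesgue_on \<Xi>. (\<Sum>i\<in>UNIV. dx_wedge i (\<omega> x) $ \<beta> * partial_deriv i \<phi> x)) = (LINT x|lebesgue_on \<Xi>. 0)"
    if "card \<beta> \<noteq> Suc k" for \<beta> and \<phi> :: "'a point \<Rightarrow> real"
  proof -
    have z: "\<eta> x $ \<beta> = 0" "dx_wedge i (\<omega> x) $ \<beta> = 0" if "x \<in> \<Xi>" for i x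
      using True assms that altD[OF _ \<open>card \<beta> \<noteq> Suc k\<close>] dx_wedge_alt[of "\<omega> x" k i] by (auto simp: L2form_iff)
    show "(LINT x|lebesgue_on \<Xi>. \<eta> x $ \<beta> * \<phi> x) = (LINT x|lebesgue_on \<Xi>. 0)"
      by (rule Bochner_Integration.integral_cong[OF refl]) (simp add: z)
    show "(LINT x|lebesgue_on \<Xi>. (\<Sum>i\<in>UNIV. dx_wedge i (\<omega> x) $ \<beta> * partial_deriv i \<phi> x)) = (LINT x|lebesgue_on \<Xi>. 0)"
      by (rule Bochner_Integration.integral_cong[OF refl]) (simp add: z)
  qed
  have "weak_deriv dx_wedge \<Xi> \<omega> \<eta> \<longleftrightarrow> (\<forall>\<beta> \<phi>. card \<beta> = Suc k \<and> test_function \<Xi> \<phi> \<longrightarrow>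
        (LINT x|lebesgue_on \<Xi>. \<eta> x $ \<beta> * \<phi> x) =
        - (LINT x|lebesgue_on \<Xi>. (\<Sum>i\<in>UNIV. dx_wedge i (\<omega> x) $ \<beta> * partial_deriv i \<phi> x)))"
    unfolding weak_deriv_def
  proof (intro iffI allI impI)
    fix \<phi> \<beta>
    assume *: "\<forall>\<beta> \<phi>. card \<beta> = Suc k \<and> test_function \<Xi> \<phi> \<longrightarrow> (LINT x|lebesgue_on \<Xi>. \<eta> x $ \<beta> * \<phi> x) =
        - (LINT x|lebesgue_on \<Xi>. (\<Sum>i\<in>UNIV. dx_wedge i (\<omega> x) $ \<beta> * partial_deriv i \<phi> x))"
      and \<phi>: "test_function \<Xi> \<phi>"
    show "(LINT x|lebesgue_on \<Xi>. \<eta> x $ \<beta> * \<phi> x) =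
        - (LINT x|lebesgue_on \<Xi>. (\<Sum>i\<in>UNIV. dx_wedge i (\<omega> x) $ \<beta> * partial_deriv i \<phi> x))"
    proof (cases "card \<beta> = Suc k")
      case True
      with *[rule_format, of \<beta> \<phi>] \<phi> show ?thesis by blast
    next
      case False
      show ?thesis unfolding z[OF False] by simp
    qed
  qed blast
  then show ?thesis using True unfolding has_extd_def e by blast
qed (simp add: has_extd_def)

text \<open>The inverse of the Hodge star on all of the exterior algebra.\<close>

definition hodge_inv :: "'n::{finite,linorder} ext \<Rightarrow> 'n ext" where
  "hodge_inv v = (\<chi> \<gamma>. v $ (- \<gamma>) * shuffle_sign \<gamma> (- \<gamma>))"

lemma hodge_inv_nth: "hodge_inv v $ \<gamma> = v $ (- \<gamma>) * shuffle_sign \<gamma> (- \<gamma>)"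
  by (simp add: hodge_inv_def)

lemma hodge_hodge_inv [simp]: "hodge (hodge_inv v) = v" "hodge_inv (hodge v) = v"
  by (simp_all add: vec_eq_iff hodge_nth hodge_inv_nth mult.assoc shuffle_sign_square)

lemma linear_hodge_inv: "linear hodge_inv"
  by (rule linearI) (simp_all add: vec_eq_iff hodge_inv_nth algebra_simps)

lemma hodge_inv_alt:
  fixes v :: "'n::{finite,linorder} ext"
  assumes "v \<in> alt k" "k \<le> CARD('n)"
  shows "hodge_inv v \<in> alt (CARD('n) - k)"
  unfolding alt_def
proof (intro CollectI allI impI)
  fix \<gamma> :: "'n set"
  assume "card \<gamma> \<noteq> CARD('n) - k"
  then have "card (- \<gamma>) \<noteq> k" using card_le_UNIV[of \<gamma>] by (auto simp: card_Compl')
  then show "hodge_inv v $ \<gamma> = 0" using altD[OF assms(1)] by (simp add: hodge_inv_nth)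
qed

text \<open>Conjugating \<open>d\<close> with the Hodge star, with the sign that belongs to the codifferential, gives the first
  order operator with symbol \<open>cod_symbol\<close>.\<close>

lemma has_codiff_iff:
  fixes \<mu> :: "'n::{finite,linorder} dform"
  assumes \<mu>: "\<mu> \<in> L2form (Suc k) \<Xi>" and k: "k < CARD('n)"
  shows "has_codiff (Suc k) \<Xi> \<mu> \<nu> \<longleftrightarrow> \<nu> \<in> L2form k \<Xi> \<and> weak_deriv cod_symbol \<Xi> \<mu> \<nu>"
proof -
  define s :: real where "s = (-1) ^ (CARD('n) * (Suc k + 1) + 1)"
  have s: "s * s = 1" by (simp add: s_def power_mult_distrib[symmetric])
  have h\<mu>: "(\<lambda>x. hodge (\<mu> x)) \<in> L2form (CARD('n) - Suc k) \<Xi>"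
    using \<mu> unfolding L2form_iff by (auto intro: hodge_alt sqint_linear[OF linear_hodge])
  have sub: "Suc (CARD('n) - Suc k) = CARD('n) - k" using k by simp
  have L2: "(\<lambda>x. s *\<^sub>R hodge (\<eta> x)) \<in> L2form k \<Xi> \<longleftrightarrow> \<eta> \<in> L2form (CARD('n) - k) \<Xi>" for \<eta> :: "'n dform"
  proof
    assume "\<eta> \<in> L2form (CARD('n) - k) \<Xi>"
    then show "(\<lambda>x. s *\<^sub>R hodge (\<eta> x)) \<in> L2form k \<Xi>"
      using hodge_alt[of "\<eta> _" "CARD('n) - k"] k unfolding L2form_iff
      by (auto intro!: alt_scaleR sqint_scaleR sqint_linear[OF linear_hodge])
  next
    assume a: "(\<lambda>x. s *\<^sub>R hodge (\<eta> x)) \<in> L2form k \<Xi>"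
    have e: "s *\<^sub>R hodge_inv (s *\<^sub>R hodge v) = v" for v :: "'n ext"
      by (simp add: linear_cmul[OF linear_hodge_inv] s)
    have "hodge_inv (s *\<^sub>R hodge (\<eta> x)) \<in> alt (CARD('n) - k)" if "x \<in> \<Xi>" for x
      using a that k by (intro hodge_inv_alt) (auto simp: L2form_iff)
    then have "(\<lambda>x. s *\<^sub>R hodge_inv (s *\<^sub>R hodge (\<eta> x))) \<in> L2form (CARD('n) - k) \<Xi>"
      using a unfolding L2form_iff
      by (auto intro!: alt_scaleR[of "hodge_inv _"] sqint_scaleR[of _ "\<lambda>x. hodge_inv (s *\<^sub>R hodge (\<eta> x))"]
          sqint_linear[OF linear_hodge_inv, of _ "\<lambda>x. s *\<^sub>R hodge (\<eta> x)"])
    then show "\<eta> \<in> L2form (CARD('n) - k) \<Xi>" by (simp only: e)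
  qed
  have weak: "weak_deriv cod_symbol \<Xi> \<mu> (\<lambda>x. s *\<^sub>R hodge (\<eta> x)) \<longleftrightarrow> weak_deriv dx_wedge \<Xi> (\<lambda>x. hodge (\<mu> x)) \<eta>"
    for \<eta> :: "'n dform"
  proof -
    have l: "(LINT x|lebesgue_on \<Xi>. (s *\<^sub>R hodge (\<eta> x)) $ \<gamma> * \<phi> x)
        = (s * shuffle_sign (- \<gamma>) \<gamma>) * (LINT x|lebesgue_on \<Xi>. \<eta> x $ (- \<gamma>) * \<phi> x)" for \<gamma> and \<phi> :: "'n point \<Rightarrow> real"
      by (subst integral_mult_right_zero[symmetric]) (simp add: hodge_nth mult_ac)
    have r: "(LINT x|lebesgue_on \<Xi>. (\<Sum>i\<in>UNIV. cod_symbol i (\<mu> x) $ \<gamma> * partial_deriv i \<phi> x))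
        = (s * shuffle_sign (- \<gamma>) \<gamma>) *
          (LINT x|lebesgue_on \<Xi>. (\<Sum>i\<in>UNIV. dx_wedge i (hodge (\<mu> x)) $ (- \<gamma>) * partial_deriv i \<phi> x))" for \<gamma> and \<phi> :: "'n point \<Rightarrow> real"
    proof (subst integral_mult_right_zero[symmetric], rule Bochner_Integration.integral_cong[OF refl])
      fix x assume "x \<in> space (lebesgue_on \<Xi>)"
      then have "\<mu> x \<in> alt (Suc k)" using \<mu> by (auto simp: L2form_iff)
      then have "cod_symbol i (\<mu> x) = s *\<^sub>R hodge (dx_wedge i (hodge (\<mu> x)))" for i
        using hodge_dx_wedge_hodge[OF _ k] by (simp add: s_def)
      then show "(\<Sum>i\<in>UNIV. cod_symbol i (\<mu> x) $ \<gamma> * partial_deriv i \<phi> x) = (s * shuffle_sign (- \<gamma>) \<gamma>) *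
          (\<Sum>i\<in>UNIV. dx_wedge i (hodge (\<mu> x)) $ (- \<gamma>) * partial_deriv i \<phi> x)"
        by (simp add: hodge_nth sum_distrib_left mult_ac)
    qed
    have nz: "s * shuffle_sign (- \<gamma>) \<gamma> \<noteq> 0" for \<gamma> :: "'n set"
      using s shuffle_sign_square[of "- \<gamma>" \<gamma>] by auto
    have cancel: "s * shuffle_sign (- \<gamma>) \<gamma> * a = - (s * shuffle_sign (- \<gamma>) \<gamma> * b) \<longleftrightarrow> a = - b"
      for \<gamma> :: "'n set" and a b
      using nz[of \<gamma>] by (metis mult_cancel_left mult_minus_right)
    have "weak_deriv cod_symbol \<Xi> \<mu> (\<lambda>x. s *\<^sub>R hodge (\<eta> x)) \<longleftrightarrow>
      (\<forall>\<phi> \<gamma>. test_function \<Xi> \<phi> \<longrightarrow> (LINT x|lebesgue_on \<Xi>. \<eta> x $ (- \<gamma>) * \<phi> x)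
        = - (LINT x|lebesgue_on \<Xi>. (\<Sum>i\<in>UNIV. dx_wedge i (hodge (\<mu> x)) $ (- \<gamma>) * partial_deriv i \<phi> x)))"
      unfolding weak_deriv_def l r cancel ..
    also have "\<dots> \<longleftrightarrow> weak_deriv dx_wedge \<Xi> (\<lambda>x. hodge (\<mu> x)) \<eta>"
      unfolding weak_deriv_def
    proof (intro iffI allI impI)
      fix \<phi> and \<gamma> :: "'n set"
      assume "\<forall>\<phi> \<gamma>. test_function \<Xi> \<phi> \<longrightarrow> (LINT x|lebesgue_on \<Xi>. \<eta> x $ (- \<gamma>) * \<phi> x)
          = - (LINT x|lebesgue_on \<Xi>. (\<Sum>i\<in>UNIV. dx_wedge i (hodge (\<mu> x)) $ (- \<gamma>) * partial_deriv i \<phi> x))"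
        and "test_function \<Xi> \<phi>"
      from this(1)[rule_format, of \<phi> "- \<gamma>", OF this(2)]
      show "(LINT x|lebesgue_on \<Xi>. \<eta> x $ \<gamma> * \<phi> x)
          = - (LINT x|lebesgue_on \<Xi>. (\<Sum>i\<in>UNIV. dx_wedge i (hodge (\<mu> x)) $ \<gamma> * partial_deriv i \<phi> x))"
        by simp
    qed blast
    finally show ?thesis .
  qed
  have "has_codiff (Suc k) \<Xi> \<mu> \<nu> \<longleftrightarrow> (\<exists>\<eta>. \<nu> = (\<lambda>x. s *\<^sub>R hodge (\<eta> x)) \<and> \<nu> \<in> L2form k \<Xi> \<and> weak_deriv cod_symbol \<Xi> \<mu> \<nu>)"
    unfolding has_codiff_def has_extd_iff[OF h\<mu>] sub s_def[symmetric] using L2 weak by blast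
  moreover have "\<exists>\<eta>. \<nu> = (\<lambda>x. s *\<^sub>R hodge (\<eta> x))"
    by (rule exI[of _ "\<lambda>x. s *\<^sub>R hodge_inv (\<nu> x)"]) (simp add: linear_cmul[OF linear_hodge] s)
  ultimately show ?thesis by blast
qed

lemma weak_deriv_cong_AE:
  assumes "weak_deriv A \<Xi> \<omega>' \<eta>" "\<Xi> \<in> sets lebesgue" "\<And>i. linear (A i)"
    "sqint (lebesgue_on \<Xi>) \<omega>" "sqint (lebesgue_on \<Xi>) \<omega>'" "AE x in lebesgue_on \<Xi>. \<omega> x = \<omega>' x"
  shows "weak_deriv A \<Xi> \<omega> \<eta>"
  unfolding weak_deriv_def
proof (intro allI impI)
  fix \<phi> \<gamma> assume \<phi>: "test_function \<Xi> \<phi>"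
  have "(LINT x|lebesgue_on \<Xi>. (\<Sum>i\<in>UNIV. A i (\<omega> x) $ \<gamma> * partial_deriv i \<phi> x))
      = (LINT x|lebesgue_on \<Xi>. (\<Sum>i\<in>UNIV. A i (\<omega>' x) $ \<gamma> * partial_deriv i \<phi> x))"
    using integrable_symbol_test[OF assms(4,3) \<phi> assms(2), THEN borel_measurable_integrable]
      integrable_symbol_test[OF assms(5,3) \<phi> assms(2), THEN borel_measurable_integrable] assms(6)
    by (intro integral_cong_AE) (auto elim!: eventually_mono)
  then show "(LINT x|lebesgue_on \<Xi>. \<eta> x $ \<gamma> * \<phi> x)
      = - (LINT x|lebesgue_on \<Xi>. (\<Sum>i\<in>UNIV. A i (\<omega> x) $ \<gamma> * partial_deriv i \<phi> x))"
    using assms(1) \<phi> by (simp add: weak_deriv_def)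
qed

lemma extd_weak:
  assumes "\<omega> \<in> L2form k \<Xi>" "\<eta> \<in> L2form (Suc k) \<Xi>" "weak_deriv dx_wedge \<Xi> \<omega> \<eta>"
  shows "extd k \<Xi> \<omega> \<in> L2form (Suc k) \<Xi>" "weak_deriv dx_wedge \<Xi> \<omega> (extd k \<Xi> \<omega>)"
proof -
  have "has_extd k \<Xi> \<omega> (extd k \<Xi> \<omega>)"
    unfolding extd_def by (rule someI[of _ \<eta>]) (use assms has_extd_iff in blast)
  then show "extd k \<Xi> \<omega> \<in> L2form (Suc k) \<Xi>" "weak_deriv dx_wedge \<Xi> \<omega> (extd k \<Xi> \<omega>)"
    using assms(1) has_extd_iff by blast+
qed

lemma codiff_weak:
  fixes \<mu> :: "'n::{finite,linorder} dform"
  assumes "k < CARD('n)" "\<mu> \<in> L2form (Suc k) \<Xi>" "\<nu> \<in> L2form k \<Xi>" "weak_deriv cod_symbol \<Xi> \<mu> \<nu>"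
  shows "codiff (Suc k) \<Xi> \<mu> \<in> L2form k \<Xi>" "weak_deriv cod_symbol \<Xi> \<mu> (codiff (Suc k) \<Xi> \<mu>)"
proof -
  have "has_codiff (Suc k) \<Xi> \<mu> (codiff (Suc k) \<Xi> \<mu>)"
    unfolding codiff_def by (rule someI[of _ \<nu>]) (use assms has_codiff_iff in blast)
  then show "codiff (Suc k) \<Xi> \<mu> \<in> L2form k \<Xi>" "weak_deriv cod_symbol \<Xi> \<mu> (codiff (Suc k) \<Xi> \<mu>)"
    using assms(1,2) has_codiff_iff by blast+
qed

lemma extd_AE:
  assumes "open \<Xi>" "\<omega> \<in> L2form k \<Xi>" "\<eta> \<in> L2form (Suc k) \<Xi>" "weak_deriv dx_wedge \<Xi> \<omega> \<eta>"
  shows "AE x in lebesgue_on \<Xi>. extd k \<Xi> \<omega> x = \<eta> x"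
  by (intro weak_deriv_unique[OF assms(1) linear_dx_wedge extd_weak(2)[OF assms(2-4)] assms(4)]
      L2form_sqint[OF assms(2)] L2form_sqint[OF assms(3)] L2form_sqint[OF extd_weak(1)[OF assms(2-4)]] AE_I2 refl)

lemma codiff_AE:
  fixes \<mu> :: "'n::{finite,linorder} dform"
  assumes "open \<Xi>" "k < CARD('n)" "\<mu> \<in> L2form (Suc k) \<Xi>" "\<nu> \<in> L2form k \<Xi>" "weak_deriv cod_symbol \<Xi> \<mu> \<nu>"
  shows "AE x in lebesgue_on \<Xi>. codiff (Suc k) \<Xi> \<mu> x = \<nu> x"
  by (intro weak_deriv_unique[OF assms(1) linear_cod_symbol codiff_weak(2)[OF assms(2-5)] assms(5)]
      L2form_sqint[OF assms(3)] L2form_sqint[OF assms(4)] L2form_sqint[OF codiff_weak(1)[OF assms(2-5)]] AE_I2 refl)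

lemma HL_D:
  assumes "\<omega> \<in> HL k \<Xi>"
  shows "\<omega> \<in> L2form k \<Xi>" "extd k \<Xi> \<omega> \<in> L2form (Suc k) \<Xi>" "weak_deriv dx_wedge \<Xi> \<omega> (extd k \<Xi> \<omega>)"
  using assms extd_weak has_extd_iff unfolding HL_def by blast+

lemma HLstar_D:
  fixes \<mu> :: "'n::{finite,linorder} dform"
  assumes "\<mu> \<in> HLstar (Suc k) \<Xi>" "k < CARD('n)"
  shows "\<mu> \<in> L2form (Suc k) \<Xi>" "codiff (Suc k) \<Xi> \<mu> \<in> L2form k \<Xi>"
    "weak_deriv cod_symbol \<Xi> \<mu> (codiff (Suc k) \<Xi> \<mu>)"
  using assms codiff_weak has_codiff_iff unfolding HLstar_def by blast+

lemma integral_inner_cong_AE: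
  assumes "sqint M f" "sqint M g" "sqint M f'" "sqint M g'" "AE x in M. f x = f' x" "AE x in M. g x = g' x"
  shows "(LINT x|M. f x \<bullet> g x) = (LINT x|M. f' x \<bullet> g' x)"
proof (rule integral_cong_AE)
  show "AE x in M. f x \<bullet> g x = f' x \<bullet> g' x" using assms(5,6) by eventually_elim simp
qed (use assms in \<open>auto intro: borel_measurable_integrable[OF integrable_sqint_inner]\<close>)

text \<open>The pairing may be computed from any representatives of the two forms and of their derivatives.\<close>

lemma dpair_AE:
  fixes \<omega> \<omega>' \<mu> \<mu>' :: "'n::{finite,linorder} dform"
  assumes K: "open K" and k: "k < CARD('n)"
    and L2: "\<omega> \<in> L2form k K" "\<mu> \<in> L2form (Suc k) K" "\<eta> \<in> L2form (Suc k) K" "\<nu> \<in> L2form k K"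
    and sq: "sqint (lebesgue_on K) \<omega>'" "sqint (lebesgue_on K) \<mu>'"
    and AE: "AE x in lebesgue_on K. \<omega> x = \<omega>' x" "AE x in lebesgue_on K. \<mu> x = \<mu>' x"
    and w: "weak_deriv dx_wedge K \<omega>' \<eta>" "weak_deriv cod_symbol K \<mu>' \<nu>"
  shows "dpair k K \<omega> \<mu> = (LINT x|lebesgue_on K. \<eta> x \<bullet> \<mu>' x) - (LINT x|lebesgue_on K. \<omega>' x \<bullet> \<nu> x)"
proof -
  have Ks: "K \<in> sets lebesgue" using K by simp
  have w': "weak_deriv dx_wedge K \<omega> \<eta>" "weak_deriv cod_symbol K \<mu> \<nu>"
    by (rule weak_deriv_cong_AE[OF w(1) Ks linear_dx_wedge L2form_sqint[OF L2(1)] sq(1) AE(1)],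
      rule weak_deriv_cong_AE[OF w(2) Ks linear_cod_symbol L2form_sqint[OF L2(2)] sq(2) AE(2)])
  note e = extd_weak[OF L2(1,3) w'(1)] extd_AE[OF K L2(1,3) w'(1)]
  note c = codiff_weak[OF k L2(2,4) w'(2)] codiff_AE[OF K k L2(2,4) w'(2)]
  have "L2inner K (extd k K \<omega>) \<mu> = (LINT x|lebesgue_on K. \<eta> x \<bullet> \<mu>' x)"
    unfolding L2inner_def
    by (rule integral_inner_cong_AE[OF L2form_sqint[OF e(1)] L2form_sqint[OF L2(2)] L2form_sqint[OF L2(3)] sq(2) e(3) AE(2)])
  moreover have "L2inner K \<omega> (codiff (Suc k) K \<mu>) = (LINT x|lebesgue_on K. \<omega>' x \<bullet> \<nu> x)"
    unfolding L2inner_def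
    by (rule integral_inner_cong_AE[OF L2form_sqint[OF L2(1)] L2form_sqint[OF c(1)] sq(1) L2form_sqint[OF L2(4)] AE(1) c(3)])
  ultimately show ?thesis by (simp add: dpair_def)
qed

lemma L2form_compact_support:
  assumes "continuous_on UNIV \<psi>" "\<And>x. \<psi> x \<in> alt k" "compact C" "\<And>x. x \<notin> C \<Longrightarrow> \<psi> x = 0" "\<Xi> \<in> sets lebesgue"
  shows "\<psi> \<in> L2form k \<Xi>"
  using assms unfolding L2form_iff by (blast intro: sqint_compact_support)

lemma form_deriv_alt:
  assumes "\<And>x. \<omega> x \<in> alt k" shows "form_deriv i \<omega> x \<in> alt k"
  unfolding alt_def
proof (intro CollectI allI impI)
  fix \<alpha> :: "'a set" assume "card \<alpha> \<noteq> k"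
  then have "(\<lambda>y. \<omega> y $ \<alpha>) = (\<lambda>y. 0)" using assms altD by fastforce
  then show "form_deriv i \<omega> x $ \<alpha> = 0"
    by (simp add: form_deriv_def partial_deriv_eq[OF has_derivative_const])
qed

lemma diff_op_alt:
  assumes "\<And>x. \<omega> x \<in> alt k" "\<And>i v. v \<in> alt k \<Longrightarrow> A i v \<in> alt l"
  shows "diff_op A \<omega> x \<in> alt l"
  unfolding diff_op_def by (intro alt_sum assms(2) form_deriv_alt assms(1))

lemma cod_symbol_alt: "v \<in> alt (Suc k) \<Longrightarrow> cod_symbol i v \<in> alt k"
  using alt_scaleR[OF contract_alt, of v k "-1"] by simp

lemma test_form_L2:
  assumes \<psi>: "\<psi> \<in> test_form k \<Xi>" and \<Xi>: "\<Xi> \<in> sets lebesgue" and A: "\<And>i. linear (A i)" "\<And>i v. v \<in> alt k \<Longrightarrow> A i v \<in> alt l"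
  shows "\<psi> \<in> L2form k \<Xi>" "diff_op A \<psi> \<in> L2form l \<Xi>" "weak_deriv A \<Xi> \<psi> (diff_op A \<psi>)"
proof -
  have t: "\<And>\<alpha>. test_function \<Xi> (\<lambda>x. \<psi> x $ \<alpha>)" and alt: "\<And>x. \<psi> x \<in> alt k"
    using \<psi> by (auto simp: test_form_def)
  have C1: "C1_form \<psi>" using t by (rule C1_form_test)
  have "\<forall>\<alpha>. \<exists>C. compact C \<and> (\<forall>x. x \<notin> C \<longrightarrow> \<psi> x $ \<alpha> = 0)"
    using t unfolding test_function_def by blast
  then obtain C where C: "\<And>\<alpha>. compact (C \<alpha>)" "\<And>x \<alpha>. x \<notin> C \<alpha> \<Longrightarrow> \<psi> x $ \<alpha> = 0" by metis
  define D where "D = (\<Union>\<alpha>\<in>UNIV. C \<alpha>)"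
  have D: "compact D" unfolding D_def using C(1) by (intro compact_UN) auto
  have out: "\<psi> x $ \<alpha> = 0" if "x \<notin> D" for x \<alpha> using C(2) that unfolding D_def by blast
  have "form_deriv i \<psi> x = 0" if "x \<notin> D" for i x
    using partial_deriv_outside[OF compact_imp_closed[OF D] out that] by (simp add: form_deriv_def vec_eq_iff)
  then have outD: "diff_op A \<psi> x = 0" if "x \<notin> D" for x
    using that by (simp add: diff_op_def linear_0[OF A(1)])
  show "\<psi> \<in> L2form k \<Xi>"
    using out by (intro L2form_compact_support[OF C1_form_continuous[OF C1] alt D _ \<Xi>]) (simp add: vec_eq_iff)
  show "diff_op A \<psi> \<in> L2form l \<Xi>"
    using C1_form_continuous_diff_op[OF C1 A(1)] diff_op_alt[OF alt A(2)] D outD \<Xi>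
    by (rule L2form_compact_support)
  show "weak_deriv A \<Xi> \<psi> (diff_op A \<psi>)" by (rule weak_deriv_diff_op[OF C1 A(1) \<Xi>])
qed

lemma L2inner_nonneg: "L2inner \<Xi> f f \<ge> 0"
  unfolding L2inner_def by (intro Bochner_Integration.integral_nonneg) auto

lemma graph_norm_lessD:
  assumes "graph_norm D \<Xi> \<omega> < \<epsilon>"
  shows "sqrt (L2inner \<Xi> \<omega> \<omega>) < \<epsilon>" "sqrt (L2inner \<Xi> (D \<omega>) (D \<omega>)) < \<epsilon>"
  using assms L2inner_nonneg[of \<Xi> \<omega>] L2inner_nonneg[of \<Xi> "D \<omega>"]
  unfolding graph_norm_def by (auto elim!: order.strict_trans1[rotated])

lemma HLstar0_green:
  fixes \<omega> \<mu> :: "'n::{finite,linorder} dform"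
  assumes \<Omega>: "open \<Omega>" and k: "k < CARD('n)" and \<omega>: "\<omega> \<in> HL k \<Omega>" and \<mu>: "\<mu> \<in> HLstar0 (Suc k) \<Omega>"
  shows "(LINT x|lebesgue_on \<Omega>. extd k \<Omega> \<omega> x \<bullet> \<mu> x) = (LINT x|lebesgue_on \<Omega>. \<omega> x \<bullet> codiff (Suc k) \<Omega> \<mu> x)"
proof (rule weak_deriv_green[where A = dx_wedge and B = cod_symbol])
  have \<Omega>s: "\<Omega> \<in> sets lebesgue" using \<Omega> by simp
  note d = HL_D[OF \<omega>]
  have \<mu>': "\<mu> \<in> HLstar (Suc k) \<Omega>" using \<mu> by (simp add: HLstar0_def)
  note c = HLstar_D[OF \<mu>' k]
  show "sqint (lebesgue_on \<Omega>) \<omega>" "sqint (lebesgue_on \<Omega>) (extd k \<Omega> \<omega>)"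
    "sqint (lebesgue_on \<Omega>) \<mu>" "sqint (lebesgue_on \<Omega>) (codiff (Suc k) \<Omega> \<mu>)"
    "weak_deriv dx_wedge \<Omega> \<omega> (extd k \<Omega> \<omega>)"
    using c d by (auto simp: L2form_iff)
  fix \<epsilon> :: real assume "\<epsilon> > 0"
  then obtain \<psi> where \<psi>: "\<psi> \<in> test_form (Suc k) \<Omega>"
    and n: "graph_norm (codiff (Suc k) \<Omega>) \<Omega> (\<lambda>x. \<mu> x - \<psi> x) < \<epsilon>"
    using \<mu> by (auto simp: HLstar0_def)
  note t = test_form_L2[where A = cod_symbol and l = k, OF \<psi> \<Omega>s linear_cod_symbol cod_symbol_alt]
  note D = L2form_diff[OF c(1) t(1)] L2form_diff[OF c(2) t(2)]
    weak_deriv_diff[where A = cod_symbol, OF \<Omega>s linear_cod_symbol c(3) t(3) c(1)[THEN L2form_sqint] t(1)[THEN L2form_sqint] c(2)[THEN L2form_sqint] t(2)[THEN L2form_sqint]]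
  \<comment> \<open>The graph norm uses the representative chosen for the codifferential of the difference; it
    agrees almost everywhere with the difference of the codifferentials.\<close>
  have "L2inner \<Omega> (\<lambda>x. codiff (Suc k) \<Omega> \<mu> x - diff_op cod_symbol \<psi> x) (\<lambda>x. codiff (Suc k) \<Omega> \<mu> x - diff_op cod_symbol \<psi> x)
      = L2inner \<Omega> (codiff (Suc k) \<Omega> (\<lambda>x. \<mu> x - \<psi> x)) (codiff (Suc k) \<Omega> (\<lambda>x. \<mu> x - \<psi> x))"
    unfolding L2inner_def
    using codiff_AE[OF \<Omega> k D] codiff_weak(1)[OF k D, THEN L2form_sqint] D(2)[THEN L2form_sqint]
    by (intro integral_inner_cong_AE) (auto elim!: eventually_mono)
  then show "\<exists>\<psi>. (\<forall>\<alpha>. test_function \<Omega> (\<lambda>x. \<psi> x $ \<alpha>)) \<and>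
      sqrt (L2inner \<Omega> (\<lambda>x. \<mu> x - \<psi> x) (\<lambda>x. \<mu> x - \<psi> x)) < \<epsilon> \<and>
      sqrt (L2inner \<Omega> (\<lambda>x. codiff (Suc k) \<Omega> \<mu> x - diff_op cod_symbol \<psi> x) (\<lambda>x. codiff (Suc k) \<Omega> \<mu> x - diff_op cod_symbol \<psi> x)) < \<epsilon>"
    using graph_norm_lessD[OF n] \<psi> by (intro exI[of _ \<psi>]) (auto simp: test_form_def)
qed (use \<Omega> in \<open>auto simp: linear_dx_wedge linear_cod_symbol dx_wedge_inner\<close>)

lemma HL0_green:
  fixes \<omega> \<mu> :: "'n::{finite,linorder} dform"
  assumes \<Omega>: "open \<Omega>" and k: "k < CARD('n)" and \<omega>: "\<omega> \<in> HL0 k \<Omega>" and \<mu>: "\<mu> \<in> HLstar (Suc k) \<Omega>"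
  shows "(LINT x|lebesgue_on \<Omega>. extd k \<Omega> \<omega> x \<bullet> \<mu> x) = (LINT x|lebesgue_on \<Omega>. \<omega> x \<bullet> codiff (Suc k) \<Omega> \<mu> x)"
proof -
  have "(LINT x|lebesgue_on \<Omega>. codiff (Suc k) \<Omega> \<mu> x \<bullet> \<omega> x) = (LINT x|lebesgue_on \<Omega>. \<mu> x \<bullet> extd k \<Omega> \<omega> x)"
  proof (rule weak_deriv_green[where A = cod_symbol and B = dx_wedge])
    have \<Omega>s: "\<Omega> \<in> sets lebesgue" using \<Omega> by simp
    have \<omega>': "\<omega> \<in> HL k \<Omega>" using \<omega> by (simp add: HL0_def)
    note d = HL_D[OF \<omega>']
    note c = HLstar_D[OF \<mu> k]
    show "sqint (lebesgue_on \<Omega>) \<omega>" "sqint (lebesgue_on \<Omega>) (extd k \<Omega> \<omega>)"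
      "sqint (lebesgue_on \<Omega>) \<mu>" "sqint (lebesgue_on \<Omega>) (codiff (Suc k) \<Omega> \<mu>)"
      "weak_deriv cod_symbol \<Omega> \<mu> (codiff (Suc k) \<Omega> \<mu>)"
      using c d by (auto simp: L2form_iff)
    fix \<epsilon> :: real assume "\<epsilon> > 0"
    then obtain \<psi> where \<psi>: "\<psi> \<in> test_form k \<Omega>"
      and n: "graph_norm (extd k \<Omega>) \<Omega> (\<lambda>x. \<omega> x - \<psi> x) < \<epsilon>"
      using \<omega> by (auto simp: HL0_def)
    note t = test_form_L2[where A = dx_wedge and l = "Suc k", OF \<psi> \<Omega>s linear_dx_wedge dx_wedge_alt]
    note D = L2form_diff[OF d(1) t(1)] L2form_diff[OF d(2) t(2)]
    weak_deriv_diff[where A = dx_wedge, OF \<Omega>s linear_dx_wedge d(3) t(3) d(1)[THEN L2form_sqint] t(1)[THEN L2form_sqint] d(2)[THEN L2form_sqint] t(2)[THEN L2form_sqint]]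
    have "L2inner \<Omega> (\<lambda>x. extd k \<Omega> \<omega> x - diff_op dx_wedge \<psi> x) (\<lambda>x. extd k \<Omega> \<omega> x - diff_op dx_wedge \<psi> x)
        = L2inner \<Omega> (extd k \<Omega> (\<lambda>x. \<omega> x - \<psi> x)) (extd k \<Omega> (\<lambda>x. \<omega> x - \<psi> x))"
      unfolding L2inner_def
      using extd_AE[OF \<Omega> D] extd_weak(1)[OF D, THEN L2form_sqint] D(2)[THEN L2form_sqint]
      by (intro integral_inner_cong_AE) (auto elim!: eventually_mono)
    then show "\<exists>\<psi>. (\<forall>\<alpha>. test_function \<Omega> (\<lambda>x. \<psi> x $ \<alpha>)) \<and>
        sqrt (L2inner \<Omega> (\<lambda>x. \<omega> x - \<psi> x) (\<lambda>x. \<omega> x - \<psi> x)) < \<epsilon> \<and>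
        sqrt (L2inner \<Omega> (\<lambda>x. extd k \<Omega> \<omega> x - diff_op dx_wedge \<psi> x) (\<lambda>x. extd k \<Omega> \<omega> x - diff_op dx_wedge \<psi> x)) < \<epsilon>"
      using graph_norm_lessD[OF n] \<psi> by (intro exI[of _ \<psi>]) (auto simp: test_form_def)
  qed (use \<Omega> cod_symbol_inner in \<open>auto intro: linear_dx_wedge linear_cod_symbol\<close>)
  then show ?thesis by (simp add: inner_commute)
qed

text \<open>The boundaries of the cells are null sets.\<close>

lemma sum_integral_cells:
  fixes F :: "'n::finite point \<Rightarrow> real"
  assumes mesh: "cubical_mesh \<Omega> \<G>" and \<Omega>: "open \<Omega>" and F: "integrable (lebesgue_on \<Omega>) F"
  shows "(\<Sum>K\<in>\<G>. LINT x|lebesgue_on (interior K). F x) = (LINT x|lebesgue_on \<Omega>. F x)"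
proof -
  have div: "\<G> division_of closure \<Omega>" and sub: "\<And>K. K \<in> \<G> \<Longrightarrow> interior K \<subseteq> \<Omega>"
    using mesh by (auto simp: cubical_mesh_def)
  have fin: "finite \<G>" using div by blast
  have s: "interior K \<in> sets lebesgue" for K :: "'n point set" by simp
  have \<Omega>s: "\<Omega> \<in> sets lebesgue" using \<Omega> by simp
  have int: "integrable lebesgue (\<lambda>x. if x \<in> interior K then F x else 0)" if "K \<in> \<G>" for K
    using integrable_lebesgue_on_subset[OF F sub[OF that] \<Omega>s s] Lebesgue_Measure.integrable_restrict_UNIV[OF s] by blast
  have "(\<Sum>K\<in>\<G>. LINT x|lebesgue_on (interior K). F x) = (\<Sum>K\<in>\<G>. LINT x|lebesgue. (if x \<in> interior K then F x else 0))"
    by (simp add: Lebesgue_Measure.integral_restrict_UNIV)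
  also have "\<dots> = (LINT x|lebesgue. (\<Sum>K\<in>\<G>. if x \<in> interior K then F x else 0))"
    using int by (simp add: Bochner_Integration.integral_sum)
  also have "\<dots> = (LINT x|lebesgue. (if x \<in> \<Omega> then F x else 0))"
  proof (rule integral_cong_AE)
    have "AE x in lebesgue. x \<notin> K - interior K" if "K \<in> \<G>" for K
    proof -
      obtain a b where "K = cbox a b" using division_ofD(4)[OF div \<open>K \<in> \<G>\<close>] by blast
      then show ?thesis
        using negligible_frontier_interval[of a b] by (intro AE_not_in) (auto simp: negligible_iff_null_sets interior_cbox)
    qed
    then have "AE x in lebesgue. \<forall>K\<in>\<G>. x \<notin> K - interior K"
      using fin by (simp add: AE_finite_allI)
    then show "AE x in lebesgue. (\<Sum>K\<in>\<G>. if x \<in> interior K then F x else 0) = (if x \<in> \<Omega> then F x else 0)"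
    proof eventually_elim
      case (elim x)
      show ?case
      proof (cases "x \<in> \<Omega>")
        case True
        then have "x \<in> \<Union>\<G>" using closure_subset division_ofD(6)[OF div] by blast
        then obtain K where K: "K \<in> \<G>" "x \<in> interior K" using elim by blast
        have "x \<notin> interior L" if "L \<in> \<G> - {K}" for L
          using division_ofD(5)[OF div K(1), of L] that K by blast
        then have "(\<Sum>K\<in>\<G>. if x \<in> interior K then F x else 0) = F x"
          using K fin by (simp add: sum.remove)
        then show ?thesis using True by simp
      next
        case False
        then have "x \<notin> interior K" if "K \<in> \<G>" for K using sub[OF that] by blast
        then show ?thesis using False by (auto intro!: sum.neutral)
      qed
    qed
    show "(\<lambda>x. if x \<in> \<Omega> then F x else 0) \<in> borel_measurable lebesgue"
      using F Lebesgue_Measure.integrable_restrict_UNIV[OF \<Omega>s, of F] by blast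
  qed (use int in \<open>auto intro!: borel_measurable_sum\<close>)
  also have "\<dots> = (LINT x|lebesgue_on \<Omega>. F x)" by (rule Lebesgue_Measure.integral_restrict_UNIV[OF \<Omega>s])
  finally show ?thesis .
qed

text \<open>The weak derivatives on \<open>\<Omega>\<close> restrict to weak derivatives on each cell, so the pairings of the cells
  add up to the pairing on \<open>\<Omega>\<close>.\<close>

lemma sum_dpair_cells:
  fixes \<omega> \<mu> :: "'n::{finite,linorder} dform"
  assumes mesh: "cubical_mesh \<Omega> \<G>" and \<Omega>: "open \<Omega>" and k: "k < CARD('n)"
    and \<omega>: "\<omega> \<in> HL k \<Omega>" and \<mu>: "\<mu> \<in> HLstar (Suc k) \<Omega>"
  shows "(\<Sum>K\<in>\<G>. dpair k (interior K) \<omega> \<mu>)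
    = (LINT x|lebesgue_on \<Omega>. extd k \<Omega> \<omega> x \<bullet> \<mu> x) - (LINT x|lebesgue_on \<Omega>. \<omega> x \<bullet> codiff (Suc k) \<Omega> \<mu> x)"
proof -
  note d = HL_D[OF \<omega>] and c = HLstar_D[OF \<mu> k]
  have \<Omega>s: "\<Omega> \<in> sets lebesgue" using \<Omega> by simp
  have cell: "dpair k (interior K) \<omega> \<mu> = (LINT x|lebesgue_on (interior K). extd k \<Omega> \<omega> x \<bullet> \<mu> x)
      - (LINT x|lebesgue_on (interior K). \<omega> x \<bullet> codiff (Suc k) \<Omega> \<mu> x)" if "K \<in> \<G>" for K
  proof -
    have sub: "interior K \<subseteq> \<Omega>" using mesh that by (auto simp: cubical_mesh_def)
    have s: "interior K \<in> sets lebesgue" by simp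
    note r = L2form_restrict[OF d(1) sub s \<Omega>s] L2form_restrict[OF c(1) sub s \<Omega>s]
      L2form_restrict[OF d(2) sub s \<Omega>s] L2form_restrict[OF c(2) sub s \<Omega>s]
    show ?thesis
      by (rule dpair_AE[OF open_interior k r])
        (use r in \<open>auto simp: L2form_iff intro: weak_deriv_restrict[OF d(3) sub s \<Omega>s] weak_deriv_restrict[OF c(3) sub s \<Omega>s]\<close>)
  qed
  have "integrable (lebesgue_on \<Omega>) (\<lambda>x. extd k \<Omega> \<omega> x \<bullet> \<mu> x)"
    "integrable (lebesgue_on \<Omega>) (\<lambda>x. \<omega> x \<bullet> codiff (Suc k) \<Omega> \<mu> x)"
    using c d by (auto simp: L2form_iff intro: integrable_sqint_inner)
  then show ?thesis
    by (simp add: cell sum_subtractf sum_integral_cells[OF mesh \<Omega>])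
qed

section \<open>Midpoint quadrature for multi-affine forms\<close>

text \<open>Polynomials of degree at most one in each of the coordinates in \<open>A\<close>, independent of the
  other coordinates.\<close>

inductive multi_affine :: "'n::finite set \<Rightarrow> ('n point \<Rightarrow> real) \<Rightarrow> bool" where
  const: "multi_affine A (\<lambda>x. c)"
| add: "multi_affine A f \<Longrightarrow> multi_affine A g \<Longrightarrow> multi_affine A (\<lambda>x. f x + g x)"
| coord: "multi_affine (A - {i}) f \<Longrightarrow> i \<in> A \<Longrightarrow> multi_affine A (\<lambda>x. x $ i * f x)"

lemma multi_affine_mono: "multi_affine A f \<Longrightarrow> A \<subseteq> B \<Longrightarrow> multi_affine B f"
proof (induction arbitrary: B rule: multi_affine.induct)
  case (coord A i f)
  then have "A - {i} \<subseteq> B - {i}" "i \<in> B" by auto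
  then show ?case using coord.IH by (intro multi_affine.coord)
qed (auto intro: multi_affine.intros)

lemma multi_affine_cont_diff: "multi_affine A f \<Longrightarrow> cont_diff m f"
  by (induction rule: multi_affine.induct)
    (auto intro: cont_diff_const cont_diff_add cont_diff_mult cont_diff_coord)

lemma multi_affine_depends: "multi_affine A f \<Longrightarrow> (\<And>i. i \<in> A \<Longrightarrow> x $ i = y $ i) \<Longrightarrow> f x = f y"
proof (induction rule: multi_affine.induct)
  case (coord A i f)
  have "f x = f y" by (rule coord.IH) (use coord.prems in blast)
  moreover have "x $ i = y $ i" using coord.hyps coord.prems by blast
  ultimately show ?case by simp
qed auto

lemma multi_affine_cmult: "multi_affine A f \<Longrightarrow> multi_affine A (\<lambda>x. c * f x)"
proof (induction rule: multi_affine.induct)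
  case (add A f g)
  then show ?case using multi_affine.add[OF add.IH] by (simp add: algebra_simps)
next
  case (coord A i f)
  then show ?case using multi_affine.coord[OF coord.IH coord.hyps(2)] by (simp add: algebra_simps)
qed (rule multi_affine.const)

lemma multi_affine_sum:
  "(\<And>j. j \<in> J \<Longrightarrow> multi_affine A (f j)) \<Longrightarrow> multi_affine A (\<lambda>x. \<Sum>j\<in>J. f j x)"
  by (induction J rule: infinite_finite_induct) (auto intro: multi_affine.intros)

lemma multi_affine_mult:
  "multi_affine A f \<Longrightarrow> multi_affine B g \<Longrightarrow> A \<inter> B = {} \<Longrightarrow> multi_affine (A \<union> B) (\<lambda>x. f x * g x)"
proof (induction rule: multi_affine.induct)
  case (const A c)
  then show ?case by (intro multi_affine_cmult) (auto intro: multi_affine_mono)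
next
  case (add A f g')
  then show ?case using multi_affine.add[of "A \<union> B" "\<lambda>x. f x * g x" "\<lambda>x. g' x * g x"]
    by (simp add: distrib_right)
next
  case (coord A i f)
  have "(A - {i}) \<union> B = (A \<union> B) - {i}" using coord.hyps coord.prems by auto
  moreover have "multi_affine ((A - {i}) \<union> B) (\<lambda>x. f x * g x)" using coord by blast
  ultimately show ?case using multi_affine.coord[of "A \<union> B" i "\<lambda>x. f x * g x"] coord.hyps
    by (simp add: mult.assoc)
qed

lemma partial_deriv_coord: "partial_deriv i (\<lambda>x. x $ j) x = (if i = j then 1 else 0)"
proof -
  have "((\<lambda>x. x $ j) has_derivative (\<lambda>h. h $ j)) (at x)"
    by (rule bounded_linear_imp_has_derivative) (rule bounded_linear_vec_nth)
  then show ?thesis by (simp add: partial_deriv_eq[of _ "\<lambda>h. h $ j"] axis_def)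
qed

lemma multi_affine_differentiable: "multi_affine A f \<Longrightarrow> f differentiable (at x)"
  using multi_affine_cont_diff[of A f 1] by simp

lemma partial_deriv_coord_mult:
  assumes "f differentiable (at x)"
  shows "partial_deriv i (\<lambda>x. x $ j * f x) x = (if i = j then f x else 0) + x $ j * partial_deriv i f x"
proof -
  have "(\<lambda>x. x $ j) differentiable (at x)"
    using cont_diff_coord[of 1 j] by simp
  from partial_deriv_mult[OF this assms] show ?thesis by (simp add: partial_deriv_coord)
qed

lemma multi_affine_partial_deriv_0:
  "multi_affine A f \<Longrightarrow> i \<notin> A \<Longrightarrow> partial_deriv i f = (\<lambda>x. 0)"
proof (induction rule: multi_affine.induct)
  case (const A c)
  show ?case by (rule ext, subst partial_deriv_eq[OF has_derivative_const]) simp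
next
  case (add A f g)
  then show ?case using multi_affine_differentiable by (intro ext) (subst partial_deriv_add; auto)
next
  case (coord A j f)
  then show ?case
    using multi_affine_differentiable[OF coord.hyps(1)] by (intro ext) (auto simp: partial_deriv_coord_mult)
qed

lemma multi_affine_partial_deriv:
  "multi_affine A f \<Longrightarrow> multi_affine (A - {i}) (partial_deriv i f)"
proof (induction rule: multi_affine.induct)
  case (const A c)
  have "partial_deriv i (\<lambda>x. c) = (\<lambda>x. 0)"
    by (rule multi_affine_partial_deriv_0[OF multi_affine.const[of "{}"]]) simp
  then show ?case by (simp add: multi_affine.const)
next
  case (add A f g)
  have "partial_deriv i (\<lambda>x. f x + g x) = (\<lambda>x. partial_deriv i f x + partial_deriv i g x)"
    using add.hyps multi_affine_differentiable by (intro ext partial_deriv_add) auto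
  then show ?case using add by (simp add: multi_affine.add)
next
  case (coord A j f)
  have d: "partial_deriv i (\<lambda>x. x $ j * f x) = (\<lambda>x. (if i = j then f x else 0) + x $ j * partial_deriv i f x)"
    using multi_affine_differentiable[OF coord.hyps(1)] by (intro ext partial_deriv_coord_mult)
  show ?case
  proof (cases "i = j")
    case True
    then have "partial_deriv i f = (\<lambda>x. 0)" using multi_affine_partial_deriv_0[OF coord.hyps(1)] by simp
    then show ?thesis using coord.hyps True d by simp
  next
    case False
    then have "A - {j} - {i} = A - {i} - {j}" "j \<in> A - {i}" using coord.hyps by auto
    then show ?thesis using coord.IH False d multi_affine.coord[of "A - {i}" j] by simp
  qed
qed

lemma poly_degree_le_1: "degree p \<le> 1 \<Longrightarrow> poly p t = coeff p 0 + coeff p 1 * (t::real)"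
proof -
  assume "degree p \<le> 1"
  then have "(\<Sum>i\<le>degree p. coeff p i * t ^ i) = (\<Sum>i\<le>1. coeff p i * t ^ i)"
    by (intro sum.mono_neutral_left) (auto simp: coeff_eq_0)
  then show ?thesis by (simp add: poly_altdef)
qed

lemma tensor_poly_multi_affine:
  assumes f: "f \<in> tensor_poly r" and r: "\<And>i. r i \<le> (if i \<in> A then 1 else 0)"
  shows "multi_affine A f"
proof -
  have prod: "multi_affine (I \<inter> A) (\<lambda>x. \<Prod>i\<in>I. poly (p i) (x $ i))"
    if p: "\<And>i. degree (p i) \<le> r i" for p :: "'a \<Rightarrow> real poly" and I
  proof (induction I rule: infinite_finite_induct)
    case (insert i I)
    have deg: "degree (p i) \<le> (if i \<in> A then 1 else 0)" using p r order_trans by blast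
    have eq: "poly (p i) t = coeff (p i) 0 + coeff (p i) 1 * t" for t
      using deg by (intro poly_degree_le_1) (auto split: if_splits)
    let ?P = "\<lambda>x. \<Prod>i\<in>I. poly (p i) (x $ i)"
    have P: "multi_affine (insert i I \<inter> A) ?P" using insert.IH by (rule multi_affine_mono) auto
    show ?case
    proof (cases "i \<in> A")
      case True
      have "insert i I \<inter> A - {i} = I \<inter> A" using insert.hyps by auto
      then have "multi_affine (insert i I \<inter> A) (\<lambda>x. x $ i * (coeff (p i) 1 * ?P x))"
        using insert.IH True by (intro multi_affine.coord multi_affine_cmult) auto
      from multi_affine.add[OF multi_affine_cmult[OF P, of "coeff (p i) 0"] this]
      show ?thesis using insert.hyps by (simp add: eq algebra_simps)
    next
      case False
      then have "coeff (p i) 1 = 0" using deg by (intro coeff_eq_0) auto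
      then show ?thesis using insert.hyps multi_affine_cmult[OF P] by (simp add: eq)
    qed
  qed (auto intro: multi_affine.const)
  obtain m p where "f = (\<lambda>x. \<Sum>j<m. \<Prod>i\<in>UNIV. poly (p j i) (x $ i))"
    and "\<forall>j<(m::nat). \<forall>i. degree (p j i) \<le> r i"
    using f unfolding tensor_poly_def by auto
  then show ?thesis using prod[of "p _" UNIV] by (auto intro!: multi_affine_sum)
qed

text \<open>Reflection in the hyperplane \<open>x\<^sub>i = s/2\<close> preserves Lebesgue measure.\<close>

lemma lborel_reflect_coord:
  fixes s :: real and i :: "'n::finite"
  defines "R \<equiv> \<lambda>x::'n point. x + (s - 2 * x $ i) *\<^sub>R axis i 1"
  shows "distr lborel borel R = lborel"
proof -
  define c where "c j = (if j = axis i 1 then - 1 else (1::real))" for j :: "'n point"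
  have "s *\<^sub>R axis i 1 + (\<Sum>j\<in>Basis. (c j * (x \<bullet> j)) *\<^sub>R j) = R x" for x
  proof -
    have "(\<Sum>j\<in>Basis. (c j * (x \<bullet> j)) *\<^sub>R j)
        = (\<Sum>j\<in>Basis. (x \<bullet> j) *\<^sub>R j - (if j = axis i 1 then (2 * (x \<bullet> axis i 1)) *\<^sub>R axis i 1 else 0))"
      by (intro sum.cong) (auto simp: c_def scaleR_left_diff_distrib[symmetric])
    also have "\<dots> = x - (2 * x $ i) *\<^sub>R axis i 1"
      by (simp add: sum_subtractf euclidean_representation axis_in_Basis_iff inner_axis)
    finally show ?thesis by (simp add: R_def algebra_simps)
  qed
  moreover have "lborel = density (distr lborel borel (\<lambda>x. s *\<^sub>R axis i 1 + (\<Sum>j\<in>Basis. (c j * (x \<bullet> j)) *\<^sub>R j)))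
      (\<lambda>_. \<Prod>j\<in>Basis. \<bar>c j\<bar>)"
    by (rule lborel_affine_euclidean) (simp add: c_def)
  moreover have "(\<Prod>j\<in>Basis. \<bar>c j\<bar>) = 1" by (rule prod.neutral) (simp add: c_def)
  ultimately show ?thesis by (simp add: density_1)
qed

lemma integral_box_lborel:
  fixes f :: "'a::euclidean_space \<Rightarrow> real"
  assumes "continuous_on UNIV f"
  shows "(LINT x|lebesgue_on (box a b). f x) = (LINT x|lborel. indicator (box a b) x * f x)"
proof -
  have [measurable]: "f \<in> borel_measurable borel" using assms by (rule borel_measurable_continuous_onI)
  have "(LINT x|lebesgue_on (box a b). f x) = (LINT x|lebesgue. indicator (box a b) x *\<^sub>R f x)"
    by (rule integral_restrict_space) simp
  also have "\<dots> = (LINT x|lborel. indicator (box a b) x * f x)"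
    by (simp add: integral_completion)
  finally show ?thesis .
qed

lemma integrable_box:
  fixes f :: "'a::euclidean_space \<Rightarrow> real"
  assumes "continuous_on UNIV f"
  shows "integrable (lebesgue_on (box a b)) f"
  using assms by (intro integrable_sqint sqint_bounded_domain finite_measure_lebesgue_on) auto

text \<open>The midpoint rule is exact: write \<open>x\<^sub>i f = (x\<^sub>i - m) f + m f\<close> with \<open>m\<close> the \<open>i\<close>-th coordinate of the midpoint.
  The first term is odd under the reflection of the box in the \<open>i\<close>-th coordinate because \<open>f\<close> does not depend
  on \<open>x\<^sub>i\<close>.\<close>

lemma integral_multi_affine:
  fixes a b :: "'n::finite point"
  assumes "multi_affine A f"
  shows "(LINT x|lebesgue_on (box a b). f x) = measure lebesgue (box a b) * f ((1/2) *\<^sub>R (a + b))"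
  using assms
proof (induction rule: multi_affine.induct)
  case (const A c)
  show ?case by (simp add: measure_restrict_space)
next
  case (add A f g)
  have "integrable (lebesgue_on (box a b)) f" "integrable (lebesgue_on (box a b)) g"
    using add.hyps multi_affine_cont_diff[of A _ 0] by (auto intro: integrable_box)
  then show ?case using add.IH by (simp add: algebra_simps)
next
  case (coord A i f)
  define m where "m = (a $ i + b $ i) / 2"
  define R where "R x = x + ((a $ i + b $ i) - 2 * x $ i) *\<^sub>R axis i 1" for x :: "'n point"
  have R_nth: "R x $ j = (if j = i then a $ i + b $ i - x $ i else x $ j)" for x j
    by (auto simp: R_def axis_def)
  have fR: "f (R x) = f x" for x
    by (rule multi_affine_depends[OF coord.hyps(1)]) (auto simp: R_nth)
  have boxR: "indicator (box a b) (R x) = (indicator (box a b) x :: real)" for x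
    by (auto simp: indicator_def mem_box_cart R_nth)
  have cf: "continuous_on UNIV f" using multi_affine_cont_diff[OF coord.hyps(1), of 0] by simp
  let ?g = "\<lambda>x. (x $ i - m) * f x"
  have cg: "continuous_on UNIV ?g" by (intro continuous_intros cf)
  have [measurable]: "f \<in> borel_measurable borel" using cf by (rule borel_measurable_continuous_onI)
  have Rm: "R \<in> borel_measurable borel"
    unfolding R_def by (intro borel_measurable_continuous_onI continuous_intros)
  have gm: "(\<lambda>x. indicator (box a b) x * ?g x) \<in> borel_measurable borel"
    using borel_measurable_continuous_onI[OF cg] by (intro borel_measurable_times borel_measurable_indicator) auto
  have "(LINT x|lborel. indicator (box a b) x * ?g x) = (LINT x|distr lborel borel R. indicator (box a b) x * ?g x)"
    using lborel_reflect_coord[of "a $ i + b $ i" i] by (simp add: R_def[abs_def])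
  also have "\<dots> = (LINT x|lborel. indicator (box a b) (R x) * ?g (R x))"
    using Rm gm by (intro integral_distr) auto
  also have "\<dots> = (LINT x|lborel. - (indicator (box a b) x * ?g x))"
    by (intro Bochner_Integration.integral_cong refl) (simp add: boxR fR R_nth m_def field_simps)
  finally have "(LINT x|lborel. indicator (box a b) x * ?g x) = 0" by simp
  then have "(LINT x|lebesgue_on (box a b). ?g x) = 0" by (simp add: integral_box_lborel[OF cg])
  moreover have "(LINT x|lebesgue_on (box a b). x $ i * f x)
      = (LINT x|lebesgue_on (box a b). ?g x + m * f x)"
    by (intro Bochner_Integration.integral_cong refl) (simp add: algebra_simps)
  moreover have "\<dots> = (LINT x|lebesgue_on (box a b). ?g x) + m * (LINT x|lebesgue_on (box a b). f x)"
    using integrable_box[OF cg] integrable_box[OF cf] by simp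
  ultimately show ?case using coord.IH by (simp add: m_def)
qed

text \<open>The properties of forms in \<open>Q1minus k\<close> and \<open>Q1minus_star k\<close> that matter, besides the degree: the
  coefficients are multi-affine, and depend only on the coordinates outside the multi-index in the first case and
  only on those in the multi-index in the second case.\<close>

definition Q_form :: "nat \<Rightarrow> 'n::{finite,linorder} dform \<Rightarrow> bool" where
  "Q_form k \<omega> \<longleftrightarrow> (\<forall>x. \<omega> x \<in> alt k) \<and> (\<forall>\<alpha>. multi_affine (- \<alpha>) (\<lambda>x. \<omega> x $ \<alpha>))"

definition Qstar_form :: "nat \<Rightarrow> 'n::{finite,linorder} dform \<Rightarrow> bool" where
  "Qstar_form k \<mu> \<longleftrightarrow> (\<forall>x. \<mu> x \<in> alt k) \<and> (\<forall>\<beta>. multi_affine \<beta> (\<lambda>x. \<mu> x $ \<beta>))"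

lemma Q_form_C1: "Q_form k \<omega> \<Longrightarrow> C1_form \<omega>" and Qstar_form_C1: "Qstar_form k \<mu> \<Longrightarrow> C1_form \<mu>"
  unfolding Q_form_def Qstar_form_def C1_form_def using multi_affine_cont_diff by blast+

lemma Q1minus_Q_form:
  fixes \<omega> :: "'n::{finite,linorder} dform"
  shows "\<omega> \<in> Q1minus k \<Longrightarrow> Q_form k \<omega>"
  unfolding Q_form_def
proof (intro conjI allI)
  fix \<alpha> :: "'n set" assume \<omega>: "\<omega> \<in> Q1minus k"
  show "multi_affine (- \<alpha>) (\<lambda>x. \<omega> x $ \<alpha>)"
  proof (cases "card \<alpha> = k")
    case True
    then show ?thesis using \<omega> by (intro tensor_poly_multi_affine) (auto simp: Q1minus_def)
  next
    case False
    then have "(\<lambda>x. \<omega> x $ \<alpha>) = (\<lambda>x. 0)" using \<omega> altD[of "\<omega> _" k \<alpha>] by (auto simp: Q1minus_def)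
    then show ?thesis by (simp add: multi_affine.const)
  qed
qed (simp add: Q1minus_def)

lemma hodge_Q_form:
  fixes \<omega> :: "'n::{finite,linorder} dform"
  assumes "Q_form (CARD('n) - k) \<omega>" "k \<le> CARD('n)"
  shows "Qstar_form k (\<lambda>x. hodge (\<omega> x))"
  unfolding Qstar_form_def
proof (intro conjI allI)
  show "hodge (\<omega> x) \<in> alt k" for x
    using hodge_alt[of "\<omega> x" "CARD('n) - k"] assms by (simp add: Q_form_def)
  fix \<beta> :: "'n set"
  have "multi_affine (- (- \<beta>)) (\<lambda>x. \<omega> x $ (- \<beta>))" using assms unfolding Q_form_def by blast
  then show "multi_affine \<beta> (\<lambda>x. hodge (\<omega> x) $ \<beta>)"
    using multi_affine_cmult[of \<beta> "\<lambda>x. \<omega> x $ (- \<beta>)" "shuffle_sign (- \<beta>) \<beta>"]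
    by (simp add: hodge_nth mult.commute)
qed

lemma P1minus_Q_form: "\<omega> \<in> P1minus k \<Longrightarrow> Q_form k \<omega>"
  unfolding Q_form_def
proof (intro conjI allI)
  assume "\<omega> \<in> P1minus k"
  then obtain v w where \<omega>: "\<omega> = (\<lambda>x. v + koszul x w)" and v: "v \<in> alt k" and w: "w \<in> alt (Suc k)"
    by (auto simp: P1minus_def P0_def)
  show "\<omega> x \<in> alt k" for x unfolding \<omega> by (intro alt_add v koszul_alt w)
  have "multi_affine (- \<alpha>) (\<lambda>x. v $ \<alpha> + (\<Sum>i\<in>UNIV. x $ i * contract i w $ \<alpha>))" for \<alpha>
  proof (intro multi_affine.add multi_affine.const multi_affine_sum)
    fix i
    show "multi_affine (- \<alpha>) (\<lambda>x. x $ i * contract i w $ \<alpha>)"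
      by (cases "i \<in> \<alpha>") (auto simp: contract_nth intro: multi_affine.coord multi_affine.const)
  qed
  then show "multi_affine (- \<alpha>) (\<lambda>x. \<omega> x $ \<alpha>)" for \<alpha> by (simp add: \<omega> koszul_eq_contract)
qed

lemma star_forms:
  fixes \<mu> :: "'n::{finite,linorder} dform"
  assumes "k \<le> CARD('n)"
  shows "\<mu> \<in> Q1minus_star k \<Longrightarrow> Qstar_form k \<mu>" "\<mu> \<in> P1minus_star k \<Longrightarrow> Qstar_form k \<mu>"
  using assms Q1minus_Q_form P1minus_Q_form hodge_Q_form
  unfolding Q1minus_star_def P1minus_star_def by blast+

lemma diff_op_dx_wedge_multi_affine:
  assumes "Q_form k \<omega>" shows "multi_affine (- \<beta>) (\<lambda>x. diff_op dx_wedge \<omega> x $ \<beta>)"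
proof -
  have "multi_affine (- \<beta>) (\<lambda>x. dx_wedge i (form_deriv i \<omega> x) $ \<beta>)" for i
  proof (cases "i \<in> \<beta>")
    case True
    then have "- (\<beta> - {i}) - {i} = - \<beta>" by auto
    moreover have "multi_affine (- (\<beta> - {i}) - {i}) (partial_deriv i (\<lambda>x. \<omega> x $ (\<beta> - {i})))"
      using assms unfolding Q_form_def by (intro multi_affine_partial_deriv) blast
    ultimately show ?thesis using True by (simp add: dx_wedge_nth form_deriv_def multi_affine_cmult)
  qed (simp add: dx_wedge_nth multi_affine.const)
  then show ?thesis by (simp add: diff_op_def multi_affine_sum)
qed

lemma diff_op_cod_symbol_multi_affine:
  assumes "Qstar_form k \<mu>" shows "multi_affine \<alpha> (\<lambda>x. diff_op cod_symbol \<mu> x $ \<alpha>)"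
proof -
  have "multi_affine \<alpha> (\<lambda>x. cod_symbol i (form_deriv i \<mu> x) $ \<alpha>)" for i
  proof (cases "i \<in> \<alpha>")
    case False
    then have "insert i \<alpha> - {i} = \<alpha>" by auto
    moreover have "multi_affine (insert i \<alpha> - {i}) (partial_deriv i (\<lambda>x. \<mu> x $ insert i \<alpha>))"
      using assms unfolding Qstar_form_def by (intro multi_affine_partial_deriv) blast
    ultimately show ?thesis
      using False multi_affine_cmult[of \<alpha> "partial_deriv i (\<lambda>x. \<mu> x $ insert i \<alpha>)" "- pos_sign i \<alpha>"]
      by (simp add: contract_nth form_deriv_def)
  qed (simp add: contract_nth multi_affine.const)
  then show ?thesis unfolding diff_op_def sum_component by (intro multi_affine_sum)
qed

lemma integral_inner_multi_affine:
  assumes "\<And>\<alpha>. multi_affine (- \<alpha>) (\<lambda>x. f x $ \<alpha>)" "\<And>\<alpha>. multi_affine \<alpha> (\<lambda>x. g x $ \<alpha>)"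
  shows "(LINT x|lebesgue_on (box a b). f x \<bullet> g x)
    = measure lebesgue (box a b) * (f ((1/2) *\<^sub>R (a + b)) \<bullet> g ((1/2) *\<^sub>R (a + b)))"
proof -
  have m: "multi_affine (- \<alpha> \<union> \<alpha>) (\<lambda>x. f x $ \<alpha> * g x $ \<alpha>)" for \<alpha>
    by (intro multi_affine_mult assms) auto
  have "integrable (lebesgue_on (box a b)) (\<lambda>x. f x $ \<alpha> * g x $ \<alpha>)" for \<alpha>
    using multi_affine_cont_diff[OF m, of 0] by (intro integrable_box) simp
  then show ?thesis
    by (simp add: inner_vec_def integral_multi_affine[OF m] sum_distrib_left)
qed

lemma L2form_bounded:
  assumes "continuous_on UNIV \<omega>" "\<And>x. \<omega> x \<in> alt k" "bounded K" "K \<in> sets lebesgue"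
  shows "\<omega> \<in> L2form k K"
  using assms unfolding L2form_iff by (blast intro: sqint_bounded_domain)

text \<open>On a box the pairing of the two tensor product families only sees the values of the two
  forms and of their derivatives at the midpoint. Here \<open>\<omega>'\<close> and \<open>\<mu>'\<close> are the polynomial
  representatives of \<open>\<omega>\<close> and \<open>\<mu>\<close>.\<close>

lemma dpair_midpoint:
  fixes \<omega> \<mu> :: "'n::{finite,linorder} dform"
  assumes k: "k < CARD('n)" and L2: "\<omega> \<in> L2form k (box a b)" "\<mu> \<in> L2form (Suc k) (box a b)"
    and AE: "AE x in lebesgue_on (box a b). \<omega> x = \<omega>' x" "AE x in lebesgue_on (box a b). \<mu> x = \<mu>' x"
    and Q: "Q_form k \<omega>'" "Qstar_form (Suc k) \<mu>'" and c: "c = (1/2) *\<^sub>R (a + b)"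
  shows "dpair k (box a b) \<omega> \<mu> = measure lebesgue (box a b) *
    (diff_op dx_wedge \<omega>' c \<bullet> \<mu>' c - \<omega>' c \<bullet> diff_op cod_symbol \<mu>' c)"
proof -
  note C1 = Q_form_C1[OF Q(1)] Qstar_form_C1[OF Q(2)]
  have alt: "\<And>x. \<omega>' x \<in> alt k" "\<And>x. \<mu>' x \<in> alt (Suc k)"
    using Q by (auto simp: Q_form_def Qstar_form_def)
  have D: "diff_op dx_wedge \<omega>' \<in> L2form (Suc k) (box a b)" "diff_op cod_symbol \<mu>' \<in> L2form k (box a b)"
    by (auto intro!: L2form_bounded diff_op_alt C1_form_continuous_diff_op C1 linear_dx_wedge linear_cod_symbol
        dx_wedge_alt cod_symbol_alt alt[THEN diff_op_alt])
  have sq: "sqint (lebesgue_on (box a b)) \<omega>'" "sqint (lebesgue_on (box a b)) \<mu>'"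
    by (auto intro!: sqint_bounded_domain C1_form_continuous C1)
  have w: "weak_deriv dx_wedge (box a b) \<omega>' (diff_op dx_wedge \<omega>')"
    "weak_deriv cod_symbol (box a b) \<mu>' (diff_op cod_symbol \<mu>')"
    by (auto intro!: weak_deriv_diff_op C1 linear_dx_wedge linear_cod_symbol)
  have "dpair k (box a b) \<omega> \<mu> = (LINT x|lebesgue_on (box a b). diff_op dx_wedge \<omega>' x \<bullet> \<mu>' x)
      - (LINT x|lebesgue_on (box a b). \<omega>' x \<bullet> diff_op cod_symbol \<mu>' x)"
    by (rule dpair_AE[OF open_box k L2 D sq AE w])
  moreover have "(LINT x|lebesgue_on (box a b). diff_op dx_wedge \<omega>' x \<bullet> \<mu>' x)
      = measure lebesgue (box a b) * (diff_op dx_wedge \<omega>' c \<bullet> \<mu>' c)"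
    unfolding c using Q diff_op_dx_wedge_multi_affine[OF Q(1)]
    by (intro integral_inner_multi_affine) (auto simp: Qstar_form_def)
  moreover have "(LINT x|lebesgue_on (box a b). \<omega>' x \<bullet> diff_op cod_symbol \<mu>' x)
      = measure lebesgue (box a b) * (\<omega>' c \<bullet> diff_op cod_symbol \<mu>' c)"
    unfolding c using Q diff_op_cod_symbol_multi_affine[OF Q(2)]
    by (intro integral_inner_multi_affine) (auto simp: Q_form_def)
  ultimately show ?thesis by (simp add: right_diff_distrib)
qed

lemma diff_op_affine:
  fixes L :: "'n::{finite,linorder} \<Rightarrow> 'n ext"
  shows "diff_op A (\<lambda>x. v + (\<Sum>j\<in>UNIV. x $ j *\<^sub>R L j)) x = (\<Sum>i\<in>UNIV. A i (L i))"
proof -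
  have "partial_deriv i (\<lambda>x::'n point. v $ \<alpha> + (\<Sum>j\<in>UNIV. x $ j * L j $ \<alpha>)) x = L i $ \<alpha>" for i \<alpha>
  proof -
    have "((\<lambda>x::'n point. v $ \<alpha> + (\<Sum>j\<in>UNIV. x $ j * L j $ \<alpha>)) has_derivative
        (\<lambda>h. \<Sum>j\<in>UNIV. h $ j * L j $ \<alpha>)) (at x)"
      by (auto intro!: derivative_eq_intros bounded_linear_imp_has_derivative bounded_linear_vec_nth)
    from partial_deriv_eq[OF this] show ?thesis
      by (simp add: axis_def if_distrib[of "\<lambda>r. r * _"] cong: if_cong)
  qed
  then show ?thesis by (simp add: diff_op_def form_deriv_def vec_eq_iff vec_lambda_eta)
qed

lemma diff_op_koszul:
  assumes "w \<in> alt (Suc k)"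
  shows "diff_op dx_wedge (\<lambda>x. v + koszul x w) x = real (Suc k) *\<^sub>R w"
  unfolding koszul_eq_contract diff_op_affine by (rule sum_dx_wedge_contract[OF assms])

section \<open>The interpolant of a tensor product form\<close>

lemma P1minusE:
  assumes "\<omega> \<in> P1minus k"
  obtains v w where "v \<in> alt k" "w \<in> alt (Suc k)" "\<omega> = (\<lambda>x. v + koszul x w)"
  using assms by (auto simp: P1minus_def P0_def)

lemma P1minusI: "v \<in> alt k \<Longrightarrow> w \<in> alt (Suc k) \<Longrightarrow> (\<lambda>x. v + koszul x w) \<in> P1minus k"
  unfolding P1minus_def P0_def by (intro CollectI exI[of _ "\<lambda>x. v"] exI[of _ "\<lambda>x. w"]) auto

text \<open>The value and the exterior derivative of a Whitney form at a given point \<open>c\<close> can be prescribed: take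
  \<open>v + koszul (x - c) w / (k + 1)\<close>.\<close>

lemma P1minus_jet:
  assumes v: "v \<in> alt k" and w: "w \<in> alt (Suc k)"
  obtains \<sigma> where "\<sigma> \<in> P1minus k" "\<sigma> c = v" "diff_op dx_wedge \<sigma> c = w"
proof
  let ?w = "(1 / real (Suc k)) *\<^sub>R w"
  let ?\<sigma> = "\<lambda>x. (v - koszul c ?w) + koszul x ?w"
  have w': "?w \<in> alt (Suc k)" by (rule alt_scaleR[OF w])
  show "?\<sigma> \<in> P1minus k" by (intro P1minusI alt_diff v koszul_alt w')
  show "?\<sigma> c = v" by simp
  show "diff_op dx_wedge ?\<sigma> c = w" by (simp add: diff_op_koszul[OF w'] del: of_nat_Suc)
qed

lemma L2form_Q_form: "Q_form k \<omega> \<Longrightarrow> \<omega> \<in> L2form k (box a b)"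
  using Q_form_C1[THEN C1_form_continuous] by (intro L2form_bounded) (auto simp: Q_form_def)

lemma L2form_Qstar_form: "Qstar_form k \<omega> \<Longrightarrow> \<omega> \<in> L2form k (box a b)"
  using Qstar_form_C1[THEN C1_form_continuous] by (intro L2form_bounded) (auto simp: Qstar_form_def)

lemma dpair_midpoint_forms:
  fixes \<omega> \<mu> :: "'n::{finite,linorder} dform"
  assumes "k < CARD('n)" "Q_form k \<omega>" "Qstar_form (Suc k) \<mu>"
  defines "c \<equiv> \<lambda>a b. (1/2) *\<^sub>R (a + b)"
  shows "dpair k (box a b) \<omega> \<mu> = measure lebesgue (box a b) *
    (diff_op dx_wedge \<omega> (c a b) \<bullet> \<mu> (c a b) - \<omega> (c a b) \<bullet> diff_op cod_symbol \<mu> (c a b))"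
  unfolding c_def
  by (rule dpair_midpoint[OF assms(1) L2form_Q_form[OF assms(2)] L2form_Qstar_form[OF assms(3)] _ _ assms(2,3) refl]) auto

lemma P1minus_star_const:
  fixes v :: "'n::{finite,linorder} ext"
  assumes v: "v \<in> alt k" and k: "k \<le> CARD('n)"
  shows "(\<lambda>x. v) \<in> P1minus_star k"
proof -
  obtain w where w: "w \<in> alt (CARD('n) - k)" "hodge w = v" by (rule hodge_surj[OF v k])
  have "(\<lambda>x. hodge (w + koszul x 0)) \<in> P1minus_star k"
    unfolding P1minus_star_def by (rule image_eqI[OF _ P1minusI[OF w(1) alt_0]]) simp
  then show ?thesis using w(2) by (simp add: koszul_eq_contract linear_0[OF linear_contract])
qed

text \<open>The form \<open>\<Sum>\<^sub>i x\<^sub>i dx\<^sub>i \<and> v\<close> is the Hodge star of a Koszul form; its codifferential is a nonzero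
  multiple of \<open>v\<close>.\<close>

lemma P1minus_star_wedge:
  fixes v :: "'n::{finite,linorder} ext"
  assumes v: "v \<in> alt k" and k: "k < CARD('n)"
  shows "(\<lambda>x. 0 + (\<Sum>i\<in>UNIV. x $ i *\<^sub>R dx_wedge i v)) \<in> P1minus_star (Suc k)"
proof -
  define s :: real where "s = (-1) ^ (CARD('n) - Suc k)"
  have s: "s * s = 1" by (simp add: s_def power_mult_distrib[symmetric])
  obtain q where q: "q \<in> alt (CARD('n) - k)" "hodge q = v" by (rule hodge_surj[OF v less_imp_le[OF k]])
  have q': "q \<in> alt (Suc (CARD('n) - Suc k))" using q(1) by (simp only: Suc_diff_Suc[OF k])
  have "hodge (0 + koszul x (s *\<^sub>R q)) = 0 + (\<Sum>i\<in>UNIV. x $ i *\<^sub>R dx_wedge i v)" for x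
  proof -
    have "s *\<^sub>R hodge (contract i q) = dx_wedge i v" for i
      using dx_wedge_hodge[OF q'] q(2) by (simp add: s_def)
    then show ?thesis
      by (simp add: koszul_eq_contract linear_sum[OF linear_hodge] linear_cmul[OF linear_hodge]
          linear_cmul[OF linear_contract] mult.commute[of _ s] flip: scaleR_scaleR)
  qed
  then show ?thesis
    unfolding P1minus_star_def
    by (intro image_eqI[of _ _ "\<lambda>x. 0 + koszul x (s *\<^sub>R q)"] P1minusI alt_0 alt_scaleR q') (simp only:)
qed

lemma measure_box_pos:
  assumes "box a b \<noteq> {}" shows "measure lebesgue (box a b :: 'a::euclidean_space set) > 0"
proof -
  have "\<not> negligible (box a b)" using assms by (intro open_not_negligible) auto
  then have "measure lebesgue (box a b) \<noteq> 0" by (simp add: negligible_iff_measure0)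
  then show ?thesis using measure_nonneg[of lebesgue "box a b"] by linarith
qed

text \<open>Constant test forms determine the exterior derivative of a Whitney form; once it is known, the
  test forms of \<open>P1minus_star_wedge\<close> determine the value at the midpoint.\<close>

lemma P1minus_unisolvent:
  fixes \<sigma> \<tau> :: "'n::{finite,linorder} dform"
  assumes k: "k < CARD('n)" and ne: "box a b \<noteq> {}" and \<sigma>: "\<sigma> \<in> P1minus k" "\<tau> \<in> P1minus k"
    and eq: "\<And>\<mu>. \<mu> \<in> P1minus_star (Suc k) \<Longrightarrow> dpair k (box a b) \<sigma> \<mu> = dpair k (box a b) \<tau> \<mu>"
  shows "\<sigma> = \<tau>"
proof -
  have meas: "measure lebesgue (box a b) > 0"
    by (rule measure_box_pos[OF ne])
  define c where "c = (1/2) *\<^sub>R (a + b)"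
  have id: "(diff_op dx_wedge \<sigma> c - diff_op dx_wedge \<tau> c) \<bullet> \<mu> c = (\<sigma> c - \<tau> c) \<bullet> diff_op cod_symbol \<mu> c"
    if \<mu>: "\<mu> \<in> P1minus_star (Suc k)" for \<mu>
    using eq[OF \<mu>] meas dpair_midpoint_forms[OF k P1minus_Q_form[OF \<sigma>(1)] star_forms(2)[OF _ \<mu>], of a b]
      dpair_midpoint_forms[OF k P1minus_Q_form[OF \<sigma>(2)] star_forms(2)[OF _ \<mu>], of a b] k
    by (simp add: c_def inner_diff_left)
  obtain v w where vw: "v \<in> alt k" "w \<in> alt (Suc k)" "\<sigma> = (\<lambda>x. v + koszul x w)" by (rule P1minusE[OF \<sigma>(1)])
  obtain v' w' where vw': "v' \<in> alt k" "w' \<in> alt (Suc k)" "\<tau> = (\<lambda>x. v' + koszul x w')" by (rule P1minusE[OF \<sigma>(2)])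
  have D: "diff_op dx_wedge \<sigma> c - diff_op dx_wedge \<tau> c = real (Suc k) *\<^sub>R (w - w')"
    by (simp only: vw(3) vw'(3) diff_op_koszul[OF vw(2)] diff_op_koszul[OF vw'(2)] scaleR_right_diff_distrib)
  have "w = w'"
  proof -
    have m: "w - w' \<in> alt (Suc k)" by (rule alt_diff[OF vw(2) vw'(2)])
    have "diff_op cod_symbol (\<lambda>x. w - w') c = 0"
      using diff_op_affine[of cod_symbol "w - w'" "\<lambda>_. 0" c] by (simp add: linear_0[OF linear_contract])
    then have "(real (Suc k) *\<^sub>R (w - w')) \<bullet> (w - w') = 0"
      using id[OF P1minus_star_const[OF m]] k unfolding D by simp
    then show ?thesis by (simp del: of_nat_Suc)
  qed
  then have diff: "\<sigma> c - \<tau> c = v - v'" by (simp add: vw(3) vw'(3))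
  have m: "v - v' \<in> alt k" by (rule alt_diff[OF vw(1) vw'(1)])
  have "diff_op cod_symbol (\<lambda>x. 0 + (\<Sum>i\<in>UNIV. x $ i *\<^sub>R dx_wedge i (v - v'))) c
      = - (real (CARD('n) - k) *\<^sub>R (v - v'))"
    by (simp only: diff_op_affine sum_negf sum_contract_dx_wedge[OF m])
  then have "(v - v') \<bullet> (real (CARD('n) - k) *\<^sub>R (v - v')) = 0"
    using id[OF P1minus_star_wedge[OF m k]] \<open>w = w'\<close> unfolding D diff by simp
  then have "v = v'" using k by simp
  then show ?thesis using \<open>w = w'\<close> by (simp add: vw(3) vw'(3))
qed

text \<open>The interpolant of a form in \<open>Q1minus k\<close> has the same pairing not just with the Whitney forms
  used to define it but with all of \<open>Q1minus_star (Suc k)\<close>: by the midpoint formula it suffices to match the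
  value and the exterior derivative at the midpoint.\<close>

lemma interp_Q1minus:
  fixes \<omega> :: "'n::{finite,linorder} dform"
  assumes k: "k < CARD('n)" and ne: "box a b \<noteq> {}"
    and \<omega>: "\<omega> \<in> L2form k (box a b)" and q: "q \<in> Q1minus k" and AE: "AE x in lebesgue_on (box a b). \<omega> x = q x"
  shows "interp k (box a b) \<omega> \<in> P1minus k"
    and "\<mu> \<in> L2form (Suc k) (box a b) \<Longrightarrow> r \<in> Q1minus_star (Suc k) \<Longrightarrow> AE x in lebesgue_on (box a b). \<mu> x = r x
      \<Longrightarrow> dpair k (box a b) (interp k (box a b) \<omega>) \<mu> = dpair k (box a b) \<omega> \<mu>"
proof -
  define c where "c = (1/2) *\<^sub>R (a + b)"
  note Qq = Q1minus_Q_form[OF q]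
  have alt: "\<And>x. q x \<in> alt k" using Qq by (simp add: Q_form_def)
  have "diff_op dx_wedge q c \<in> alt (Suc k)" by (rule diff_op_alt[OF alt dx_wedge_alt])
  then obtain \<sigma> where \<sigma>: "\<sigma> \<in> P1minus k" "\<sigma> c = q c" "diff_op dx_wedge \<sigma> c = diff_op dx_wedge q c"
    by (rule P1minus_jet[OF alt])
  note Q\<sigma> = P1minus_Q_form[OF \<sigma>(1)]
  have pair: "dpair k (box a b) \<sigma> \<mu> = dpair k (box a b) \<omega> \<mu>"
    if "\<mu> \<in> L2form (Suc k) (box a b)" "Qstar_form (Suc k) r" "AE x in lebesgue_on (box a b). \<mu> x = r x" for \<mu> r
    unfolding dpair_midpoint[OF k \<omega> that(1) AE that(3) Qq that(2) c_def]
      dpair_midpoint[OF k L2form_Q_form[OF Q\<sigma>] that(1) AE_I2[OF refl] that(3) Q\<sigma> that(2) c_def] \<sigma>(2,3) ..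
  have "interp k (box a b) \<omega> = \<sigma>"
    unfolding interp_def if_P[OF k]
  proof (rule the_equality)
    have "dpair k (box a b) \<sigma> \<mu> = dpair k (box a b) \<omega> \<mu>" if "\<mu> \<in> P1minus_star (Suc k)" for \<mu>
      using star_forms(2)[OF _ that] k by (intro pair[of _ \<mu>] L2form_Qstar_form) auto
    then show \<sigma>': "\<sigma> \<in> P1minus k \<and> (\<forall>\<mu>\<in>P1minus_star (Suc k). dpair k (box a b) \<sigma> \<mu> = dpair k (box a b) \<omega> \<mu>)"
      using \<sigma>(1) by blast
    show "\<tau> = \<sigma>" if "\<tau> \<in> P1minus k \<and> (\<forall>\<mu>\<in>P1minus_star (Suc k). dpair k (box a b) \<tau> \<mu> = dpair k (box a b) \<omega> \<mu>)" for \<tau>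
      using that \<sigma>' by (intro P1minus_unisolvent[OF k ne]) auto
  qed
  note interp = this
  show "interp k (box a b) \<omega> \<in> P1minus k" unfolding interp by (rule \<sigma>(1))
  show "dpair k (box a b) (interp k (box a b) \<omega>) \<mu> = dpair k (box a b) \<omega> \<mu>"
    if "\<mu> \<in> L2form (Suc k) (box a b)" "r \<in> Q1minus_star (Suc k)" "AE x in lebesgue_on (box a b). \<mu> x = r x"
    unfolding interp using pair[OF that(1) star_forms(1)[OF _ that(2)] that(3)] k by simp
qed

text \<open>In top degree the interpolant is an \<open>L\<^sup>2\<close> projection, and forms in \<open>Q1minus\<close> are constant.\<close>

lemma interp_top:
  fixes \<omega> :: "'n::{finite,linorder} dform"
  assumes ne: "box a b \<noteq> {}"
    and \<omega>: "\<omega> \<in> L2form CARD('n) (box a b)" and q: "q \<in> Q1minus CARD('n)" and AE: "AE x in lebesgue_on (box a b). \<omega> x = q x"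
  shows "interp CARD('n) (box a b) \<omega> \<in> P1minus CARD('n)"
proof -
  have meas: "measure lebesgue (box a b) > 0"
    by (rule measure_box_pos[OF ne])
  note Qq = Q1minus_Q_form[OF q]
  have const: "q x = q 0" for x
  proof (rule vec_eq_iff[THEN iffD2], rule allI)
    fix \<alpha> :: "'n set"
    show "q x $ \<alpha> = q 0 $ \<alpha>"
    proof (cases "card \<alpha> = CARD('n)")
      case True
      then have "\<alpha> = UNIV" by (simp add: card_eq_UNIV_imp_eq_UNIV)
      then have "multi_affine {} (\<lambda>x. q x $ \<alpha>)" using Qq unfolding Q_form_def by (metis Compl_UNIV_eq)
      then show ?thesis by (rule multi_affine_depends) simp
    next
      case False
      then show ?thesis using Qq altD[of "q _" "CARD('n)" \<alpha>] by (simp add: Q_form_def)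
    qed
  qed
  have q0: "q 0 \<in> alt CARD('n)" using Qq by (simp add: Q_form_def)
  have L2: "L2inner (box a b) (\<lambda>x. v) (\<lambda>x. w) = measure lebesgue (box a b) * (v \<bullet> w)" for v w :: "'n ext"
    by (simp add: L2inner_def measure_restrict_space)
  have sq: "sqint (lebesgue_on (box a b)) (\<lambda>x. v)" for v :: "'n ext"
    by (intro sqint_bounded_domain) auto
  have L2\<omega>: "L2inner (box a b) \<omega> (\<lambda>x. w) = measure lebesgue (box a b) * (q 0 \<bullet> w)" for w
    unfolding L2[symmetric] L2inner_def using AE const
    by (intro integral_inner_cong_AE L2form_sqint[OF \<omega>] sq) auto
  have "interp CARD('n) (box a b) \<omega> = (\<lambda>x. q 0)"
    unfolding interp_def if_not_P[OF less_irrefl]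
  proof (rule the_equality)
    show "(\<lambda>x. q 0) \<in> P0 CARD('n) \<and> (\<forall>\<mu>\<in>P0 CARD('n). L2inner (box a b) (\<lambda>x. q 0) \<mu> = L2inner (box a b) \<omega> \<mu>)"
      using q0 by (auto simp: P0_def L2 L2\<omega>)
    fix \<tau> assume \<tau>: "\<tau> \<in> P0 CARD('n) \<and> (\<forall>\<mu>\<in>P0 CARD('n). L2inner (box a b) \<tau> \<mu> = L2inner (box a b) \<omega> \<mu>)"
    then obtain v where v: "\<tau> = (\<lambda>x. v)" "v \<in> alt CARD('n)" by (auto simp: P0_def)
    have "(\<lambda>x. v - q 0) \<in> P0 CARD('n)" using alt_diff[OF v(2) q0] by (auto simp: P0_def)
    then have "v \<bullet> (v - q 0) = q 0 \<bullet> (v - q 0)" using \<tau> meas by (auto simp: v(1) L2 L2\<omega>)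
    then have "(v - q 0) \<bullet> (v - q 0) = 0" by (simp add: inner_diff_left)
    then show "\<tau> = (\<lambda>x. q 0)" by (simp add: v(1))
  qed
  \<comment> \<open>There are no nonzero forms of degree above the dimension, so \<open>P1minus\<close> consists of constants here.\<close>
  moreover have "(\<lambda>x. q 0 + koszul x 0) \<in> P1minus CARD('n)" by (intro P1minusI q0 alt_0)
  ultimately show ?thesis by (simp add: koszul_eq_contract linear_0[OF linear_contract])
qed

lemma piecewise_inE:
  assumes "piecewise_in \<G> S \<omega>" "K \<in> \<G>"
  obtains q where "q \<in> S" "AE x in lebesgue_on (interior K). \<omega> x = q x"
  using assms unfolding piecewise_in_def by blast

lemma mesh_cell:
  assumes "cubical_mesh \<Omega> \<G>" "K \<in> \<G>"
  obtains a b where "interior K = box a b" "box a b \<noteq> {}" "box a b \<subseteq> \<Omega>"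
proof -
  obtain a b where "K = cbox a b" using assms unfolding cubical_mesh_def by blast
  then have "interior K = box a b" by (simp add: interior_cbox)
  moreover have "interior K \<noteq> {}" "interior K \<subseteq> \<Omega>" using assms unfolding cubical_mesh_def by auto
  ultimately show ?thesis using that by metis
qed

lemma interp_mesh_P1minus:
  fixes \<omega> :: "'n::{finite,linorder} dform"
  assumes mesh: "cubical_mesh \<Omega> \<G>" and \<Omega>: "open \<Omega>" and k: "k \<le> CARD('n)"
    and \<omega>: "\<omega> \<in> HL k \<Omega>" "piecewise_in \<G> (Q1minus k) \<omega>"
  shows "interp_mesh k \<G> \<omega> \<in> P1minus_mesh k \<G>"
  unfolding interp_mesh_def P1minus_mesh_def
proof (intro restrict_PiE_iff[THEN iffD2] ballI)
  fix K assume K: "K \<in> \<G>"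
  obtain a b where ab: "interior K = box a b" "box a b \<noteq> {}" "box a b \<subseteq> \<Omega>" by (rule mesh_cell[OF mesh K])
  have L2: "\<omega> \<in> L2form k (box a b)"
    using \<Omega> by (intro L2form_restrict[OF HL_D(1)[OF \<omega>(1)] ab(3)]) auto
  obtain q where q: "q \<in> Q1minus k" "AE x in lebesgue_on (box a b). \<omega> x = q x"
    by (rule piecewise_inE[OF \<omega>(2) K, unfolded ab(1)])
  show "interp k (interior K) \<omega> \<in> P1minus k"
  proof (cases "k < CARD('n)")
    case True
    show ?thesis unfolding ab(1) by (rule interp_Q1minus(1)[OF True ab(2) L2 q])
  next
    case False
    then have "k = CARD('n)" using k by simp
    then show ?thesis using interp_top[OF ab(2) _ _ q(2)] L2 q(1) ab(1) by simp
  qed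
qed

lemma sum_dpair_interp_mesh:
  fixes \<omega> \<mu> :: "'n::{finite,linorder} dform"
  assumes mesh: "cubical_mesh \<Omega> \<G>" and \<Omega>: "open \<Omega>" and k: "k < CARD('n)"
    and \<omega>: "\<omega> \<in> HL k \<Omega>" "piecewise_in \<G> (Q1minus k) \<omega>"
    and \<mu>: "\<mu> \<in> HLstar (Suc k) \<Omega>" "piecewise_in \<G> (Q1minus_star (Suc k)) \<mu>"
  shows "(\<Sum>K\<in>\<G>. dpair k (interior K) (interp_mesh k \<G> \<omega> K) \<mu>) = (\<Sum>K\<in>\<G>. dpair k (interior K) \<omega> \<mu>)"
proof (rule sum.cong[OF refl])
  fix K assume K: "K \<in> \<G>"
  obtain a b where ab: "interior K = box a b" "box a b \<noteq> {}" "box a b \<subseteq> \<Omega>" by (rule mesh_cell[OF mesh K])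
  have L2: "\<omega> \<in> L2form k (box a b)" "\<mu> \<in> L2form (Suc k) (box a b)"
    using \<Omega> by (auto intro!: L2form_restrict[OF HL_D(1)[OF \<omega>(1)] ab(3)] L2form_restrict[OF HLstar_D(1)[OF \<mu>(1) k] ab(3)])
  obtain q where q: "q \<in> Q1minus k" "AE x in lebesgue_on (box a b). \<omega> x = q x"
    by (rule piecewise_inE[OF \<omega>(2) K, unfolded ab(1)])
  obtain r where r: "r \<in> Q1minus_star (Suc k)" "AE x in lebesgue_on (box a b). \<mu> x = r x"
    by (rule piecewise_inE[OF \<mu>(2) K, unfolded ab(1)])
  show "dpair k (interior K) (interp_mesh k \<G> \<omega> K) \<mu> = dpair k (interior K) \<omega> \<mu>"
    using interp_Q1minus(2)[OF k ab(2) L2(1) q L2(2) r] K by (simp add: interp_mesh_def ab(1))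
qed

theorem lemma4p1:
  fixes \<Omega> :: "'n::{finite,linorder} point set"
    and \<G> :: "'n point set set"
    and k :: nat
  assumes "open \<Omega>" and "connected \<Omega>" and "\<Omega> \<noteq> {}" and "bounded \<Omega>"
    and "cubical_mesh \<Omega> \<G>"
    and "k \<le> CARD('n)"
  shows "interp_mesh k \<G> ` VQ k \<Omega> \<G> \<subseteq> Wdef k \<Omega> \<G>
    \<and> interp_mesh k \<G> ` VQ0 k \<Omega> \<G> \<subseteq> Wdef0 k \<Omega> \<G>"
proof (intro conjI image_subsetI)
  note \<Omega> = assms(1) and mesh = assms(5) and k = assms(6)
  fix \<omega> assume "\<omega> \<in> VQ k \<Omega> \<G>"
  then have \<omega>: "\<omega> \<in> HL k \<Omega>" "piecewise_in \<G> (Q1minus k) \<omega>" by (auto simp: VQ_def)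
  have "(\<Sum>K\<in>\<G>. dpair k (interior K) (interp_mesh k \<G> \<omega> K) \<mu>) = 0"
    if kn: "k < CARD('n)" and "\<mu> \<in> VQstar0 (Suc k) \<Omega> \<G>" for \<mu>
  proof -
    have \<mu>0: "\<mu> \<in> HLstar0 (Suc k) \<Omega>" and pw: "piecewise_in \<G> (Q1minus_star (Suc k)) \<mu>"
      using that by (auto simp: VQstar0_def)
    then have \<mu>: "\<mu> \<in> HLstar (Suc k) \<Omega>" by (simp add: HLstar0_def)
    show ?thesis
      using sum_dpair_interp_mesh[OF mesh \<Omega> kn \<omega> \<mu> pw] sum_dpair_cells[OF mesh \<Omega> kn \<omega>(1) \<mu>]
        HLstar0_green[OF \<Omega> kn \<omega>(1) \<mu>0] by simp
  qed
  then show "interp_mesh k \<G> \<omega> \<in> Wdef k \<Omega> \<G>"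
    using interp_mesh_P1minus[OF mesh \<Omega> k \<omega>] by (simp add: Wdef_def)
next
  note \<Omega> = assms(1) and mesh = assms(5) and k = assms(6)
  fix \<omega> assume "\<omega> \<in> VQ0 k \<Omega> \<G>"
  then have \<omega>0: "\<omega> \<in> HL0 k \<Omega>" and pw\<omega>: "piecewise_in \<G> (Q1minus k) \<omega>" by (auto simp: VQ0_def)
  then have \<omega>: "\<omega> \<in> HL k \<Omega>" by (simp add: HL0_def)
  have "(\<Sum>K\<in>\<G>. dpair k (interior K) (interp_mesh k \<G> \<omega> K) \<mu>) = 0"
    if kn: "k < CARD('n)" and "\<mu> \<in> VQstar (Suc k) \<Omega> \<G>" for \<mu>
  proof -
    have \<mu>: "\<mu> \<in> HLstar (Suc k) \<Omega>" and pw: "piecewise_in \<G> (Q1minus_star (Suc k)) \<mu>"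
      using that by (auto simp: VQstar_def)
    show ?thesis
      using sum_dpair_interp_mesh[OF mesh \<Omega> kn \<omega> pw\<omega> \<mu> pw] sum_dpair_cells[OF mesh \<Omega> kn \<omega> \<mu>]
        HL0_green[OF \<Omega> kn \<omega>0 \<mu>] by simp
  qed
  then show "interp_mesh k \<G> \<omega> \<in> Wdef0 k \<Omega> \<G>"
    using interp_mesh_P1minus[OF mesh \<Omega> k \<omega> pw\<omega>] by (simp add: Wdef0_def)
qed

end
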